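(* Let $\mathcal{M}$ be a II$_1$-factor with separable predual and tracial state $\tau$. Let $E$ be a Calkin function space on $[0,1]$ and let $F$ be a strictly larger Calkin function space on $[0,1]$ (i.e. $E\subsetneq F$), with corresponding $\mathcal{M}$-bimodules $\mathcal{E}(\mathcal{M},\tau)$ and $\mathcal{F}(\mathcal{M},\tau)$. If $\psi$ is an arbitrary positive trace on $\mathcal{F}(\mathcal{M},\tau)$, then $$\det\nolimits_\psi\restriction_{\mathcal{E}_{\log}(\mathcal{M},\tau)}\neq\det\nolimits_{\varphi}$$ for each positive trace $\varphi$ on $\mathcal{E}(\mathcal{M},\tau)$.
   Context: $\mathcal{S}(\mathcal{M},\tau)$ denotes the $*$-algebra of (possibly unbounded) closed densely defined operators affiliated to $\mathcal{M}$ (the Murray–von Neumann algebra). For $A\in\mathcal{S}(\mathcal{M},\tau)$ and $t\in(0,1)$, $\mu(t,A)=\inf\{\|A(1-p)\| : p\in\mathcal{M}\text{ a projection},\ \tau(p)\le t\}$, and $\mu(A)$ is the function $t\mapsto\mu(t,A)$. Functions on $[0,1]$ that agree almost everywhere are identified. A Calkin function space $G$ is a complex vector space of measurable functions on $[0,1]$ such that if $f,g$ are measurable, $f^*\le g^*$ and $g\in G$, then $f\in G$, where $f^*$ denotes the decreasing rearrangement of $|f|$. The corresponding $\mathcal{M}$-bimodule is $\mathcal{G}(\mathcal{M},\tau)=\{A\in\mathcal{S}(\mathcal{M},\tau) : \mu(A)\in G\}$ (so $\mathcal{E}(\mathcal{M},\tau)$ corresponds to $E$ and $\mathcal{F}(\mathcal{M},\tau)$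 to $F$). A trace on $\mathcal{G}(\mathcal{M},\tau)$ is a linear functional $\varphi:\mathcal{G}(\mathcal{M},\tau)\to\mathbb{C}$ with $\varphi(UAU^* )=\varphi(A)$ for all $A\in\mathcal{G}(\mathcal{M},\tau)$ and all unitaries $U\in\mathcal{M}$; it is positive if $A\ge0$ implies $\varphi(A)\ge0$. Write $\log_+(t)=\max(\log t,0)$ and $\log_-(t)=-\min(\log t,0)$. Let $\mathcal{G}_{\log}(\mathcal{M},\tau)$ be the set of all $T\in\mathcal{S}(\mathcal{M},\tau)$ such that $\log_+(|T|)\in\mathcal{G}(\mathcal{M},\tau)$. For a positive trace $\varphi$ on $\mathcal{G}(\mathcal{M},\tau)$ and $T\in\mathcal{G}_{\log}(\mathcal{M},\tau)$ define $\det_\varphi(T)=\exp(\varphi(\log|T|))$ if $\ker T=\{0\}$ and $\log_-(|T|)\in\mathcal{G}(\mathcal{M},\tau)$; and $\det_\varphi(T)=0$ otherwise. Note $\mathcal{E}_{\log}(\mathcal{M},\tau)\subseteq\mathcal{F}_{\log}(\mathcal{M},\tau)$ when $E\subseteq F$. *)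

theory Defs
  imports "HOL-Analysis.Analysis"
begin

section \<open>Complex Hilbert spaces\<close>

text \<open>The complex inner product is linear in the first argument.  The norm, the topology and
  completeness come from the underlying real Hilbert space, whose inner product is the real part
  of the complex one.\<close>

class complex_hilbert = real_inner + complete_space +
  fixes scaleC :: "complex \<Rightarrow> 'a \<Rightarrow> 'a" (infixr "*\<^sub>C" 75)
    and cinner :: "'a \<Rightarrow> 'a \<Rightarrow> complex"
  assumes scaleC_add_right: "c *\<^sub>C (x + y) = c *\<^sub>C x + c *\<^sub>C y"
    and scaleC_add_left: "(c + d) *\<^sub>C x = c *\<^sub>C x + d *\<^sub>C x"
    and scaleC_scaleC: "c *\<^sub>C d *\<^sub>C x = (c * d) *\<^sub>C x"
    and scaleC_of_real: "complex_of_real r *\<^sub>C x = r *\<^sub>R x"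
    and cinner_add_left: "cinner (x + y) z = cinner x z + cinner y z"
    and cinner_scaleC_left: "cinner (c *\<^sub>C x) z = c * cinner x z"
    and cinner_commute: "cinner x y = cnj (cinner y x)"
    and inner_eq_Re_cinner: "inner x y = Re (cinner x y)"
begin

subclass banach ..

end

lemma cinner_scaleC_right: "cinner x (c *\<^sub>C y) = cnj c * cinner x y"
  by (metis cinner_commute cinner_scaleC_left complex_cnj_mult)

lemma norm_scaleC: "norm (c *\<^sub>C x) = cmod c * norm (x :: 'h::complex_hilbert)"
proof -
  have "inner (c *\<^sub>C x) (c *\<^sub>C x) = Re ((c * cnj c) * cinner x x)"
    by (simp only: inner_eq_Re_cinner cinner_scaleC_left cinner_scaleC_right ac_simps)
  also have "\<dots> = (cmod c)\<^sup>2 * inner x x"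
    by (simp only: complex_norm_square[symmetric] inner_eq_Re_cinner) simp
  finally show ?thesis
    by (simp add: norm_eq_sqrt_inner real_sqrt_mult)
qed

lift_definition scalar_op :: "complex \<Rightarrow> 'h::complex_hilbert \<Rightarrow>\<^sub>L 'h" is "\<lambda>c x. c *\<^sub>C x"
proof (rule bounded_linear_intro)
  fix c and x y :: 'h and r :: real
  show "c *\<^sub>C (x + y) = c *\<^sub>C x + c *\<^sub>C y"
    by (rule scaleC_add_right)
  show "c *\<^sub>C r *\<^sub>R x = r *\<^sub>R c *\<^sub>C x"
    by (metis mult.commute scaleC_of_real scaleC_scaleC)
  show "norm (c *\<^sub>C x) \<le> norm x * cmod c"
    by (simp add: norm_scaleC)
qed

section \<open>Bounded operators and von Neumann algebras\<close>

text \<open>The type \<open>'h \<Rightarrow>\<^sub>L 'h\<close> consists of the bounded real-linear maps.\<close>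

definition bounded_ops :: "('h::complex_hilbert \<Rightarrow>\<^sub>L 'h) set" where
  "bounded_ops = {A. \<forall>c x. blinfun_apply A (c *\<^sub>C x) = c *\<^sub>C blinfun_apply A x}"

definition adj :: "('h::complex_hilbert \<Rightarrow>\<^sub>L 'h) \<Rightarrow> 'h \<Rightarrow>\<^sub>L 'h" where
  "adj A = (THE B. \<forall>x y. cinner (blinfun_apply A x) y = cinner x (blinfun_apply B y))"

definition commutant :: "('h::complex_hilbert \<Rightarrow>\<^sub>L 'h) set \<Rightarrow> ('h \<Rightarrow>\<^sub>L 'h) set" where
  "commutant M = {T \<in> bounded_ops. \<forall>A\<in>M. T o\<^sub>L A = A o\<^sub>L T}"

definition von_neumann_algebra :: "('h::complex_hilbert \<Rightarrow>\<^sub>L 'h) set \<Rightarrow> bool" where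
  "von_neumann_algebra M \<longleftrightarrow>
     M \<subseteq> bounded_ops \<and> (\<forall>A\<in>M. adj A \<in> M) \<and> commutant (commutant M) = M"

definition factor :: "('h::complex_hilbert \<Rightarrow>\<^sub>L 'h) set \<Rightarrow> bool" where
  "factor M \<longleftrightarrow> von_neumann_algebra M \<and> M \<inter> commutant M = range scalar_op"

definition projections :: "('h::complex_hilbert \<Rightarrow>\<^sub>L 'h) set \<Rightarrow> ('h \<Rightarrow>\<^sub>L 'h) set" where
  "projections M = {p \<in> M. p o\<^sub>L p = p \<and> adj p = p}"

definition unitaries :: "('h::complex_hilbert \<Rightarrow>\<^sub>L 'h) set \<Rightarrow> ('h \<Rightarrow>\<^sub>L 'h) set" where
  "unitaries M = {U \<in> M. adj U o\<^sub>L U = id_blinfun \<and> U o\<^sub>L adj U = id_blinfun}"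

text \<open>Murray--von Neumann type: type II\<open>\<^sub>1\<close> means that the identity is a finite projection and
  that there are no minimal projections (in a factor, the nonzero abelian projections are exactly
  the minimal ones).\<close>

definition II1_factor :: "('h::complex_hilbert \<Rightarrow>\<^sub>L 'h) set \<Rightarrow> bool" where
  "II1_factor M \<longleftrightarrow> factor M \<and>
     (\<forall>V\<in>M. adj V o\<^sub>L V = id_blinfun \<longrightarrow> V o\<^sub>L adj V = id_blinfun) \<and>
     (\<forall>p\<in>projections M. p \<noteq> 0 \<longrightarrow> (\<exists>q\<in>projections M. p o\<^sub>L q = q \<and> q \<noteq> 0 \<and> q \<noteq> p))"

text \<open>The predual, realised as the space of ultraweakly continuous functionals on \<open>M\<close>, with the
  norm of the dual of \<open>M\<close>.\<close>

definition predual :: "('h::complex_hilbert \<Rightarrow>\<^sub>L 'h) set \<Rightarrow> (('h \<Rightarrow>\<^sub>L 'h) \<Rightarrow> complex) set" where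
  "predual M = {(\<lambda>A\<in>M. \<Sum>n. cinner (blinfun_apply A (x n)) (y n)) | x y :: nat \<Rightarrow> 'h.
      summable (\<lambda>n. (norm (x n))\<^sup>2) \<and> summable (\<lambda>n. (norm (y n))\<^sup>2)}"

definition separable_predual :: "('h::complex_hilbert \<Rightarrow>\<^sub>L 'h) set \<Rightarrow> bool" where
  "separable_predual M \<longleftrightarrow>
     (\<exists>D \<subseteq> predual M. countable D \<and>
        (\<forall>\<omega>\<in>predual M. \<forall>\<epsilon>>0. \<exists>\<omega>'\<in>D. \<forall>A\<in>M. norm A \<le> 1 \<longrightarrow> cmod (\<omega> A - \<omega>' A) \<le> \<epsilon>))"

definition tracial_state ::
  "('h::complex_hilbert \<Rightarrow>\<^sub>L 'h) set \<Rightarrow> (('h \<Rightarrow>\<^sub>L 'h) \<Rightarrow> complex) \<Rightarrow> bool" where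
  "tracial_state M \<tau> \<longleftrightarrow>
     (\<forall>A\<in>M. \<forall>B\<in>M. \<tau> (A + B) = \<tau> A + \<tau> B) \<and>
     (\<forall>c. \<forall>A\<in>M. \<tau> (scalar_op c o\<^sub>L A) = c * \<tau> A) \<and>
     (\<forall>A\<in>M. (\<forall>x. cinner (blinfun_apply A x) x \<in> \<real>\<^sub>\<ge>\<^sub>0) \<longrightarrow> \<tau> A \<in> \<real>\<^sub>\<ge>\<^sub>0) \<and>
     \<tau> id_blinfun = 1 \<and>
     (\<forall>A\<in>M. \<forall>B\<in>M. \<tau> (A o\<^sub>L B) = \<tau> (B o\<^sub>L A))"

section \<open>Unbounded operators\<close>

text \<open>An unbounded operator \<open>A\<close> is its graph: \<open>(x, y) \<in> A\<close> means that \<open>x\<close> is in the domain of \<open>A\<close>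
  and \<open>A x = y\<close>.\<close>

type_synonym 'h uop = "('h \<times> 'h) set"

definition closed_densely_defined :: "'h::complex_hilbert uop \<Rightarrow> bool" where
  "closed_densely_defined A \<longleftrightarrow> single_valued A \<and> (0, 0) \<in> A \<and>
     (\<forall>(x, y)\<in>A. \<forall>(x', y')\<in>A. (x + x', y + y') \<in> A) \<and>
     (\<forall>c. \<forall>(x, y)\<in>A. (c *\<^sub>C x, c *\<^sub>C y) \<in> A) \<and>
     closed A \<and> closure (Domain A) = UNIV"

text \<open>\<open>U A U\<^sup>*\<close>, for unitary \<open>U\<close>.\<close>

definition uop_conj :: "('h::complex_hilbert \<Rightarrow>\<^sub>L 'h) \<Rightarrow> 'h uop \<Rightarrow> 'h uop" where
  "uop_conj U A = {(blinfun_apply U x, blinfun_apply U y) | x y. (x, y) \<in> A}"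

definition affiliated_ops :: "('h::complex_hilbert \<Rightarrow>\<^sub>L 'h) set \<Rightarrow> 'h uop set" where
  "affiliated_ops M =
     {A. closed_densely_defined A \<and> (\<forall>U\<in>unitaries (commutant M). uop_conj U A = A)}"

text \<open>The vector space operations of the algebra of affiliated operators: closures of the
  algebraic sum and of the algebraic scalar multiple (for \<open>c = 0\<close> the latter is the zero operator
  on the domain of \<open>A\<close>, so the closure matters).\<close>

definition uop_add :: "'h::complex_hilbert uop \<Rightarrow> 'h uop \<Rightarrow> 'h uop" where
  "uop_add A B = closure {(x, y + z) | x y z. (x, y) \<in> A \<and> (x, z) \<in> B}"

definition uop_scale :: "complex \<Rightarrow> 'h::complex_hilbert uop \<Rightarrow> 'h uop" where
  "uop_scale c A = closure {(x, c *\<^sub>C y) | x y. (x, y) \<in> A}"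

definition uop_adj :: "'h::complex_hilbert uop \<Rightarrow> 'h uop" where
  "uop_adj A = {(y, z). \<forall>(x, w)\<in>A. cinner w y = cinner x z}"

definition uop_nonneg :: "'h::complex_hilbert uop \<Rightarrow> bool" where
  "uop_nonneg A \<longleftrightarrow> uop_adj A = A \<and> (\<forall>(x, y)\<in>A. cinner y x \<in> \<real>\<^sub>\<ge>\<^sub>0)"

text \<open>The operator norm, equal to \<open>\<infinity>\<close> unless \<open>A\<close> is everywhere defined and bounded.\<close>

definition uop_norm :: "'h::complex_hilbert uop \<Rightarrow> ennreal" where
  "uop_norm A =
     Inf {ennreal c | c. 0 \<le> c \<and> (\<forall>x. \<exists>y. (x, y) \<in> A \<and> norm y \<le> c * norm x)}"

section \<open>Borel functional calculus\<close>

definition spectral_measure :: "(real set \<Rightarrow> 'h::complex_hilbert \<Rightarrow>\<^sub>L 'h) \<Rightarrow> bool" where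
  "spectral_measure P \<longleftrightarrow>
     (\<forall>B\<in>sets borel. P B \<in> projections bounded_ops) \<and> P UNIV = id_blinfun \<and>
     (\<forall>B\<in>sets borel. \<forall>C\<in>sets borel. P (B \<inter> C) = P B o\<^sub>L P C) \<and>
     (\<forall>B. range B \<subseteq> sets borel \<longrightarrow> disjoint_family B \<longrightarrow>
        (\<forall>x. (\<lambda>n. blinfun_apply (P (B n)) x) sums blinfun_apply (P (\<Union>n. B n)) x))"

text \<open>The scalar measure \<open>B \<mapsto> \<langle>P(B)x, x\<rangle> = \<parallel>P(B)x\<parallel>\<^sup>2\<close>.\<close>

definition scalar_measure ::
  "(real set \<Rightarrow> 'h::complex_hilbert \<Rightarrow>\<^sub>L 'h) \<Rightarrow> 'h \<Rightarrow> real measure" where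
  "scalar_measure P x =
     measure_of UNIV (sets borel) (\<lambda>B. ennreal ((norm (blinfun_apply (P B) x))\<^sup>2))"

definition spectral_domain ::
  "(real set \<Rightarrow> 'h::complex_hilbert \<Rightarrow>\<^sub>L 'h) \<Rightarrow> (real \<Rightarrow> real) \<Rightarrow> 'h set" where
  "spectral_domain P f = {x. (\<integral>\<^sup>+ s. ennreal ((f s)\<^sup>2) \<partial>scalar_measure P x) < \<infinity>}"

text \<open>The operator \<open>\<integral> f dP\<close>: it is characterised by \<open>\<langle>y, z\<rangle> = \<integral> f d\<langle>P x, z\<rangle>\<close>, where the
  complex measure \<open>\<langle>P x, z\<rangle>\<close> is written by polarisation as
  \<open>1/4 \<Sum>\<^sub>k i\<^sup>k \<langle>P (x + i\<^sup>k z), x + i\<^sup>k z\<rangle>\<close>.\<close>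

definition spectral_integral ::
  "(real set \<Rightarrow> 'h::complex_hilbert \<Rightarrow>\<^sub>L 'h) \<Rightarrow> (real \<Rightarrow> real) \<Rightarrow> 'h uop" where
  "spectral_integral P f = {(x, y). x \<in> spectral_domain P f \<and>
     (\<forall>z\<in>spectral_domain P f. cinner y z =
        (\<Sum>k<4. \<i> ^ k * complex_of_real (\<integral>s. f s \<partial>scalar_measure P (x + \<i> ^ k *\<^sub>C z))) / 4)}"

text \<open>\<open>f(A)\<close> for self-adjoint \<open>A\<close> and Borel \<open>f\<close>, via the unique spectral measure of \<open>A\<close>.\<close>

definition fun_calc :: "(real \<Rightarrow> real) \<Rightarrow> 'h::complex_hilbert uop \<Rightarrow> 'h uop" where
  "fun_calc f A = (THE B. \<exists>P. spectral_measure P \<and> spectral_integral P (\<lambda>s. s) = A \<and>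
     B = spectral_integral P f)"

text \<open>\<open>|A| = (A\<^sup>* A)\<^sup>1\<^sup>/\<^sup>2\<close>; the relational composite \<open>A O uop_adj A\<close> applies \<open>A\<close> first.\<close>

definition uop_abs :: "'h::complex_hilbert uop \<Rightarrow> 'h uop" where
  "uop_abs A = fun_calc sqrt (A O uop_adj A)"

section \<open>Calkin function spaces and bimodules\<close>

text \<open>The generalised singular value function; the infimum is finite for \<open>0 < t < 1\<close>, and the
  values at other \<open>t\<close> are irrelevant.\<close>

definition mu ::
  "('h::complex_hilbert \<Rightarrow>\<^sub>L 'h) set \<Rightarrow> (('h \<Rightarrow>\<^sub>L 'h) \<Rightarrow> complex) \<Rightarrow> real \<Rightarrow> 'h uop \<Rightarrow> real" where
  "mu M \<tau> t A = enn2real (INF p\<in>{p \<in> projections M. Re (\<tau> p) \<le> t}.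
     uop_norm {(x, y). (x - blinfun_apply p x, y) \<in> A})"

definition rearrangement :: "(real \<Rightarrow> complex) \<Rightarrow> real \<Rightarrow> real" where
  "rearrangement f t =
     Inf {s. 0 \<le> s \<and> measure (lebesgue_on {0..1}) {u\<in>{0..1}. s < cmod (f u)} \<le> t}"

text \<open>Functions on \<open>[0,1]\<close> are represented by functions on the real line whose values outside
  \<open>[0,1]\<close> are ignored.  The ideal condition makes \<open>G\<close> closed under almost everywhere equality on
  \<open>[0,1]\<close>, so inclusions between such sets \<open>G\<close> are the same as inclusions between the
  corresponding spaces of equivalence classes.\<close>

definition calkin_function_space :: "(real \<Rightarrow> complex) set \<Rightarrow> bool" where
  "calkin_function_space G \<longleftrightarrow> G \<subseteq> borel_measurable (lebesgue_on {0..1}) \<and>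
     (\<lambda>_. 0) \<in> G \<and> (\<forall>f\<in>G. \<forall>g\<in>G. (\<lambda>t. f t + g t) \<in> G) \<and> (\<forall>c. \<forall>f\<in>G. (\<lambda>t. c * f t) \<in> G) \<and>
     (\<forall>f \<in> borel_measurable (lebesgue_on {0..1}). \<forall>g\<in>G.
        (\<forall>t\<in>{0<..<1}. rearrangement f t \<le> rearrangement g t) \<longrightarrow> f \<in> G)"

definition bimodule :: "('h::complex_hilbert \<Rightarrow>\<^sub>L 'h) set \<Rightarrow> (('h \<Rightarrow>\<^sub>L 'h) \<Rightarrow> complex) \<Rightarrow>
    (real \<Rightarrow> complex) set \<Rightarrow> 'h uop set" where
  "bimodule M \<tau> G = {A \<in> affiliated_ops M. (\<lambda>t. complex_of_real (mu M \<tau> t A)) \<in> G}"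

section \<open>Traces and determinants\<close>

text \<open>Only the values of \<open>\<phi>\<close> on the bimodule are relevant.\<close>

definition trace_on :: "('h::complex_hilbert \<Rightarrow>\<^sub>L 'h) set \<Rightarrow> (('h \<Rightarrow>\<^sub>L 'h) \<Rightarrow> complex) \<Rightarrow>
    (real \<Rightarrow> complex) set \<Rightarrow> ('h uop \<Rightarrow> complex) \<Rightarrow> bool" where
  "trace_on M \<tau> G \<phi> \<longleftrightarrow>
     (\<forall>A\<in>bimodule M \<tau> G. \<forall>B\<in>bimodule M \<tau> G. \<phi> (uop_add A B) = \<phi> A + \<phi> B) \<and>
     (\<forall>c. \<forall>A\<in>bimodule M \<tau> G. \<phi> (uop_scale c A) = c * \<phi> A) \<and>
     (\<forall>U\<in>unitaries M. \<forall>A\<in>bimodule M \<tau> G. \<phi> (uop_conj U A) = \<phi> A)"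

definition positive_trace_on :: "('h::complex_hilbert \<Rightarrow>\<^sub>L 'h) set \<Rightarrow>
    (('h \<Rightarrow>\<^sub>L 'h) \<Rightarrow> complex) \<Rightarrow> (real \<Rightarrow> complex) set \<Rightarrow> ('h uop \<Rightarrow> complex) \<Rightarrow> bool" where
  "positive_trace_on M \<tau> G \<phi> \<longleftrightarrow> trace_on M \<tau> G \<phi> \<and>
     (\<forall>A\<in>bimodule M \<tau> G. uop_nonneg A \<longrightarrow> \<phi> A \<in> \<real>\<^sub>\<ge>\<^sub>0)"

text \<open>At \<open>0\<close> the library convention \<open>ln 0 = 0\<close> gives \<open>log_plus 0 = 0\<close>, as it should;
  \<open>ln\<close> and \<open>log_minus\<close> are applied below only to operators with trivial kernel, whose
  spectral measure does not charge \<open>{0}\<close>.\<close>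

definition log_plus :: "real \<Rightarrow> real" where
  "log_plus t = max (ln t) 0"

definition log_minus :: "real \<Rightarrow> real" where
  "log_minus t = - min (ln t) 0"

definition log_bimodule :: "('h::complex_hilbert \<Rightarrow>\<^sub>L 'h) set \<Rightarrow> (('h \<Rightarrow>\<^sub>L 'h) \<Rightarrow> complex) \<Rightarrow>
    (real \<Rightarrow> complex) set \<Rightarrow> 'h uop set" where
  "log_bimodule M \<tau> G =
     {T \<in> affiliated_ops M. fun_calc log_plus (uop_abs T) \<in> bimodule M \<tau> G}"

definition det_tr :: "('h::complex_hilbert \<Rightarrow>\<^sub>L 'h) set \<Rightarrow> (('h \<Rightarrow>\<^sub>L 'h) \<Rightarrow> complex) \<Rightarrow>
    (real \<Rightarrow> complex) set \<Rightarrow> ('h uop \<Rightarrow> complex) \<Rightarrow> 'h uop \<Rightarrow> complex" where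
  "det_tr M \<tau> G \<phi> = (\<lambda>T\<in>log_bimodule M \<tau> G.
     if {x. (x, 0) \<in> T} = {0} \<and> fun_calc log_minus (uop_abs T) \<in> bimodule M \<tau> G
     then exp (\<phi> (fun_calc ln (uop_abs T))) else 0)"

end

theory Submission
  imports Defs
begin

text \<open>Pick \<open>f \<in> F - E\<close> with decreasing rearrangement \<open>f\<^sup>*\<close>.  Repeated halving of the identity gives
  orthogonal projections \<open>p\<^sub>n \<in> M\<close> with sum \<open>1\<close> whose tails \<open>\<Sum>k\<ge>n. p\<^sub>k\<close> have trace \<open>2\<^sup>-\<^sup>n\<close>.  Put
  \<open>a\<^sub>n = f\<^sup>*(3/4 \<sqdot> 2\<^sup>-\<^sup>n)\<close>, \<open>X = \<Sum>n. a\<^sub>n p\<^sub>n\<close> and \<open>T = exp(-X)\<close>.  Then \<open>\<bar>T\<bar> = T\<close>, \<open>log\<^sub>+ T = 0\<close> and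
  \<open>log\<^sub>- T = X\<close>.  The singular value function of \<open>X\<close> agrees with \<open>f\<^sup>*\<close> up to a factor and a
  dilation, under which Calkin function spaces are invariant, so \<open>X\<close> lies in the bimodule of \<open>F\<close>
  but not in that of \<open>E\<close>.  Hence \<open>det\<^sub>\<psi> T\<close> is a value of \<open>exp\<close>, whereas \<open>det\<^sub>\<phi> T = 0\<close>.\<close>

section \<open>Adjoints and orthogonal projections\<close>

text \<open>A diagonal \<open>X\<close> is chosen because \<open>fun_calc\<close> is a definite
  description: it has its intended value only if a spectral measure of the operator exists and all
  such measures give the same integral. For a diagonal operator existence is explicit, and
  uniqueness can be checked on eigenvectors.

  The singular values of \<open>X\<close> are bounded rather than computed. For the upper bound one
  cuts off along a tail of the projections. For the lower bound let \<open>e\<close> be the tail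
  with trace \<open>1 / 2 ^ n\<close>. If \<open>q\<close> brought the norm of
  \<open>X (1 - q)\<close> below \<open>a n / 4\<close>, then \<open>e (1 - q)\<close> would have
  norm at most 1/4, and comparing the traces of the compressions \<open>e q e\<close> and
  \<open>q e q\<close> would give \<open>q\<close> at least 15/16 of the trace of \<open>e\<close>.
  No normality of \<tau> enters this argument. It loses a factor 4 in the value and moves the
  argument by a bounded factor. Both losses are harmless: scalar multiples stay in a Calkin space,
  and so do dilations by less than two, because two disjoint copies of a rearrangement can be
  added.\<close>

lemma cinner_add_right: "cinner x (y + z) = cinner x y + cinner x z"
  by (metis cinner_add_left cinner_commute complex_cnj_add)

interpretation cinner_left: additive "\<lambda>x. cinner x (y::'h::complex_hilbert)"
  by standard (rule cinner_add_left)

interpretation cinner_right: additive "\<lambda>y. cinner (x::'h::complex_hilbert) y"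
  by standard (rule cinner_add_right)

lemmas cinner_simps = cinner_add_left cinner_add_right cinner_left.diff cinner_right.diff
  cinner_left.zero cinner_right.zero cinner_left.minus cinner_right.minus
  cinner_scaleC_left cinner_scaleC_right

lemma cinner_self: "cinner x x = complex_of_real ((norm (x :: 'h::complex_hilbert))\<^sup>2)"
proof -
  have "Im (cinner x x) = 0"
    using arg_cong[OF cinner_commute[of x x], of Im] by simp
  then show ?thesis
    by (simp add: complex_eq_iff dot_square_norm inner_eq_Re_cinner[symmetric])
qed

lemma cinner_self_eq_0_iff [simp]: "cinner x x = 0 \<longleftrightarrow> (x :: 'h::complex_hilbert) = 0"
  by (simp add: cinner_self)

lemma cinner_eqI: "(\<And>z. cinner x z = cinner y z) \<Longrightarrow> (x :: 'h::complex_hilbert) = y"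
  by (metis cinner_left.diff cinner_self_eq_0_iff eq_iff_diff_eq_0)

text \<open>Rotating \<open>x\<close> by a unit scalar \<open>c\<close> makes the inner product real
  and nonnegative; it is then the real inner product, for which Cauchy-Schwarz holds.\<close>

lemma cmod_cinner_le: "cmod (cinner x y) \<le> norm x * norm (y :: 'h::complex_hilbert)"
proof (cases "cinner x y = 0")
  case False
  define c where "c = cnj (sgn (cinner x y))"
  have c: "cmod c = 1" using False by (simp add: c_def norm_sgn)
  have "c * cinner x y = complex_of_real (cmod (cinner x y))"
    using False complex_norm_square[of "cinner x y"]
    by (simp add: c_def sgn_eq field_simps power2_eq_square)
  then have "cmod (cinner x y) = Re (cinner (c *\<^sub>C x) y)"
    by (simp add: cinner_scaleC_left)
  also have "\<dots> = inner (c *\<^sub>C x) y" by (simp add: inner_eq_Re_cinner)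
  also have "\<dots> \<le> norm (c *\<^sub>C x) * norm y" by (rule norm_cauchy_schwarz)
  finally show ?thesis by (simp add: norm_scaleC c)
qed simp

lemma scaleC_zero_right [simp]: "c *\<^sub>C (0 :: 'h::complex_hilbert) = 0"
  by (metis norm_scaleC mult_zero_right norm_eq_zero norm_zero)

lemma scaleC_zero_left [simp]: "0 *\<^sub>C (x :: 'h::complex_hilbert) = 0"
  by (metis norm_scaleC mult_zero_left norm_eq_zero norm_zero)

lemma scaleC_one [simp]: "1 *\<^sub>C (x :: 'h::complex_hilbert) = x"
  by (metis of_real_1 scaleC_of_real scaleR_one)

lemma scaleC_minus_one: "(-1) *\<^sub>C (x :: 'h::complex_hilbert) = - x"
  by (metis of_real_1 of_real_minus scaleC_of_real scaleR_minus1_left)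

lemma bounded_bilinear_cinner:
  "bounded_bilinear (cinner :: 'h::complex_hilbert \<Rightarrow> 'h \<Rightarrow> complex)"
proof
  fix r :: real and a b :: 'h
  show "cinner (r *\<^sub>R a) b = r *\<^sub>R cinner a b"
    by (metis scaleC_of_real cinner_scaleC_left scaleR_conv_of_real)
  show "cinner a (r *\<^sub>R b) = r *\<^sub>R cinner a b"
    by (metis scaleC_of_real cinner_scaleC_right scaleR_conv_of_real complex_cnj_complex_of_real)
  show "\<exists>K. \<forall>a b :: 'h. norm (cinner a b) \<le> norm a * norm b * K"
    by (rule exI[of _ 1]) (simp add: cmod_cinner_le)
qed (simp_all add: cinner_simps)

interpretation cinner: bounded_bilinear cinner
  by (rule bounded_bilinear_cinner)

section \<open>The projection theorem for closed complex subspaces\<close>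

definition closed_csubspace :: "'h::complex_hilbert set \<Rightarrow> bool" where
  "closed_csubspace S \<longleftrightarrow> closed S \<and> 0 \<in> S \<and> (\<forall>x\<in>S. \<forall>y\<in>S. x + y \<in> S) \<and> (\<forall>c. \<forall>x\<in>S. c *\<^sub>C x \<in> S)"

lemma closed_csubspaceI:
  assumes "closed S" "0 \<in> S" "\<And>x y. x \<in> S \<Longrightarrow> y \<in> S \<Longrightarrow> x + y \<in> S"
    "\<And>c x. x \<in> S \<Longrightarrow> c *\<^sub>C x \<in> S"
  shows "closed_csubspace S"
  using assms by (auto simp: closed_csubspace_def)

lemma closed_csubspace_diff: "closed_csubspace S \<Longrightarrow> x \<in> S \<Longrightarrow> y \<in> S \<Longrightarrow> x - y \<in> S"
  by (metis closed_csubspace_def scaleC_minus_one add_uminus_conv_diff)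

lemma closed_csubspace_scaleR: "closed_csubspace S \<Longrightarrow> x \<in> S \<Longrightarrow> r *\<^sub>R x \<in> S"
  by (metis closed_csubspace_def scaleC_of_real)

lemma power2_norm_diff_scaleR:
  "(norm (w - r *\<^sub>R z))\<^sup>2 = (norm w)\<^sup>2 - 2 * r * inner w z + r\<^sup>2 * inner z (z :: 'a::real_inner)"
  unfolding power2_norm_eq_inner
  by (simp add: inner_diff_left inner_diff_right inner_commute[of z w] power2_eq_square algebra_simps)

text \<open>A minimising sequence for the squared distance \<open>d\<close> is Cauchy by the
  parallelogram law, since midpoints stay in \<open>S\<close>. At the minimiser no move along
  \<open>S\<close> decreases the distance, which makes the residual orthogonal to
  \<open>S\<close>.\<close>

lemma orthogonal_projection_exists:
  assumes S: "closed_csubspace (S :: 'h::complex_hilbert set)"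
  shows "\<exists>y\<in>S. \<forall>z\<in>S. cinner (x - y) z = 0"
proof -
  define d where "d = (INF y\<in>S. (norm (x - y))\<^sup>2)"
  have S0: "S \<noteq> {}" using S by (auto simp: closed_csubspace_def)
  have bdd: "bdd_below ((\<lambda>y. (norm (x - y))\<^sup>2) ` S)" by (rule bdd_belowI2[of _ 0]) simp
  have le: "d \<le> (norm (x - y))\<^sup>2" if "y \<in> S" for y
    unfolding d_def using that bdd by (rule cINF_lower[rotated])
  have "\<exists>y\<in>S. (norm (x - y))\<^sup>2 < d + 1 / Suc n" for n
  proof -
    have "d < d + 1 / Suc n" by simp
    then show ?thesis unfolding d_def using cINF_less_iff[OF S0 bdd] by metis
  qed
  then obtain u where u: "\<And>n. u n \<in> S" "\<And>n. (norm (x - u n))\<^sup>2 < d + 1 / Suc n" by metis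
  have par: "(norm (u m - u n))\<^sup>2 \<le> 2 * (1 / Suc m) + 2 * (1 / Suc n)" for m n
  proof -
    let ?w = "(1/2) *\<^sub>R (u m + u n)"
    have "?w \<in> S" using S u by (metis closed_csubspace_def closed_csubspace_scaleR)
    then have "d \<le> (norm (x - ?w))\<^sup>2" by (rule le)
    moreover have "(norm (u m - u n))\<^sup>2 + 4 * (norm (x - ?w))\<^sup>2 = 2 * (norm (x - u m))\<^sup>2 + 2 * (norm (x - u n))\<^sup>2"
      by (simp add: power2_norm_eq_inner inner_simps inner_commute algebra_simps)
    ultimately show ?thesis using u(2)[of m] u(2)[of n] by argo
  qed
  have "Cauchy u"
  proof (rule metric_CauchyI)
    fix e :: real assume e: "e > 0"
    obtain N where N: "1 / real (Suc N) < e\<^sup>2 / 4"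
      using reals_Archimedean[of "e\<^sup>2 / 4"] e by (auto simp: inverse_eq_divide)
    show "\<exists>N. \<forall>m\<ge>N. \<forall>n\<ge>N. dist (u m) (u n) < e"
    proof (intro exI allI impI)
      fix m n assume mn: "N \<le> m" "N \<le> n"
      have "1 / real (Suc m) \<le> 1 / real (Suc N)" "1 / real (Suc n) \<le> 1 / real (Suc N)"
        using mn by (auto simp: frac_le)
      then have "(norm (u m - u n))\<^sup>2 < e\<^sup>2" using par[of m n] N by argo
      then show "dist (u m) (u n) < e" using e by (simp add: dist_norm power2_less_imp_less)
    qed
  qed
  then obtain y where y: "u \<longlonglongrightarrow> y" by (auto simp: convergent_eq_Cauchy[symmetric])
  have yS: "y \<in> S" using S y u(1) by (metis closed_csubspace_def closed_sequentially)
  have "(\<lambda>n. (norm (x - u n))\<^sup>2) \<longlonglongrightarrow> (norm (x - y))\<^sup>2" by (intro tendsto_intros y)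
  moreover have "(\<lambda>n. d + 1 / Suc n) \<longlonglongrightarrow> d + 0"
    by (intro tendsto_intros LIMSEQ_Suc[OF lim_1_over_n])
  ultimately have "(norm (x - y))\<^sup>2 \<le> d + 0"
    by (rule LIMSEQ_le) (use u(2) less_imp_le in blast)
  then have dy: "d = (norm (x - y))\<^sup>2" using le[OF yS] by simp
  have re: "inner (x - y) z = 0" if z: "z \<in> S" for z
  proof (cases "z = 0")
    case False
    \<comment> \<open>The step length that minimises the distance along \<open>z\<close>.\<close>
    let ?r = "inner (x - y) z / inner z z"
    have "y + ?r *\<^sub>R z \<in> S" using S yS z by (metis closed_csubspace_def closed_csubspace_scaleR)
    from le[OF this] have "(norm (x - y))\<^sup>2 \<le> (norm ((x - y) - ?r *\<^sub>R z))\<^sup>2"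
      by (simp add: dy diff_diff_eq)
    also have "\<dots> = (norm (x - y))\<^sup>2 - 2 * ?r * inner (x - y) z + ?r\<^sup>2 * inner z z"
      by (rule power2_norm_diff_scaleR)
    also have "\<dots> = (norm (x - y))\<^sup>2 - (inner (x - y) z)\<^sup>2 / inner z z"
      using False by (simp add: power2_eq_square)
    finally have "(inner (x - y) z)\<^sup>2 / inner z z \<le> 0" by simp
    moreover have "inner z z > 0" using False by simp
    ultimately show ?thesis by (simp add: divide_le_0_iff)
  qed simp
  have "cinner (x - y) z = 0" if z: "z \<in> S" for z
  proof -
    \<comment> \<open>\<open>re\<close> controls real parts only; applied to
      \<open>\<i> *\<^sub>C z\<close> it controls the imaginary part as well.\<close>
    have "\<i> *\<^sub>C z \<in> S" using S z by (auto simp: closed_csubspace_def)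
    from re[OF this] re[OF z] show ?thesis
      by (simp add: inner_eq_Re_cinner cinner_scaleC_right complex_eq_iff)
  qed
  then show ?thesis using yS by blast
qed

section \<open>Riesz representation and adjoints\<close>

lemma bounded_opsD: "A \<in> bounded_ops \<Longrightarrow> blinfun_apply A (c *\<^sub>C x) = c *\<^sub>C blinfun_apply A x"
  by (simp add: bounded_ops_def)

lemma adj_eqI:
  assumes "\<And>x y. cinner (blinfun_apply A x) y = cinner x (blinfun_apply B y)"
  shows "adj A = B"
  unfolding adj_def
proof (rule the_equality)
  fix C assume C: "\<forall>x y. cinner (blinfun_apply A x) y = cinner x (blinfun_apply C y)"
  show "C = B"
  proof (rule blinfun_eqI)
    fix y
    have "cinner (C y) x = cinner (B y) x" for x
      using C assms by (metis cinner_commute)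
    then show "C y = B y" by (rule cinner_eqI)
  qed
qed (use assms in simp)

text \<open>A residual \<open>w\<close> of the projection onto the kernel is orthogonal to it, and
  \<open>u - (f u / f w) *\<^sub>C w\<close> lies in the kernel for every \<open>u\<close>. Pairing
  with \<open>w\<close> then computes \<open>f u\<close>.\<close>

lemma riesz_representation:
  fixes f :: "'h::complex_hilbert \<Rightarrow> complex"
  assumes f: "bounded_linear f" and fC: "\<And>c x. f (c *\<^sub>C x) = c * f x"
  shows "\<exists>z. \<forall>x. f x = cinner x z"
proof (cases "\<forall>x. f x = 0")
  case True
  then show ?thesis by (intro exI[of _ 0]) (simp add: cinner_simps)
next
  case False
  interpret f: bounded_linear f by fact
  obtain x where x: "f x \<noteq> 0" using False by blast
  let ?K = "{x. f x = 0}"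
  have "closed_csubspace ?K"
    by (rule closed_csubspaceI)
      (auto simp: f.zero f.add fC intro!: closed_Collect_eq f.continuous_on continuous_intros)
  then obtain y where y: "f y = 0" "\<And>z. f z = 0 \<Longrightarrow> cinner (x - y) z = 0"
    using orthogonal_projection_exists[of ?K x] by auto
  define w where "w = x - y"
  have w: "f w \<noteq> 0" "w \<noteq> 0" using x y(1) by (auto simp: w_def f.diff f.zero)
  show ?thesis
  proof (intro exI allI)
    fix u
    let ?v = "u - (f u / f w) *\<^sub>C w"
    have "f ?v = 0" using w by (simp add: f.diff fC)
    then have "cinner w ?v = 0" using y(2) by (simp add: w_def)
    then have "cinner ?v w = 0" by (metis cinner_commute complex_cnj_zero)
    then have "cinner u w = (f u / f w) * cinner w w" by (simp add: cinner_simps)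
    then show "f u = cinner u (cnj (f w / cinner w w) *\<^sub>C w)"
      using w by (simp add: cinner_simps)
  qed
qed

lemma bounded_linearI_cinner:
  fixes B :: "'h::complex_hilbert \<Rightarrow> 'h"
  assumes add: "\<And>x y. B (x + y) = B x + B y" and C: "\<And>c x. B (c *\<^sub>C x) = c *\<^sub>C B x"
    and K: "\<And>x. norm (B x) \<le> norm x * K"
  shows "bounded_linear B"
  by (rule bounded_linear_intro[of _ K]) (use assms in \<open>simp_all flip: scaleC_of_real\<close>)

text \<open>Riesz representation gives \<open>B y\<close> for each fixed \<open>y\<close>. Linearity
  of \<open>B\<close> follows from uniqueness, and the bound from
  \<open>cinner (B x) (B x) = cinner x (A (B x))\<close>.\<close>

lemma adj_exists:
  assumes A: "A \<in> bounded_ops"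
  shows "\<exists>B\<in>bounded_ops. \<forall>x y. cinner (blinfun_apply A x) y = cinner x (blinfun_apply B y)"
proof -
  have "\<exists>z. \<forall>x. cinner (blinfun_apply A x) y = cinner x z" for y
  proof (rule riesz_representation)
    show "bounded_linear (\<lambda>x. cinner (blinfun_apply A x) y)"
      by (rule bounded_linear_compose[OF cinner.bounded_linear_left blinfun.bounded_linear_right])
  qed (simp add: bounded_opsD[OF A] cinner_scaleC_left)
  then obtain B where B: "\<And>x y. cinner (blinfun_apply A x) y = cinner x (B y)" by metis
  have B': "cinner (B y) x = cinner y (blinfun_apply A x)" for x y
    by (metis B cinner_commute)
  have C: "B (c *\<^sub>C x) = c *\<^sub>C B x" for c x
    by (rule cinner_eqI) (simp add: B' cinner_scaleC_left)
  have bl: "bounded_linear B"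
  proof (rule bounded_linearI_cinner)
    show "B (x + y) = B x + B y" for x y
      by (rule cinner_eqI) (simp add: B' cinner_add_left)
    show "norm (B x) \<le> norm x * norm A" for x
    proof -
      have "(norm (B x))\<^sup>2 = cmod (cinner (B x) (B x))" by (simp add: cinner_self norm_power)
      also have "\<dots> = cmod (cinner x (blinfun_apply A (B x)))" by (simp add: B')
      also have "\<dots> \<le> norm x * (norm A * norm (B x))"
        by (rule order_trans[OF cmod_cinner_le mult_left_mono[OF norm_blinfun]]) simp
      finally have "norm (B x) * norm (B x) \<le> (norm x * norm A) * norm (B x)"
        by (simp add: power2_eq_square mult_ac)
      then show ?thesis
        by (cases "B x = 0") (simp_all add: mult_le_cancel_right)
    qed
  qed (rule C)
  show ?thesis
    by (rule bexI[of _ "Blinfun B"]) (auto simp: bounded_linear_Blinfun_apply[OF bl] B bounded_ops_def C)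
qed

lemma
  assumes "A \<in> bounded_ops"
  shows cinner_adj_right: "cinner (blinfun_apply A x) y = cinner x (blinfun_apply (adj A) y)"
    and adj_in_bounded_ops: "adj A \<in> bounded_ops"
proof -
  obtain B where B: "B \<in> bounded_ops"
    "\<And>x y. cinner (blinfun_apply A x) y = cinner x (blinfun_apply B y)"
    using adj_exists[OF assms] by blast
  have "adj A = B" by (rule adj_eqI) (rule B)
  then show "cinner (blinfun_apply A x) y = cinner x (blinfun_apply (adj A) y)" "adj A \<in> bounded_ops"
    using B by simp_all
qed

lemma cinner_adj_left:
  "A \<in> bounded_ops \<Longrightarrow> cinner (blinfun_apply (adj A) x) y = cinner x (blinfun_apply A y)"
  by (metis cinner_adj_right cinner_commute)

lemma norm_adj_le:
  assumes "A \<in> bounded_ops" shows "norm (adj A) \<le> norm A"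
proof (rule norm_blinfun_bound)
  fix x
  let ?y = "blinfun_apply (adj A) x"
  have "(norm ?y)\<^sup>2 = cmod (cinner ?y ?y)" by (simp add: cinner_self norm_power)
  also have "\<dots> = cmod (cinner x (blinfun_apply A ?y))" by (simp add: cinner_adj_left[OF assms])
  also have "\<dots> \<le> norm x * (norm A * norm ?y)"
    by (rule order_trans[OF cmod_cinner_le mult_left_mono[OF norm_blinfun]]) simp
  finally have "norm ?y * norm ?y \<le> (norm A * norm x) * norm ?y"
    by (simp add: power2_eq_square mult_ac)
  then show "norm ?y \<le> norm A * norm x"
    by (cases "?y = 0") (simp_all add: mult_le_cancel_right)
qed simp

section \<open>Orthogonal projections as bounded operators\<close>

definition proj_onto :: "'h::complex_hilbert set \<Rightarrow> 'h \<Rightarrow>\<^sub>L 'h" where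
  "proj_onto S = Blinfun (\<lambda>x. SOME y. y \<in> S \<and> (\<forall>z\<in>S. cinner (x - y) z = 0))"

context
  fixes S :: "'h::complex_hilbert set"
  assumes S: "closed_csubspace S"
begin

lemma orthogonal_projection_unique:
  assumes "y \<in> S" "\<And>z. z \<in> S \<Longrightarrow> cinner (x - y) z = 0"
    and "y' \<in> S" "\<And>z. z \<in> S \<Longrightarrow> cinner (x - y') z = 0"
  shows "y = y'"
proof -
  have "y - y' \<in> S" using S assms closed_csubspace_diff by blast
  then have "cinner (x - y') (y - y') - cinner (x - y) (y - y') = 0" using assms by simp
  then have "cinner ((x - y') - (x - y)) (y - y') = 0" by (simp only: cinner_left.diff)
  then show ?thesis by simp
qed

text \<open>Uniqueness turns the choice inside \<open>proj_onto\<close> into a linear map, and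
  Pythagoras bounds its norm by 1.\<close>

lemma
  shows proj_onto_in: "blinfun_apply (proj_onto S) x \<in> S"
    and proj_onto_orth: "z \<in> S \<Longrightarrow> cinner (x - blinfun_apply (proj_onto S) x) z = 0"
    and proj_onto_bounded_ops: "proj_onto S \<in> bounded_ops"
proof -
  define P where "P = (\<lambda>x. SOME y. y \<in> S \<and> (\<forall>z\<in>S. cinner (x - y) z = 0))"
  have P: "P x \<in> S \<and> (\<forall>z\<in>S. cinner (x - P x) z = 0)" for x
    unfolding P_def by (rule someI_ex) (use orthogonal_projection_exists[OF S] in blast)
  have C: "P (c *\<^sub>C x) = c *\<^sub>C P x" for c x
  proof (rule orthogonal_projection_unique)
    show "c *\<^sub>C P x \<in> S" using P S by (auto simp: closed_csubspace_def)
    fix z assume "z \<in> S"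
    then have "c * cinner (x - P x) z = 0" using P by simp
    then show "cinner (c *\<^sub>C x - c *\<^sub>C P x) z = 0" by (simp add: cinner_simps algebra_simps)
  qed (use P in auto)
  have "bounded_linear P"
  proof (rule bounded_linearI_cinner)
    fix x y
    show "P (x + y) = P x + P y"
    proof (rule orthogonal_projection_unique)
      show "P x + P y \<in> S" using P S by (auto simp: closed_csubspace_def)
      fix z assume "z \<in> S"
      then have "cinner (x - P x) z + cinner (y - P y) z = 0" using P by simp
      then show "cinner (x + y - (P x + P y)) z = 0" by (simp add: cinner_simps algebra_simps)
    qed (use P in auto)
  next
    fix x
    have "cinner (x - P x) (P x) = 0" using P by blast
    then have "inner (x - P x) (P x) = 0" by (simp add: inner_eq_Re_cinner)
    then have "(norm x)\<^sup>2 = (norm (x - P x))\<^sup>2 + (norm (P x))\<^sup>2"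
      by (simp add: power2_norm_eq_inner inner_simps inner_commute)
    then have "(norm (P x))\<^sup>2 \<le> (norm x)\<^sup>2" by simp
    then have "norm (P x) \<le> norm x" by (rule power2_le_imp_le) simp
    then show "norm (P x) \<le> norm x * 1" by simp
  qed (rule C)
  then have "blinfun_apply (proj_onto S) = P"
    unfolding proj_onto_def P_def[symmetric] by (rule bounded_linear_Blinfun_apply)
  then show "blinfun_apply (proj_onto S) x \<in> S" "proj_onto S \<in> bounded_ops"
    "z \<in> S \<Longrightarrow> cinner (x - blinfun_apply (proj_onto S) x) z = 0"
    using P C by (auto simp: bounded_ops_def)
qed

lemma proj_onto_eqI:
  "y \<in> S \<Longrightarrow> (\<And>z. z \<in> S \<Longrightarrow> cinner (x - y) z = 0) \<Longrightarrow> blinfun_apply (proj_onto S) x = y"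
  by (rule orthogonal_projection_unique[where x = x]) (auto simp: proj_onto_in proj_onto_orth)

lemma proj_onto_fix [simp]: "x \<in> S \<Longrightarrow> blinfun_apply (proj_onto S) x = x"
  by (rule proj_onto_eqI) (auto simp: cinner_simps)

lemma proj_onto_eq_0: "(\<And>z. z \<in> S \<Longrightarrow> cinner x z = 0) \<Longrightarrow> blinfun_apply (proj_onto S) x = 0"
  by (rule proj_onto_eqI) (use S in \<open>auto simp: closed_csubspace_def\<close>)

lemma proj_onto_in_projections: "proj_onto S \<in> projections bounded_ops"
proof -
  have "cinner (blinfun_apply (proj_onto S) x) y = cinner x (blinfun_apply (proj_onto S) y)" for x y
  proof -
    have "cinner (x - blinfun_apply (proj_onto S) x) (blinfun_apply (proj_onto S) y) = 0"
      by (rule proj_onto_orth) (rule proj_onto_in)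
    moreover have "cinner (y - blinfun_apply (proj_onto S) y) (blinfun_apply (proj_onto S) x) = 0"
      by (rule proj_onto_orth) (rule proj_onto_in)
    then have "cinner (blinfun_apply (proj_onto S) x) (y - blinfun_apply (proj_onto S) y) = 0"
      by (metis cinner_commute complex_cnj_zero)
    ultimately show ?thesis by (simp add: cinner_simps)
  qed
  then show ?thesis
    using adj_eqI[of "proj_onto S" "proj_onto S"]
    by (auto simp: projections_def proj_onto_bounded_ops proj_onto_in intro!: blinfun_eqI)
qed

end

lemma
  assumes "p \<in> projections M" "M \<subseteq> bounded_ops"
  shows projection_idem: "blinfun_apply p (blinfun_apply p x) = blinfun_apply p x"
    and projection_sym: "cinner (blinfun_apply p x) y = cinner x (blinfun_apply p y)"
proof -
  show "blinfun_apply p (blinfun_apply p x) = blinfun_apply p x"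
    using assms by (metis (mono_tags, lifting) projections_def mem_Collect_eq blinfun_apply_blinfun_compose)
  show "cinner (blinfun_apply p x) y = cinner x (blinfun_apply p y)"
    using assms cinner_adj_right[of p x y] by (auto simp: projections_def)
qed

lemma projectionsI:
  assumes "p \<in> M" "\<And>x. blinfun_apply p (blinfun_apply p x) = blinfun_apply p x"
    "\<And>x y. cinner (blinfun_apply p x) y = cinner x (blinfun_apply p y)"
  shows "p \<in> projections M"
  using assms adj_eqI[of p p] by (auto simp: projections_def intro: blinfun_eqI)

section \<open>Von Neumann algebras\<close>

lemma commutantD: "A \<in> commutant M \<Longrightarrow> T \<in> M \<Longrightarrow> blinfun_apply A (T x) = blinfun_apply T (A x)"
  by (auto simp: commutant_def dest!: bspec[of M _ T] arg_cong[of _ _ "\<lambda>S. blinfun_apply S x"])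

lemma bounded_opsI: "(\<And>c x. blinfun_apply A (c *\<^sub>C x) = c *\<^sub>C blinfun_apply A x) \<Longrightarrow> A \<in> bounded_ops"
  by (simp add: bounded_ops_def)

lemma commutant_bounded_ops: "A \<in> commutant M \<Longrightarrow> A \<in> bounded_ops"
  by (simp add: commutant_def)

lemma blinfun_apply_cdiff: "blinfun_apply A (x - y) = blinfun_apply A x - blinfun_apply A y"
  by (simp add: blinfun.bilinear_simps)

lemma projection_diff:
  assumes M: "M \<subseteq> bounded_ops" and p: "p \<in> projections M" and q: "q \<in> projections M"
    and pq: "\<And>x. blinfun_apply p (q x) = q x" and d: "p - q \<in> M"
  shows "p - q \<in> projections M"
proof (rule projectionsI)
  \<comment> \<open>The adjoint form of \<open>pq\<close>; with both products known,
    \<open>p - q\<close> is idempotent.\<close>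
  have "blinfun_apply q (p x) = q x" for x
  proof (rule cinner_eqI)
    show "cinner (q (p x)) z = cinner (q x) z" for z
      by (simp add: projection_sym[OF p M] projection_sym[OF q M] pq)
  qed
  then show "blinfun_apply (p - q) ((p - q) x) = (p - q) x" for x
    by (simp add: blinfun.bilinear_simps projection_idem[OF p M] projection_idem[OF q M] pq)
  show "cinner ((p - q) x) y = cinner x ((p - q) y)" for x y
    by (simp add: blinfun.bilinear_simps cinner_simps projection_sym[OF p M] projection_sym[OF q M])
qed (rule d)

text \<open>Invariance under \<open>A\<close> keeps the projected part in \<open>S\<close>;
  invariance under \<open>adj A\<close> keeps the residual orthogonal to \<open>S\<close>.\<close>

lemma proj_onto_commutes:
  assumes S: "closed_csubspace S" and A: "A \<in> bounded_ops"
    and inv: "\<And>x. x \<in> S \<Longrightarrow> blinfun_apply A x \<in> S" "\<And>x. x \<in> S \<Longrightarrow> blinfun_apply (adj A) x \<in> S"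
  shows "blinfun_apply (proj_onto S) (A x) = A (proj_onto S x)"
proof (rule proj_onto_eqI[OF S])
  show "blinfun_apply A (proj_onto S x) \<in> S" by (intro inv proj_onto_in S)
  fix z assume "z \<in> S"
  then have "cinner (x - proj_onto S x) (adj A z) = 0" by (intro proj_onto_orth S inv)
  then show "cinner (A x - A (proj_onto S x)) z = 0"
    by (simp add: cinner_adj_right[OF A] flip: blinfun_apply_cdiff)
qed

lemma closed_csubspace_range:
  assumes p: "p \<in> projections M" and M: "M \<subseteq> bounded_ops"
  shows "closed_csubspace {x. blinfun_apply p x = x}"
proof -
  have "p \<in> bounded_ops" using p M by (auto simp: projections_def)
  then show ?thesis
    by (intro closed_csubspaceI closed_Collect_eq continuous_intros)
      (auto simp: blinfun.bilinear_simps bounded_opsD)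
qed

lemma projection_orth_norm_le:
  assumes p: "p \<in> projections M" and M: "M \<subseteq> bounded_ops"
  shows "norm (blinfun_apply p x) \<le> norm x"
proof (cases "p x = 0")
  case False
  have "(norm (p x))\<^sup>2 = cmod (cinner (p x) (p x))" by (simp add: cinner_self norm_power)
  also have "\<dots> = cmod (cinner (p x) x)" by (simp add: projection_sym[OF p M] projection_idem[OF p M])
  also have "\<dots> \<le> norm (p x) * norm x" by (rule cmod_cinner_le)
  finally show ?thesis using False by (simp add: power2_eq_square)
qed simp

locale vn_algebra =
  fixes M :: "('h::complex_hilbert \<Rightarrow>\<^sub>L 'h) set"
  assumes vn: "von_neumann_algebra M"
begin

lemma bounded: "M \<subseteq> bounded_ops"
  using vn by (simp add: von_neumann_algebra_def)

lemma in_bounded_ops: "A \<in> M \<Longrightarrow> A \<in> bounded_ops"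
  using bounded by blast

lemma adj_closed: "A \<in> M \<Longrightarrow> adj A \<in> M"
  using vn by (simp add: von_neumann_algebra_def)

text \<open>The double commutant condition, turned into the membership test behind the closure
  properties below.\<close>

lemma memI:
  assumes "T \<in> bounded_ops" "\<And>A x. A \<in> commutant M \<Longrightarrow> blinfun_apply T (A x) = A (T x)"
  shows "T \<in> M"
proof -
  have "T \<in> commutant (commutant M)"
    using assms by (auto simp: commutant_def[of "commutant M"] intro: blinfun_eqI)
  then show ?thesis using vn by (simp add: von_neumann_algebra_def)
qed

lemma commutes:
  "A \<in> commutant M \<Longrightarrow> T \<in> M \<Longrightarrow> blinfun_apply T (A x) = blinfun_apply A (T x)"
  by (rule commutantD[symmetric])

lemma id_closed: "id_blinfun \<in> M" and zero_closed: "0 \<in> M"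
  by (rule memI; simp add: bounded_ops_def)+

lemma compose_closed: "A \<in> M \<Longrightarrow> B \<in> M \<Longrightarrow> A o\<^sub>L B \<in> M"
  by (rule memI) (simp_all add: bounded_opsD in_bounded_ops bounded_opsI commutes)

lemma add_closed: "A \<in> M \<Longrightarrow> B \<in> M \<Longrightarrow> A + B \<in> M"
  by (rule memI) (simp_all add: bounded_opsD in_bounded_ops bounded_opsI
      commutes blinfun.bilinear_simps scaleC_add_right)

lemma scalar_closed: "scalar_op c \<in> M"
proof (rule memI)
  show "scalar_op c \<in> bounded_ops"
    by (simp add: bounded_ops_def scalar_op.rep_eq scaleC_scaleC mult.commute)
  show "blinfun_apply (scalar_op c) (A x) = A (scalar_op c x)" if "A \<in> commutant M" for A x
    using bounded_opsD[OF commutant_bounded_ops[OF that]] by (simp add: scalar_op.rep_eq)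
qed

lemma scaleR_closed: "A \<in> M \<Longrightarrow> r *\<^sub>R A \<in> M"
proof -
  assume "A \<in> M"
  moreover have "r *\<^sub>R A = scalar_op (complex_of_real r) o\<^sub>L A"
    by (rule blinfun_eqI) (simp add: scalar_op.rep_eq scaleC_of_real blinfun.bilinear_simps)
  ultimately show ?thesis by (simp add: compose_closed scalar_closed)
qed

lemma diff_closed: "A \<in> M \<Longrightarrow> B \<in> M \<Longrightarrow> A - B \<in> M"
  using add_closed[OF _ scaleR_closed[of B "-1"]] by simp

text \<open>Serves for the norm limit of the square root iteration in
  \<open>abs_exists\<close>.\<close>

lemma lim_closed:
  assumes X: "\<And>n. X n \<in> M" and lim: "X \<longlonglongrightarrow> T"
  shows "T \<in> M"
proof (rule memI)
  have *: "(\<lambda>n. blinfun_apply (X n) x) \<longlonglongrightarrow> blinfun_apply T x" for x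
    by (intro blinfun.tendsto lim tendsto_const)
  show "T \<in> bounded_ops"
    unfolding bounded_ops_def
  proof (intro CollectI allI)
    fix c x
    have "(\<lambda>n. scalar_op c (blinfun_apply (X n) x)) \<longlonglongrightarrow> scalar_op c (blinfun_apply T x)"
      by (intro blinfun.tendsto * tendsto_const)
    then have "(\<lambda>n. blinfun_apply (X n) (c *\<^sub>C x)) \<longlonglongrightarrow> c *\<^sub>C T x"
      using bounded_opsD[OF in_bounded_ops[OF X]] by (simp add: scalar_op.rep_eq)
    then show "blinfun_apply T (c *\<^sub>C x) = c *\<^sub>C T x" using * LIMSEQ_unique by blast
  qed
  fix A x assume A: "A \<in> commutant M"
  have "(\<lambda>n. A (X n x)) \<longlonglongrightarrow> A (T x)"
    by (intro blinfun.tendsto * tendsto_const)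
  then have "(\<lambda>n. X n (A x)) \<longlonglongrightarrow> A (T x)" by (simp add: commutantD[OF A X])
  then show "blinfun_apply T (A x) = A (T x)" using * LIMSEQ_unique by blast
qed

lemma adj_commutant:
  assumes A: "A \<in> commutant M"
  shows "adj A \<in> commutant M"
  unfolding commutant_def
proof (intro CollectI conjI ballI blinfun_eqI)
  have A': "A \<in> bounded_ops" by (rule commutant_bounded_ops[OF A])
  then show "adj A \<in> bounded_ops" by (rule adj_in_bounded_ops)
  fix T x assume T: "T \<in> M"
  have "cinner (adj A (T x)) z = cinner (T (adj A x)) z" for z
  proof -
    have "cinner (adj A (T x)) z = cinner x (adj T (A z))"
      by (simp add: cinner_adj_left[OF A'] cinner_adj_right[OF in_bounded_ops[OF T]])
    also have "\<dots> = cinner (T (adj A x)) z"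
      by (simp flip: commutantD[OF A adj_closed[OF T]]
          add: cinner_adj_left[OF A'] cinner_adj_right[OF in_bounded_ops[OF T]])
    finally show ?thesis .
  qed
  then show "blinfun_apply (adj A o\<^sub>L T) x = blinfun_apply (T o\<^sub>L adj A) x"
    by (auto intro: cinner_eqI)
qed

text \<open>The source of projections in \<open>M\<close>. Invariance under the commutant is enough
  because the commutant is closed under adjoints, so the residual is handled as well.\<close>

lemma proj_onto_closed:
  assumes S: "closed_csubspace S" and inv: "\<And>A x. A \<in> commutant M \<Longrightarrow> x \<in> S \<Longrightarrow> blinfun_apply A x \<in> S"
  shows "proj_onto S \<in> projections M"
proof -
  have "proj_onto S \<in> M"
    by (intro memI proj_onto_bounded_ops S proj_onto_commutes inv commutant_bounded_ops adj_commutant)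
  then show ?thesis using proj_onto_in_projections[OF S] by (auto simp: projections_def)
qed

lemma projection_mem: "p \<in> projections M \<Longrightarrow> p \<in> M"
  by (simp add: projections_def)

lemmas proj_idem = projection_idem[OF _ bounded] and proj_sym = projection_sym[OF _ bounded]

lemma projection_diff_closed:
  "p \<in> projections M \<Longrightarrow> q \<in> projections M \<Longrightarrow> (\<And>x. blinfun_apply p (q x) = q x) \<Longrightarrow> p - q \<in> projections M"
  by (intro projection_diff bounded diff_closed projection_mem)

text \<open>The square root is \<open>1 - y\<close>, where \<open>y\<close> is the limit of the iteration
  \<open>y \<mapsto> (a + y\<^sup>2) / 2\<close> with \<open>a = 1 - b\<^sup>* b\<close>; it is norm convergent because it is majorised by the
  same iteration for the scalar \<open>a = 1\<close>.\<close>

lemma abs_exists: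
  assumes b: "b \<in> M" "norm b \<le> 1"
  shows "\<exists>s\<in>M. (\<forall>x y. cinner (s x) y = cinner x (s y)) \<and> (\<forall>x y. cinner (s x) (s y) = cinner (b x) (b y))"
proof -
  define a where "a = id_blinfun - (adj b o\<^sub>L b)"
  have aM: "a \<in> M" unfolding a_def by (intro diff_closed id_closed compose_closed adj_closed b)
  have b': "b \<in> bounded_ops" using b in_bounded_ops by blast
  have bb: "cinner (adj b (b x)) y = cinner (b x) (b y)" for x y
    by (simp add: cinner_adj_left[OF b'])
  \<comment> \<open>In the expansion of the squared norm of \<open>a x\<close>, the square of
    \<open>norm (adj b (b x))\<close> is at most that of \<open>norm (b x)\<close>, which is
    subtracted twice.\<close>
  have na: "norm a \<le> 1"
  proof (rule norm_blinfun_bound)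
    fix x
    have "norm (adj b (b x)) \<le> norm (adj b) * norm (b x)" by (rule norm_blinfun)
    also have "\<dots> \<le> 1 * norm (b x)"
      using norm_adj_le[OF b'] b(2) by (intro mult_right_mono) auto
    finally have 1: "(norm (adj b (b x)))\<^sup>2 \<le> (norm (b x))\<^sup>2" by simp
    have 2: "inner x (adj b (b x)) = (norm (b x))\<^sup>2"
      by (simp add: inner_eq_Re_cinner flip: cinner_adj_right[OF b'] power2_norm_eq_inner)
        (simp add: cinner_self)
    have "(norm (a x))\<^sup>2 = (norm (x - 1 *\<^sub>R adj b (b x)))\<^sup>2"
      by (simp add: a_def blinfun.bilinear_simps)
    also have "\<dots> = (norm x)\<^sup>2 - 2 * (norm (b x))\<^sup>2 + (norm (adj b (b x)))\<^sup>2"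
      by (subst power2_norm_diff_scaleR) (simp add: 2 power2_norm_eq_inner)
    also have "\<dots> \<le> (norm x)\<^sup>2" using 1 zero_le_power2[of "norm (b x)"] by linarith
    finally have "norm (a x) \<le> norm x" by (rule power2_le_imp_le) simp
    then show "norm (a x) \<le> 1 * norm x" by simp
  qed simp
  have asym: "cinner (a x) y = cinner x (a y)" for x y
    by (simp add: a_def blinfun.bilinear_simps cinner_simps cinner_adj_left[OF b'])
      (simp add: cinner_adj_right[OF b'])
  define Y where "Y = rec_nat 0 (\<lambda>_ y. (1/2) *\<^sub>R (a + (y o\<^sub>L y)))"
  define s where "s = rec_nat (0::real) (\<lambda>_ y. (1 + y\<^sup>2) / 2)"
  have Y: "Y 0 = 0" "\<And>n. Y (Suc n) = (1/2) *\<^sub>R (a + (Y n o\<^sub>L Y n))" by (simp_all add: Y_def)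
  have s: "s 0 = 0" "\<And>n. s (Suc n) = (1 + (s n)\<^sup>2) / 2" by (simp_all add: s_def)
  have YM: "Y n \<in> M" for n
    by (induction n) (auto simp: Y intro!: zero_closed scaleR_closed add_closed compose_closed aM)
  have aY: "a o\<^sub>L Y n = Y n o\<^sub>L a" for n
  proof (induction n)
    case (Suc n)
    have "a (Y n x) = Y n (a x)" for x using arg_cong[OF Suc, of "\<lambda>S. blinfun_apply S x"] by simp
    then show ?case by (auto simp: Y blinfun.bilinear_simps intro!: blinfun_eqI)
  qed (simp add: Y)
  have aY': "a (Y n x) = Y n (a x)" for x n
    using arg_cong[OF aY[of n], of "\<lambda>S. blinfun_apply S x"] by simp
  have YY: "Y m (Y n x) = Y n (Y m x)" for m n x
  proof (induction m arbitrary: x)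
    case (Suc m)
    then show ?case by (simp add: Y blinfun.bilinear_simps aY')
  qed (simp add: Y)
  have Ysym: "cinner (Y n x) y = cinner x (Y n y)" for n x y
  proof (induction n arbitrary: x y)
    case (Suc n)
    then show ?case
      by (simp add: Y blinfun.bilinear_simps cinner_simps asym cinner.scaleR_left cinner.scaleR_right)
  qed (simp add: Y cinner_simps)
  have s01: "0 \<le> s n \<and> s n \<le> 1" for n
    by (induction n) (auto simp: s power_le_one)
  have nY: "norm (Y n) \<le> s n" for n
  proof (induction n)
    case (Suc n)
    have "norm (Y n o\<^sub>L Y n) \<le> (s n)\<^sup>2"
      by (rule order_trans[OF norm_blinfun_compose])
        (use Suc s01[of n] in \<open>auto simp: power2_eq_square intro: mult_mono\<close>)
    then have "norm (a + (Y n o\<^sub>L Y n)) \<le> 1 + (s n)\<^sup>2"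
      using na by (intro norm_triangle_mono) auto
    then show ?case by (simp add: Y s)
  qed (simp add: Y s)
  \<comment> \<open>The increments of \<open>Y\<close> are dominated by those of the bounded
    increasing scalar iteration \<open>s\<close>; this makes \<open>Y\<close> Cauchy.\<close>
  have step1: "norm (Y (Suc n) - Y n) \<le> s (Suc n) - s n" for n
  proof (induction n)
    case 0
    then show ?case using na by (simp add: Y s)
  next
    case (Suc n)
    have "Y (Suc (Suc n)) - Y (Suc n) = (1/2) *\<^sub>R ((Y (Suc n) o\<^sub>L Y (Suc n)) - (Y n o\<^sub>L Y n))"
      unfolding Y(2)[of "Suc n"] using Y(2)[of n] by (simp add: algebra_simps flip: scaleR_right_diff_distrib)
    \<comment> \<open>Difference of squares, valid because the iterates commute by
      \<open>YY\<close>.\<close>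
    also have "(Y (Suc n) o\<^sub>L Y (Suc n)) - (Y n o\<^sub>L Y n) = (Y (Suc n) + Y n) o\<^sub>L (Y (Suc n) - Y n)"
      by (rule blinfun_eqI) (simp add: blinfun.bilinear_simps YY)
    finally have "norm (Y (Suc (Suc n)) - Y (Suc n))
        \<le> 1/2 * (norm (Y (Suc n) + Y n) * norm (Y (Suc n) - Y n))"
      using norm_blinfun_compose[of "Y (Suc n) + Y n" "Y (Suc n) - Y n"] by simp
    also have "norm (Y (Suc n) + Y n) * norm (Y (Suc n) - Y n) \<le> (s (Suc n) + s n) * (s (Suc n) - s n)"
      using nY s01 Suc by (intro mult_mono norm_triangle_mono) auto
    also have "1/2 * \<dots> = (1 + (s (Suc n))\<^sup>2) / 2 - (1 + (s n)\<^sup>2) / 2"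
      by (simp add: field_simps power2_eq_square)
    also have "\<dots> = s (Suc (Suc n)) - s (Suc n)"
      by (simp only: s(2))
    finally show ?case by simp
  qed
  have sinc: "incseq s"
    using step1 by (intro incseq_SucI) (meson diff_ge_0_iff_ge norm_ge_zero order_trans)
  have "Cauchy s"
    using incseq_convergent[OF sinc, of 1] s01 by (metis LIMSEQ_imp_Cauchy)
  have diffle: "norm (Y n - Y m) \<le> s n - s m" if "m \<le> n" for m n
    using that
  proof (induction n rule: dec_induct)
    case (step n)
    have "norm (Y (Suc n) - Y m) \<le> norm (Y (Suc n) - Y n) + norm (Y n - Y m)"
      by (metis norm_triangle_ineq diff_add_cancel add_diff_eq)
    then show ?case using step1[of n] step.IH by linarith
  qed simp
  have "Cauchy Y"
  proof (rule metric_CauchyI)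
    fix e :: real assume "e > 0"
    then obtain N where N: "\<And>m n. m \<ge> N \<Longrightarrow> n \<ge> N \<Longrightarrow> dist (s m) (s n) < e"
      using \<open>Cauchy s\<close> by (metis metric_CauchyD)
    have "dist (Y m) (Y n) < e" if "N \<le> m" "N \<le> n" for m n
    proof (cases "m \<le> n")
      case True
      then show ?thesis using diffle[OF True] N[OF that] by (simp add: dist_norm norm_minus_commute)
    next
      case False
      then show ?thesis using diffle[of n m] N[OF that] by (simp add: dist_norm norm_minus_commute)
    qed
    then show "\<exists>N. \<forall>m\<ge>N. \<forall>n\<ge>N. dist (Y m) (Y n) < e" by blast
  qed
  then obtain y where y: "Y \<longlonglongrightarrow> y" by (auto simp: convergent_eq_Cauchy[symmetric])
  have yM: "y \<in> M" by (rule lim_closed[OF YM y])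
  have yx: "(\<lambda>n. Y n x) \<longlonglongrightarrow> y x" for x by (intro blinfun.tendsto y tendsto_const)
  have ysym: "cinner (y x) z = cinner x (y z)" for x z
    by (rule LIMSEQ_unique[OF cinner.tendsto[OF yx tendsto_const]])
      (simp add: Ysym cinner.tendsto[OF tendsto_const yx])
  have yeq: "y x = (1/2) *\<^sub>R (a x + y (y x))" for x
  proof (rule LIMSEQ_unique)
    show "(\<lambda>n. Y (Suc n) x) \<longlonglongrightarrow> y x" by (rule LIMSEQ_Suc[OF yx])
    have "(\<lambda>n. (1/2) *\<^sub>R (a x + Y n (Y n x))) \<longlonglongrightarrow> (1/2) *\<^sub>R (a x + y (y x))"
      by (intro tendsto_intros blinfun.tendsto[OF y] yx)
    then show "(\<lambda>n. Y (Suc n) x) \<longlonglongrightarrow> (1/2) *\<^sub>R (a x + y (y x))"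
      by (simp add: Y blinfun.bilinear_simps)
  qed
  let ?s = "id_blinfun - y"
  show ?thesis
  proof (intro bexI conjI allI)
    show "?s \<in> M" by (intro diff_closed id_closed yM)
    show ssym: "cinner (?s x) z = cinner x (?s z)" for x z
      by (simp add: blinfun.bilinear_simps cinner_simps ysym)
    fix x z
    \<comment> \<open>By the fixed point equation \<open>yeq\<close>,
      \<open>2 y = a + y\<^sup>2\<close>; hence \<open>(1 - y)\<^sup>2 = 1 - a\<close>, which is
      \<open>adj b o\<^sub>L b\<close>.\<close>
    have "?s (?s x) = x - 2 *\<^sub>R y x + y (y x)"
      by (simp add: blinfun.bilinear_simps scaleR_2)
    also have "2 *\<^sub>R y x = a x + y (y x)" by (subst yeq) simp
    also have "x - (a x + y (y x)) + y (y x) = adj b (b x)"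
      by (simp add: a_def blinfun.bilinear_simps)
    finally have "?s (?s x) = adj b (b x)" .
    then have "cinner (?s (?s x)) z = cinner (b x) (b z)" by (simp only: bb)
    then show "cinner (?s x) (?s z) = cinner (b x) (b z)" by (simp only: ssym)
  qed
qed

end

text \<open>The projection onto the common kernel \<open>S\<close> of all \<open>r1 A\<close>, \<open>A \<in> M\<close>, is central.\<close>

lemma factor_prime:
  assumes "factor M" and r: "r1 \<in> projections M" "r2 \<in> projections M"
    and zero: "\<And>A x. A \<in> M \<Longrightarrow> blinfun_apply r1 (A (r2 x)) = 0"
  shows "r1 = 0 \<or> r2 = 0"
proof (rule disjCI)
  assume "r2 \<noteq> 0"
  interpret vn_algebra M using assms(1) by unfold_locales (simp add: factor_def)
  define S where "S = {y. \<forall>A\<in>M. blinfun_apply r1 (A y) = 0}"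
  have r1M: "r1 \<in> M" "r1 \<in> bounded_ops" using r projection_mem in_bounded_ops by auto
  have S: "closed_csubspace S"
  proof (rule closed_csubspaceI)
    show "closed S" unfolding S_def Ball_def
      by (intro closed_Collect_all closed_Collect_imp open_Collect_const closed_Collect_eq continuous_intros)
    show "c *\<^sub>C x \<in> S" if "x \<in> S" for c x
      using that r1M by (auto simp: S_def bounded_opsD in_bounded_ops)
  qed (auto simp: S_def blinfun.bilinear_simps)
  have inv: "blinfun_apply A x \<in> S" if "A \<in> M" "x \<in> S" for A x
    using that compose_closed[OF _ \<open>A \<in> M\<close>] unfolding S_def
    by (smt (verit) blinfun_apply_blinfun_compose mem_Collect_eq)
  have "proj_onto S \<in> M"
  proof (rule projection_mem[OF proj_onto_closed[OF S]])
    show "blinfun_apply A x \<in> S" if "A \<in> commutant M" "x \<in> S" for A x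
      using that by (simp add: S_def commutantD[OF \<open>A \<in> commutant M\<close>, symmetric] r1M)
  qed
  moreover have "proj_onto S \<in> commutant M"
    unfolding commutant_def
  proof (intro CollectI conjI ballI blinfun_eqI)
    fix A x assume "A \<in> M"
    then have "proj_onto S (A x) = A (proj_onto S x)"
      by (intro proj_onto_commutes S inv in_bounded_ops adj_closed)
    then show "blinfun_apply (proj_onto S o\<^sub>L A) x = blinfun_apply (A o\<^sub>L proj_onto S) x" by simp
  qed (rule proj_onto_bounded_ops[OF S])
  ultimately obtain c where c: "proj_onto S = scalar_op c"
    using assms(1) by (auto simp: factor_def)
  obtain x where x: "r2 x \<noteq> 0"
    using \<open>r2 \<noteq> 0\<close> by (metis blinfun_eqI zero_blinfun.rep_eq)
  \<comment> \<open>A central projection is a scalar \<open>c\<close>; since it fixes the nonzero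
    vector \<open>r2 x\<close>, the scalar is 1 and \<open>S\<close> is the whole space.\<close>
  have "r2 x \<in> S" using zero by (simp add: S_def)
  then have "c *\<^sub>C r2 x = r2 x" using proj_onto_fix[OF S] by (simp add: c scalar_op.rep_eq)
  then have "(c - 1) *\<^sub>C r2 x = 0"
    using scaleC_add_left[of "c - 1" 1 "r2 x"] by simp
  then have "c = 1" using x norm_scaleC[of "c - 1" "r2 x"] by simp
  then have "proj_onto S y = y" for y by (simp add: c scalar_op.rep_eq)
  then have "y \<in> S" for y by (metis proj_onto_in[OF S])
  then have "r1 (id_blinfun y) = 0" for y using id_closed unfolding S_def by blast
  then show "r1 = 0" by (simp add: blinfun_eqI)
qed

section \<open>Halving projections\<close>

text \<open>The graphs of the partial isometries in the commutant of \<open>N\<close>, between orthogonal subspaces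
  of the range of \<open>p\<close>, except that the subspaces need not be closed.\<close>

definition partial_isometry_graph ::
  "('h::complex_hilbert \<Rightarrow>\<^sub>L 'h) set \<Rightarrow> ('h \<Rightarrow>\<^sub>L 'h) \<Rightarrow> ('h \<times> 'h) set \<Rightarrow> bool" where
  "partial_isometry_graph N p G \<longleftrightarrow> (0, 0) \<in> G \<and>
     (\<forall>x y x' y'. (x, y) \<in> G \<longrightarrow> (x', y') \<in> G \<longrightarrow> (x + x', y + y') \<in> G) \<and>
     (\<forall>c x y. (x, y) \<in> G \<longrightarrow> (c *\<^sub>C x, c *\<^sub>C y) \<in> G) \<and>
     (\<forall>A x y. A \<in> N \<longrightarrow> (x, y) \<in> G \<longrightarrow> (A x, A y) \<in> G) \<and>
     (\<forall>x y. (x, y) \<in> G \<longrightarrow> p x = x \<and> p y = y) \<and>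
     (\<forall>x y x' y'. (x, y) \<in> G \<longrightarrow> (x', y') \<in> G \<longrightarrow> cinner x x' = cinner y y' \<and> cinner x y' = 0)"

lemma partial_isometry_graphI:
  assumes "(0, 0) \<in> G"
    and "\<And>x y x' y'. (x, y) \<in> G \<Longrightarrow> (x', y') \<in> G \<Longrightarrow> (x + x', y + y') \<in> G"
    and "\<And>c x y. (x, y) \<in> G \<Longrightarrow> (c *\<^sub>C x, c *\<^sub>C y) \<in> G"
    and "\<And>A x y. A \<in> N \<Longrightarrow> (x, y) \<in> G \<Longrightarrow> (blinfun_apply A x, blinfun_apply A y) \<in> G"
    and "\<And>x y. (x, y) \<in> G \<Longrightarrow> blinfun_apply p x = x"
    and "\<And>x y. (x, y) \<in> G \<Longrightarrow> blinfun_apply p y = y"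
    and "\<And>x y x' y'. (x, y) \<in> G \<Longrightarrow> (x', y') \<in> G \<Longrightarrow> cinner x x' = cinner y y'"
    and "\<And>x y x' y'. (x, y) \<in> G \<Longrightarrow> (x', y') \<in> G \<Longrightarrow> cinner x y' = 0"
  shows "partial_isometry_graph N p G"
  unfolding partial_isometry_graph_def by (intro conjI allI impI; rule assms; assumption)

lemma
  assumes "partial_isometry_graph N p G"
  shows partial_isometry_graph_zero: "(0, 0) \<in> G"
    and partial_isometry_graph_add: "(x, y) \<in> G \<Longrightarrow> (x', y') \<in> G \<Longrightarrow> (x + x', y + y') \<in> G"
    and partial_isometry_graph_scaleC: "(x, y) \<in> G \<Longrightarrow> (c *\<^sub>C x, c *\<^sub>C y) \<in> G"
    and partial_isometry_graph_apply: "A \<in> N \<Longrightarrow> (x, y) \<in> G \<Longrightarrow> (blinfun_apply A x, blinfun_apply A y) \<in> G"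
    and partial_isometry_graph_dom: "(x, y) \<in> G \<Longrightarrow> blinfun_apply p x = x"
    and partial_isometry_graph_ran: "(x, y) \<in> G \<Longrightarrow> blinfun_apply p y = y"
    and partial_isometry_graph_iso: "(x, y) \<in> G \<Longrightarrow> (x', y') \<in> G \<Longrightarrow> cinner x x' = cinner y y'"
    and partial_isometry_graph_orth: "(x, y) \<in> G \<Longrightarrow> (x', y') \<in> G \<Longrightarrow> cinner x y' = 0"
  using assms unfolding partial_isometry_graph_def by blast+

lemmas partial_isometry_graphD = partial_isometry_graph_zero partial_isometry_graph_add
  partial_isometry_graph_scaleC partial_isometry_graph_apply partial_isometry_graph_dom
  partial_isometry_graph_ran partial_isometry_graph_iso partial_isometry_graph_orth

text \<open>Makes a maximal graph closed, and hence the sets of its first and of its second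
  coordinates closed subspaces.\<close>

lemma partial_isometry_graph_closure:
  fixes G :: "('h::complex_hilbert \<times> 'h) set"
  assumes "partial_isometry_graph N p G"
  shows "partial_isometry_graph N p (closure G)"
proof -
  note G = partial_isometry_graphD[OF assms]
  have seq: "\<exists>u v. (\<forall>n. (u n, v n) \<in> G) \<and> u \<longlonglongrightarrow> x \<and> v \<longlonglongrightarrow> y"
    if xy: "(x, y) \<in> closure G" for x y
  proof -
    obtain g where g: "\<And>n. g n \<in> G" "g \<longlonglongrightarrow> (x, y)" using xy unfolding closure_sequential by blast
    show ?thesis
      using g(1) tendsto_fst[OF g(2)] tendsto_snd[OF g(2)]
      by (intro exI[of _ "\<lambda>n. fst (g n)"] exI[of _ "\<lambda>n. snd (g n)"]) auto
  qed
  have clI: "(x, y) \<in> closure G" if "\<And>n. (u n, v n) \<in> G" "u \<longlonglongrightarrow> x" "v \<longlonglongrightarrow> y" for u v x y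
    using that tendsto_Pair[of u x sequentially v y]
    unfolding closure_sequential by (intro exI[of _ "\<lambda>n. (u n, v n)"]) auto
  have ap: "(\<lambda>n. blinfun_apply A (u n)) \<longlonglongrightarrow> A x" if "u \<longlonglongrightarrow> x" for A :: "'h \<Rightarrow>\<^sub>L 'h" and u x
    by (intro blinfun.tendsto that tendsto_const)
  show ?thesis
  proof (rule partial_isometry_graphI)
    show "(0, 0) \<in> closure G" using G(1) closure_subset by blast
  next
    fix x y x' y' assume xy: "(x, y) \<in> closure G" "(x', y') \<in> closure G"
    obtain u v where u: "\<And>n. (u n, v n) \<in> G" "u \<longlonglongrightarrow> x" "v \<longlonglongrightarrow> y" using seq[OF xy(1)] by blast
    obtain u' v' where u': "\<And>n. (u' n, v' n) \<in> G" "u' \<longlonglongrightarrow> x'" "v' \<longlonglongrightarrow> y'" using seq[OF xy(2)] by blast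
    show "(x + x', y + y') \<in> closure G"
      by (rule clI[where u = "\<lambda>n. u n + u' n" and v = "\<lambda>n. v n + v' n"]) (intro G(2) tendsto_add u u')+
    have "(\<lambda>n. cinner (u n) (u' n)) \<longlonglongrightarrow> cinner x x'" "(\<lambda>n. cinner (v n) (v' n)) \<longlonglongrightarrow> cinner y y'"
      "(\<lambda>n. cinner (u n) (v' n)) \<longlonglongrightarrow> cinner x y'"
      by (intro cinner.tendsto u u')+
    then show "cinner x x' = cinner y y'" "cinner x y' = 0"
      by (auto simp: G(7)[OF u(1) u'(1)] G(8)[OF u(1) u'(1)] LIMSEQ_const_iff intro: LIMSEQ_unique)
  next
    fix x y assume xy: "(x, y) \<in> closure G"
    obtain u v where u: "\<And>n. (u n, v n) \<in> G" "u \<longlonglongrightarrow> x" "v \<longlonglongrightarrow> y" using seq[OF xy(1)] by blast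
    show "(c *\<^sub>C x, c *\<^sub>C y) \<in> closure G" for c
      using clI[OF G(3)[OF u(1)]] ap[OF u(2), of "scalar_op c"] ap[OF u(3), of "scalar_op c"]
      by (simp add: scalar_op.rep_eq)
    show "(A x, A y) \<in> closure G" if "A \<in> N" for A
      by (rule clI[where u = "\<lambda>n. A (u n)" and v = "\<lambda>n. A (v n)"]) (intro G(4) that ap u)+
    show "p x = x" "p y = y"
      using ap[OF u(2), of p] ap[OF u(3), of p] u
      by (auto simp: G(5)[OF u(1)] G(6)[OF u(1)] intro: LIMSEQ_unique)
  qed
qed

text \<open>Zorn's lemma applies because no defining condition involves more than two pairs, and two
  pairs in the union of a chain already lie in a common member.\<close>

lemma maximal_partial_isometry_graph:
  "\<exists>G. partial_isometry_graph N p G \<and> closed G \<and> (\<forall>G'. partial_isometry_graph N p G' \<longrightarrow> G \<subseteq> G' \<longrightarrow> G' = G)"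
proof -
  let ?\<G> = "Collect (partial_isometry_graph N p)"
  have "\<exists>G\<in>?\<G>. \<forall>G'\<in>?\<G>. G \<subseteq> G' \<longrightarrow> G' = G"
  proof (rule subset_Zorn_nonempty)
    have "partial_isometry_graph N p {(0, 0)}"
      by (rule partial_isometry_graphI) (auto simp: cinner_simps)
    then show "?\<G> \<noteq> {}" by blast
    fix C assume C: "C \<noteq> {}" "subset.chain ?\<G> C"
    have CG: "partial_isometry_graph N p G" if "G \<in> C" for G
      using C that by (auto simp: subset_chain_def)
    have two: "\<exists>G. partial_isometry_graph N p G \<and> G \<in> C \<and> g \<in> G \<and> g' \<in> G"
      if gs: "g \<in> \<Union>C" "g' \<in> \<Union>C" for g g'
    proof -
      obtain G G' where *: "G \<in> C" "G' \<in> C" "g \<in> G" "g' \<in> G'" using gs by blast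
      then have "G \<subseteq> G' \<or> G' \<subseteq> G" using C by (auto simp: subset_chain_def)
      then show ?thesis using * CG by blast
    qed
    have "partial_isometry_graph N p (\<Union>C)"
    proof (rule partial_isometry_graphI)
      obtain G where "G \<in> C" using C by blast
      then show "(0, 0) \<in> \<Union>C" using CG[of G] partial_isometry_graph_zero by blast
    next
      fix x y x' y' assume xy: "(x, y) \<in> \<Union>C" "(x', y') \<in> \<Union>C"
      then obtain G where G: "partial_isometry_graph N p G" "G \<in> C" "(x, y) \<in> G" "(x', y') \<in> G"
        using two by blast
      note D = partial_isometry_graphD[OF G(1)]
      show "(x + x', y + y') \<in> \<Union>C" "cinner x x' = cinner y y'" "cinner x y' = 0"
        using D(2,7,8)[OF G(3,4)] G(2) by auto
    next
      fix x y assume "(x, y) \<in> \<Union>C"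
      then obtain G where G: "partial_isometry_graph N p G" "G \<in> C" "(x, y) \<in> G"
        using CG by blast
      note D = partial_isometry_graphD[OF G(1)]
      show "(c *\<^sub>C x, c *\<^sub>C y) \<in> \<Union>C" for c using D(3)[OF G(3)] G(2) by blast
      show "(A x, A y) \<in> \<Union>C" if "A \<in> N" for A using D(4)[OF that G(3)] G(2) by blast
      show "p x = x" "p y = y" using D(5,6)[OF G(3)] by auto
    qed
    then show "\<Union>C \<in> ?\<G>" by simp
  qed
  then obtain G where G: "partial_isometry_graph N p G"
    "\<And>G'. partial_isometry_graph N p G' \<Longrightarrow> G \<subseteq> G' \<Longrightarrow> G' = G" by auto
  have "closure G = G" by (intro G partial_isometry_graph_closure closure_subset)
  then have "closed G" by (metis closed_closure)
  then show ?thesis using G by blast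
qed

text \<open>Applied with \<open>s\<close> the absolute value of \<open>b\<close>: the map from
  \<open>s u\<close> to \<open>b u\<close> is isometric, and as its two ranges are orthogonal to
  each other and to everything in \<open>G\<close>, it can be adjoined to \<open>G\<close>.\<close>

lemma partial_isometry_graph_extend:
  fixes b s p :: "'h::complex_hilbert \<Rightarrow>\<^sub>L 'h"
  assumes G: "partial_isometry_graph N p G"
    and N: "\<And>A x. A \<in> N \<Longrightarrow> A (b x) = b (A x)" "\<And>A x. A \<in> N \<Longrightarrow> A (s x) = s (A x)"
    and lin: "b \<in> bounded_ops" "s \<in> bounded_ops"
    and p: "\<And>x. p (b x) = b x" "\<And>x. p (s x) = s x"
    and iso: "\<And>x y. cinner (s x) (s y) = cinner (b x) (b y)" "\<And>x y. cinner (s x) (b y) = 0"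
    and orth: "\<And>x y u. (x, y) \<in> G \<Longrightarrow> cinner x (s u) = 0 \<and> cinner x (b u) = 0 \<and>
      cinner y (s u) = 0 \<and> cinner y (b u) = 0"
  shows "partial_isometry_graph N p {(x + s u, y + b u) |x y u. (x, y) \<in> G}"
    (is "partial_isometry_graph N p ?G")
proof -
  have orth': "cinner (s u) x = 0 \<and> cinner (b u) x = 0 \<and> cinner (s u) y = 0 \<and> cinner (b u) y = 0"
    if "(x, y) \<in> G" for x y u
    using orth[OF that, of u] by (metis cinner_commute complex_cnj_zero)
  note G = partial_isometry_graphD[OF G]
  have I: "(v, w) \<in> ?G" if "(x, y) \<in> G" "v = x + s u" "w = y + b u" for v w x y u using that by blast
  show ?thesis
  proof (rule partial_isometry_graphI)
    show "(0, 0) \<in> ?G" by (rule I[OF G(1), of _ 0]) (simp_all add: blinfun.bilinear_simps)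
  next
    fix v w v' w' assume "(v, w) \<in> ?G" "(v', w') \<in> ?G"
    then obtain x y u x' y' u' where 1: "v = x + s u" "w = y + b u" "v' = x' + s u'" "w' = y' + b u'"
      "(x, y) \<in> G" "(x', y') \<in> G" by blast
    show "(v + v', w + w') \<in> ?G"
      by (rule I[OF G(2)[OF 1(5,6)], of _ "u + u'"]) (simp_all add: 1 blinfun.bilinear_simps)
    show "cinner v v' = cinner w w'" "cinner v w' = 0"
      using orth[OF 1(5)] orth'[OF 1(6)]
      by (simp_all add: 1(1-4) cinner_simps iso G(7)[OF 1(5,6)] G(8)[OF 1(5,6)])
  next
    fix v w assume "(v, w) \<in> ?G"
    then obtain x y u where 1: "v = x + s u" "w = y + b u" "(x, y) \<in> G" by blast
    show "(c *\<^sub>C v, c *\<^sub>C w) \<in> ?G" for c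
      by (rule I[OF G(3)[OF 1(3)], of _ c "c *\<^sub>C u"]) (simp_all add: 1 lin bounded_opsD scaleC_add_right)
    show "(A v, A w) \<in> ?G" if "A \<in> N" for A
      by (rule I[OF G(4)[OF that 1(3)], of _ "A u"]) (simp_all add: 1 N that blinfun.bilinear_simps)
    show "p v = v" "p w = w"
      using G(5,6)[OF 1(3)] by (simp_all add: 1 p blinfun.bilinear_simps)
  qed
qed

section \<open>Tracial states\<close>

locale tracial_vn_algebra = vn_algebra M for M :: "('h::complex_hilbert \<Rightarrow>\<^sub>L 'h) set" +
  fixes \<tau> :: "('h \<Rightarrow>\<^sub>L 'h) \<Rightarrow> complex"
  assumes tr: "tracial_state M \<tau>"
begin

lemma trace_add: "A \<in> M \<Longrightarrow> B \<in> M \<Longrightarrow> \<tau> (A + B) = \<tau> A + \<tau> B"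
  and trace_scalar: "A \<in> M \<Longrightarrow> \<tau> (scalar_op c o\<^sub>L A) = c * \<tau> A"
  and trace_id: "\<tau> id_blinfun = 1"
  and trace_commute: "A \<in> M \<Longrightarrow> B \<in> M \<Longrightarrow> \<tau> (A o\<^sub>L B) = \<tau> (B o\<^sub>L A)"
  and trace_nonneg: "A \<in> M \<Longrightarrow> (\<And>x. cinner (A x) x \<in> \<real>\<^sub>\<ge>\<^sub>0) \<Longrightarrow> \<tau> A \<in> \<real>\<^sub>\<ge>\<^sub>0"
  using tr by (auto simp: tracial_state_def)

lemma trace_scaleR: "A \<in> M \<Longrightarrow> \<tau> (r *\<^sub>R A) = r *\<^sub>R \<tau> A"
proof -
  assume "A \<in> M"
  moreover have "r *\<^sub>R A = scalar_op (complex_of_real r) o\<^sub>L A"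
    by (rule blinfun_eqI) (simp add: scalar_op.rep_eq scaleC_of_real blinfun.bilinear_simps)
  ultimately show ?thesis by (simp add: trace_scalar scaleR_conv_of_real)
qed

lemma trace_diff: "A \<in> M \<Longrightarrow> B \<in> M \<Longrightarrow> \<tau> (A - B) = \<tau> A - \<tau> B"
  using trace_add[of "A - B" B] diff_closed[of A B] by simp

lemma trace_zero: "\<tau> 0 = 0"
  using trace_add[of 0 0] zero_closed by simp

lemma trace_mono:
  assumes "A \<in> M" "B \<in> M" "\<And>x. cinner ((B - A) x) x \<in> \<real>\<^sub>\<ge>\<^sub>0"
  shows "Re (\<tau> A) \<le> Re (\<tau> B)"
proof -
  have "\<tau> (B - A) \<in> \<real>\<^sub>\<ge>\<^sub>0" using assms by (intro trace_nonneg diff_closed)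
  then show ?thesis using assms by (simp add: trace_diff complex_nonneg_Reals_iff)
qed

lemma cinner_projection_nonneg:
  assumes p: "p \<in> projections M" shows "cinner (p x) x \<in> \<real>\<^sub>\<ge>\<^sub>0"
proof -
  have "cinner (p x) x = cinner (p x) (p x)" by (metis p proj_idem proj_sym)
  then show ?thesis by (simp add: cinner_self)
qed

lemma trace_projection_nonneg: "p \<in> projections M \<Longrightarrow> \<tau> p \<in> \<real>\<^sub>\<ge>\<^sub>0"
  by (intro trace_nonneg projection_mem cinner_projection_nonneg)

lemma trace_projection_mono:
  assumes "p \<in> projections M" "q \<in> projections M" "\<And>x. blinfun_apply p (q x) = q x"
  shows "Re (\<tau> q) \<le> Re (\<tau> p)"
  using assms by (intro trace_mono projection_mem cinner_projection_nonneg projection_diff_closed)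

end

lemma blinfun_compose_assoc: "(A o\<^sub>L B) o\<^sub>L C = A o\<^sub>L (B o\<^sub>L C)"
  by (rule blinfun_eqI) simp

lemma complete_image_closed:
  fixes f :: "'a::{real_normed_vector,complete_space} \<Rightarrow> 'b::real_normed_vector"
  assumes "closed S" "subspace S" "bounded_linear f" "0 < e" "\<And>x. x \<in> S \<Longrightarrow> e * norm x \<le> norm (f x)"
  shows "closed (f ` S)"
  using complete_isometric_image[OF assms(4,2,3)] assms(1,5) by (simp add: complete_eq_closed complete_imp_closed)

text \<open>A maximal partial isometry, with initial projection \<open>e1\<close> and final projection \<open>e2\<close>, exhausts \<open>p\<close>:
  a nonzero remainder splits into two orthogonal pieces, and polar decomposition of an element of
  \<open>M\<close> between them extends the partial isometry.  If \<open>Q\<close> is the projection onto the vectors \<open>x + y\<close>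
  with \<open>(x, y)\<close> in its graph, then \<open>e Q e = e / 2\<close> and \<open>Q e Q = Q / 2\<close> for \<open>e \<in> {e1, e2}\<close>, so that both
  have the trace of \<open>Q\<close>.\<close>

lemma halve_projection:
  fixes M :: "('h::complex_hilbert \<Rightarrow>\<^sub>L 'h) set"
  assumes M: "II1_factor M" and tr: "tracial_state M \<tau>" and p: "p \<in> projections M"
  shows "\<exists>q\<in>projections M. (\<forall>x. blinfun_apply p (blinfun_apply q x) = blinfun_apply q x) \<and> \<tau> q = \<tau> p / 2"
proof -
  interpret tracial_vn_algebra M \<tau>
    using M tr by unfold_locales (auto simp: II1_factor_def factor_def)
  obtain G where G: "partial_isometry_graph (commutant M) p G" "closed G"
    and Gmax: "\<And>G'. partial_isometry_graph (commutant M) p G' \<Longrightarrow> G \<subseteq> G' \<Longrightarrow> G' = G"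
    using maximal_partial_isometry_graph[of "commutant M" p] by blast
  note GD = partial_isometry_graphD[OF G(1)]
  note G0 = GD(1) and Gadd = GD(2) and GC = GD(3) and GA = GD(4) and Gp = GD(5,6)
    and Giso = GD(7) and Gorth = GD(8)
  have Gorth': "cinner y x' = 0" if "(x, y) \<in> G" "(x', y') \<in> G" for x y x' y'
    by (metis Gorth[OF that(2,1)] cinner_commute complex_cnj_zero)
  have Gnorm: "norm x = norm y" if "(x, y) \<in> G" for x y
    using Giso[OF that that] by (simp add: cinner_self flip: of_real_power)
  have Gsub: "subspace G"
  proof (rule subspaceI)
    fix g r assume "g \<in> G"
    then show "r *\<^sub>R g \<in> G"
      using GC[of "fst g" "snd g" "complex_of_real r"] by (cases g) (simp add: scaleC_of_real)
  qed (use G0 Gadd in \<open>auto simp: zero_prod_def\<close>)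
  define S1 S2 S3 where "S1 = fst ` G" and "S2 = snd ` G" and "S3 = (\<lambda>g. fst g + snd g) ` G"
  \<comment> \<open>The two coordinates of a pair in \<open>G\<close> have equal norm, so each
    coordinate map is bounded below on \<open>G\<close> and has closed image. The sum of the
    coordinates is treated likewise below, using their orthogonality.\<close>
  have nle: "norm (x, y) \<le> 2 * norm x" if "(x, y) \<in> G" for x y
    using norm_Pair_le[of x y] Gnorm[OF that] by simp
  have "closed S1" unfolding S1_def
    by (rule complete_image_closed[OF G(2) Gsub bounded_linear_fst, of "1/2"]) (use nle in force)+
  then have S1: "closed_csubspace S1"
    by (rule closed_csubspaceI) (use G0 Gadd GC in \<open>force simp: S1_def\<close>)+
  have "closed S2" unfolding S2_def
    by (rule complete_image_closed[OF G(2) Gsub bounded_linear_snd, of "1/2"]) (use nle Gnorm in force)+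
  then have S2: "closed_csubspace S2"
    by (rule closed_csubspaceI) (use G0 Gadd GC in \<open>force simp: S2_def\<close>)+
  have "closed S3" unfolding S3_def
  proof (rule complete_image_closed[OF G(2) Gsub, of _ "1/2"])
    show "bounded_linear (\<lambda>g::'h \<times> 'h. fst g + snd g)"
      by (intro bounded_linear_add bounded_linear_fst bounded_linear_snd)
    fix g assume "g \<in> G"
    then obtain x y where g: "g = (x, y)" "(x, y) \<in> G" by (cases g) auto
    have "inner x y = 0" using Gorth[OF g(2) g(2)] by (simp add: inner_eq_Re_cinner)
    then have "(norm (x + y))\<^sup>2 = (norm x)\<^sup>2 + (norm y)\<^sup>2"
      by (simp add: power2_norm_eq_inner inner_simps inner_commute)
    then have "(norm x)\<^sup>2 \<le> (norm (x + y))\<^sup>2" by simp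
    then have "norm x \<le> norm (x + y)" by (rule power2_le_imp_le) simp
    then show "1 / 2 * norm g \<le> norm (fst g + snd g)" using nle[OF g(2)] by (simp add: g)
  qed simp
  then have S3: "closed_csubspace S3"
  proof (rule closed_csubspaceI)
    show "0 \<in> S3" using G0 by (force simp: S3_def)
    fix u v assume "u \<in> S3" "v \<in> S3"
    then obtain x y x' y' where "u = x + y" "v = x' + y'" and xy: "(x, y) \<in> G" "(x', y') \<in> G"
      by (auto simp: S3_def)
    then show "u + v \<in> S3" unfolding S3_def
      by (intro image_eqI[OF _ Gadd[OF xy]]) (simp add: algebra_simps)
  next
    fix c u assume "u \<in> S3"
    then obtain x y where "u = x + y" "(x, y) \<in> G" by (auto simp: S3_def)
    then show "c *\<^sub>C u \<in> S3" unfolding S3_def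
      by (intro image_eqI[OF _ GC]) (auto simp: scaleC_add_right)
  qed
  define e1 e2 Q where "e1 = proj_onto S1" and "e2 = proj_onto S2" and "Q = proj_onto S3"
  have e1: "e1 \<in> projections M" unfolding e1_def
    by (rule proj_onto_closed[OF S1]) (use GA in \<open>force simp: S1_def\<close>)
  have e2: "e2 \<in> projections M" unfolding e2_def
    by (rule proj_onto_closed[OF S2]) (use GA in \<open>force simp: S2_def\<close>)
  have Q: "Q \<in> projections M" unfolding Q_def
  proof (rule proj_onto_closed[OF S3])
    fix A u assume A: "A \<in> commutant M" "u \<in> S3"
    then obtain x y where "u = x + y" "(x, y) \<in> G" by (auto simp: S3_def)
    then show "A u \<in> S3" unfolding S3_def
      by (intro image_eqI[OF _ GA[OF A(1)]]) (auto simp: blinfun.bilinear_simps)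
  qed
  have e1G: "e1 x = x" "e1 y = 0" if "(x, y) \<in> G" for x y
  proof -
    have "x \<in> S1" using that by (force simp: S1_def)
    moreover have "cinner y z = 0" if "z \<in> S1" for z
      using that Gorth'[OF \<open>(x, y) \<in> G\<close>] by (auto simp: S1_def)
    ultimately show "e1 x = x" "e1 y = 0"
      unfolding e1_def by (simp_all add: proj_onto_fix[OF S1] proj_onto_eq_0[OF S1])
  qed
  have e2G: "e2 y = y" "e2 x = 0" if "(x, y) \<in> G" for x y
  proof -
    have "y \<in> S2" using that by (force simp: S2_def)
    moreover have "cinner x z = 0" if "z \<in> S2" for z
      using that Gorth[OF \<open>(x, y) \<in> G\<close>] by (auto simp: S2_def)
    ultimately show "e2 y = y" "e2 x = 0"
      unfolding e2_def by (simp_all add: proj_onto_fix[OF S2] proj_onto_eq_0[OF S2])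
  qed
  have QG: "Q x = (1/2) *\<^sub>R (x + y)" "Q y = (1/2) *\<^sub>R (x + y)" if g: "(x, y) \<in> G" for x y
  proof -
    have in3: "(1/2) *\<^sub>R (x + y) \<in> S3"
      by (rule closed_csubspace_scaleR[OF S3]) (use g in \<open>force simp: S3_def\<close>)
    have o: "cinner (x - y) z = 0" if z: "z \<in> S3" for z
    proof -
      obtain x' y' where z: "z = x' + y'" "(x', y') \<in> G" using z by (auto simp: S3_def)
      show ?thesis
        using Giso[OF g z(2)] Gorth[OF g z(2)] Gorth'[OF g z(2)] by (simp add: z cinner_simps)
    qed
    have eq: "x - (1/2) *\<^sub>R (x + y) = (1/2) *\<^sub>R (x - y)" "y - (1/2) *\<^sub>R (x + y) = (- 1/2) *\<^sub>R (x - y)"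
      by (simp_all add: algebra_simps flip: scaleR_add_left)
    show "Q x = (1/2) *\<^sub>R (x + y)" "Q y = (1/2) *\<^sub>R (x + y)"
      unfolding Q_def by (rule proj_onto_eqI[OF S3 in3], simp add: eq o cinner.scaleR_left cinner_left.minus)+
  qed
  have e1in: "\<exists>y. (e1 z, y) \<in> G" for z using proj_onto_in[OF S1, of z] by (force simp: e1_def S1_def)
  have e2in: "\<exists>x. (x, e2 z) \<in> G" for z using proj_onto_in[OF S2, of z] by (force simp: e2_def S2_def)
  have Qin: "\<exists>x y. (x, y) \<in> G \<and> Q z = x + y" for z
    using proj_onto_in[OF S3, of z] by (force simp: Q_def S3_def)
  have Mem: "e1 \<in> M" "e2 \<in> M" "Q \<in> M" "p \<in> M" using e1 e2 Q p projection_mem by auto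
  \<comment> \<open>By cyclicity both compressions have the trace of
    \<open>Q o\<^sub>L e\<close>.\<close>
  have eQ: "\<tau> e = \<tau> Q" if e: "e \<in> projections M"
    and 1: "e o\<^sub>L (Q o\<^sub>L e) = (1/2) *\<^sub>R e" and 2: "Q o\<^sub>L (e o\<^sub>L Q) = (1/2) *\<^sub>R Q" for e
  proof -
    have eM: "e \<in> M" and ee: "e o\<^sub>L e = e" and QQ: "Q o\<^sub>L Q = Q" using e Q by (auto simp: projections_def)
    have "\<tau> (e o\<^sub>L (Q o\<^sub>L e)) = \<tau> ((Q o\<^sub>L e) o\<^sub>L e)"
      by (intro trace_commute compose_closed eM Mem)
    also have "\<dots> = \<tau> (Q o\<^sub>L e)" by (simp add: ee blinfun_compose_assoc)
    also have "\<dots> = \<tau> (Q o\<^sub>L (Q o\<^sub>L e))" by (simp add: QQ flip: blinfun_compose_assoc)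
    also have "\<dots> = \<tau> ((Q o\<^sub>L e) o\<^sub>L Q)"
      by (intro trace_commute compose_closed eM Mem)
    also have "\<dots> = \<tau> (Q o\<^sub>L (e o\<^sub>L Q))" by (simp add: blinfun_compose_assoc)
    finally show ?thesis using trace_scaleR[OF eM] trace_scaleR[OF Mem(3)] by (simp add: 1 2)
  qed
  have t1: "\<tau> e1 = \<tau> Q"
  proof (rule eQ[OF e1]; rule blinfun_eqI)
    fix z
    show "(e1 o\<^sub>L (Q o\<^sub>L e1)) z = ((1/2) *\<^sub>R e1) z"
      using e1in[of z] by (auto simp: QG e1G blinfun.bilinear_simps)
    show "(Q o\<^sub>L (e1 o\<^sub>L Q)) z = ((1/2) *\<^sub>R Q) z"
      using Qin[of z] by (auto simp: QG e1G blinfun.bilinear_simps)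
  qed
  have t2: "\<tau> e2 = \<tau> Q"
  proof (rule eQ[OF e2]; rule blinfun_eqI)
    fix z
    show "(e2 o\<^sub>L (Q o\<^sub>L e2)) z = ((1/2) *\<^sub>R e2) z"
      using e2in[of z] by (auto simp: QG e2G blinfun.bilinear_simps)
    show "(Q o\<^sub>L (e2 o\<^sub>L Q)) z = ((1/2) *\<^sub>R Q) z"
      using Qin[of z] by (auto simp: QG e2G blinfun.bilinear_simps)
  qed
  have pe: "p (e1 z) = e1 z" "p (e2 z) = e2 z" for z
    using e1in[of z] e2in[of z] Gp by auto
  have e21: "e2 (e1 z) = 0" "e1 (e2 z) = 0" for z using e1in[of z] e2in[of z] e2G e1G by auto
  define r where "r = p - e1 - e2"
  have r: "r \<in> projections M" unfolding r_def
    by (intro projection_diff_closed e1 e2 p) (simp_all add: pe e21 blinfun.bilinear_simps)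
  have "r = 0"
  proof (rule ccontr)
    assume "r \<noteq> 0"
    then obtain r2 where r2: "r2 \<in> projections M" "r o\<^sub>L r2 = r2" "r2 \<noteq> 0" "r2 \<noteq> r"
      using M r unfolding II1_factor_def by blast
    have rr2: "r (r2 z) = r2 z" for z using r2(2) by (metis blinfun_apply_blinfun_compose)
    define r1 where "r1 = r - r2"
    have r1: "r1 \<in> projections M" unfolding r1_def by (intro projection_diff_closed r r2 rr2)
    have "r1 \<noteq> 0" using r2 by (simp add: r1_def)
    \<comment> \<open>Two nonzero projections of a factor are connected by some \<open>A\<close>; a
      contractive multiple \<open>b\<close> of \<open>r1 A r2\<close> is then available for
      \<open>abs_exists\<close>.\<close>
    then obtain A u where A: "A \<in> M" "r1 (A (r2 u)) \<noteq> 0"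
      using factor_prime[of M r1 r2] M r1 r2 by (auto simp: II1_factor_def)
    define b0 where "b0 = r1 o\<^sub>L A o\<^sub>L r2"
    define b where "b = (1 / (norm b0)) *\<^sub>R b0"
    have bM: "b \<in> M" unfolding b_def b0_def
      by (intro scaleR_closed compose_closed A projection_mem r1 r2)
    have "b0 \<noteq> 0" using A(2) by (auto simp: b0_def dest!: arg_cong[of _ _ "\<lambda>S. blinfun_apply S u"])
    then have nb: "norm b \<le> 1" and b0: "b u \<noteq> 0" using A(2) by (simp_all add: b_def b0_def blinfun.bilinear_simps)
    have r1b: "r1 (b z) = b z" and br2: "b (r2 z) = b z" for z
      by (simp_all add: b_def b0_def blinfun.bilinear_simps proj_idem[OF r1] proj_idem[OF r2(1)])
    obtain s where s: "s \<in> M" "\<And>x y. cinner (s x) y = cinner x (s y)"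
      "\<And>x y. cinner (s x) (s y) = cinner (b x) (b y)"
      using abs_exists[OF bM nb] by blast
    \<comment> \<open>\<open>s\<close> and \<open>b\<close> have the same kernel, because
      \<open>s x\<close> and \<open>b x\<close> always have the same norm.\<close>
    have sr2: "s (r2 z) = s z" for z
    proof -
      have "b (z - r2 z) = 0" by (simp add: blinfun_apply_cdiff br2)
      then have "cinner (s (z - r2 z)) (s (z - r2 z)) = 0" by (simp only: s(3) cinner_left.zero)
      then show ?thesis by (simp add: blinfun_apply_cdiff)
    qed
    have r2s: "r2 (s z) = s z" for z
      by (rule cinner_eqI) (simp add: proj_sym[OF r2(1)] s(2) sr2)
    have re: "r (e1 z) = 0" "r (e2 z) = 0" for z
      by (simp_all add: r_def blinfun.bilinear_simps pe e21 proj_idem[OF e1] proj_idem[OF e2])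
    have rG: "r x = 0" "r y = 0" if "(x, y) \<in> G" for x y
      using re[of x] re[of y] by (simp_all add: e1G[OF that] e2G[OF that])
    have rr1: "r (r1 z) = r1 z" for z
      by (simp add: r1_def blinfun.bilinear_simps rr2 proj_idem[OF r])
    have rb: "r (b z) = b z" and rs: "r (s z) = s z" for z
      using rr1[of "b z"] rr2[of "s z"] by (simp_all add: r1b r2s)
    have pr: "p (r z) = r z" for z by (simp add: r_def blinfun.bilinear_simps pe proj_idem[OF p])
    have r12: "r2 (r1 z) = 0" for z
    proof -
      have "r2 (r z) = r2 z"
        by (rule cinner_eqI) (simp add: proj_sym[OF r2(1)] proj_sym[OF r] rr2)
      then show ?thesis by (simp add: r1_def blinfun.bilinear_simps proj_idem[OF r2(1)])
    qed
    have Go: "cinner x (r z) = 0" "cinner y (r z) = 0" if "(x, y) \<in> G" for x y z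
      using rG[OF that] by (simp_all add: cinner_simps flip: proj_sym[OF r])
    define G1 where "G1 = {(x + s u, y + b u) |x y u. (x, y) \<in> G}"
    have "partial_isometry_graph (commutant M) p G1" unfolding G1_def
    proof (rule partial_isometry_graph_extend[OF G(1)])
      show "p (b x) = b x" "p (s x) = s x" for x using pr[of "b x"] pr[of "s x"] by (simp_all add: rb rs)
      show "cinner (s x) (b y) = 0" for x y
      proof -
        have "cinner (s x) (b y) = cinner (s x) (r2 (r1 (b y)))"
          by (simp only: r2s r1b flip: proj_sym[OF r2(1)])
        then show ?thesis by (simp add: r12 cinner_simps)
      qed
      show "cinner x (s u) = 0 \<and> cinner x (b u) = 0 \<and> cinner y (s u) = 0 \<and> cinner y (b u) = 0"
        if "(x, y) \<in> G" for x y u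
        using Go[OF that, of "s u"] Go[OF that, of "b u"] by (simp add: rs rb)
    qed (use bM s in \<open>auto simp: commutes in_bounded_ops\<close>)
    moreover have "G \<subseteq> G1"
    proof
      fix g assume "g \<in> G"
      then have "g = (fst g + s 0, snd g + b 0)" "(fst g, snd g) \<in> G"
        by (simp_all add: blinfun.bilinear_simps)
      then show "g \<in> G1" unfolding G1_def by blast
    qed
    ultimately have "G1 = G" by (rule Gmax)
    \<comment> \<open>By maximality this pair was already in \<open>G\<close>. But \<open>r\<close>
      annihilates both coordinates of \<open>G\<close>, whereas it fixes the nonzero vector
      \<open>b u\<close>.\<close>
    then have "(0 + s u, 0 + b u) \<in> G" using G0 unfolding G1_def by blast
    then have "r (b u) = 0" using rG by simp
    then show False using b0 by (simp add: rb)
  qed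
  then have "p = e1 + e2" by (simp add: r_def algebra_simps)
  then have "\<tau> p = 2 * \<tau> e1" using t1 t2 Mem by (simp add: trace_add)
  then show ?thesis using e1 pe by (intro bexI[of _ e1]) auto
qed

section \<open>Dyadic projections\<close>

text \<open>The squared distance between \<open>f m x\<close> and \<open>f n x\<close> is the
  difference of their squared norms, and these norms decrease; so the sequence is Cauchy. Its limit
  is fixed by every \<open>f n\<close>, and \<open>x\<close> minus the limit is orthogonal to the
  common range.\<close>

lemma projection_decreasing_tendsto:
  fixes f :: "nat \<Rightarrow> 'h::complex_hilbert \<Rightarrow>\<^sub>L 'h"
  assumes f: "\<And>n. f n \<in> projections bounded_ops"
    and dec: "\<And>m n x. m \<le> n \<Longrightarrow> f m (f n x) = f n x"
  shows "(\<lambda>n. f n x) \<longlonglongrightarrow> proj_onto {x. \<forall>n. f n x = x} x"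
proof -
  note idem = projection_idem[OF f order_refl] and sym = projection_sym[OF f order_refl]
  have dec': "f n (f m x) = f n x" if "m \<le> n" for m n x
    by (rule cinner_eqI) (simp add: sym dec[OF that])
  have eq: "(norm (f m x - f n x))\<^sup>2 = (norm (f m x))\<^sup>2 - (norm (f n x))\<^sup>2" if "m \<le> n" for m n
  proof -
    have 1: "cinner (f m x) (f n x) = cinner (f n x) (f n x)"
      by (simp flip: sym) (simp add: dec'[OF that] idem)
    then have "cinner (f n x) (f m x) = cinner (f n x) (f n x)" by (metis cinner_commute)
    with 1 have "inner (f m x) (f n x) = inner (f n x) (f n x)"
      by (simp add: inner_eq_Re_cinner)
    then show ?thesis by (simp add: power2_norm_eq_inner inner_simps inner_commute)
  qed
  have "decseq (\<lambda>n. (norm (f n x))\<^sup>2)"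
    by (rule decseq_SucI) (metis eq[of _ "Suc _"] diff_ge_0_iff_ge zero_le_power2 le_SucI order_refl)
  then obtain L where "(\<lambda>n. (norm (f n x))\<^sup>2) \<longlonglongrightarrow> L"
    using decseq_convergent[of "\<lambda>n. (norm (f n x))\<^sup>2" 0] by auto
  then have C: "Cauchy (\<lambda>n. (norm (f n x))\<^sup>2)" by (rule LIMSEQ_imp_Cauchy)
  have "Cauchy (\<lambda>n. f n x)"
  proof (rule metric_CauchyI)
    fix e :: real assume e: "e > 0"
    then obtain N where N: "\<And>m n. m \<ge> N \<Longrightarrow> n \<ge> N \<Longrightarrow> dist ((norm (f m x))\<^sup>2) ((norm (f n x))\<^sup>2) < e\<^sup>2"
      using metric_CauchyD[OF C, of "e\<^sup>2"] by auto
    have *: "dist (f m x) (f n x) < e" if "N \<le> m" "N \<le> n" "m \<le> n" for m n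
    proof -
      have "(norm (f m x - f n x))\<^sup>2 < e\<^sup>2"
        using N[OF that(1,2)] by (simp add: eq[OF that(3)] dist_real_def)
      then show ?thesis using e by (simp add: dist_norm power2_less_imp_less)
    qed
    have "dist (f m x) (f n x) < e" if "N \<le> m" "N \<le> n" for m n
      using *[of m n] *[of n m] that by (metis dist_commute nat_le_linear)
    then show "\<exists>N. \<forall>m\<ge>N. \<forall>n\<ge>N. dist (f m x) (f n x) < e" by blast
  qed
  then obtain z where z: "(\<lambda>n. f n x) \<longlonglongrightarrow> z" by (auto simp: convergent_eq_Cauchy[symmetric])
  have "f m z = z" for m
  proof (rule LIMSEQ_unique)
    show "(\<lambda>n. f m (f n x)) \<longlonglongrightarrow> f m z" by (intro blinfun.tendsto z tendsto_const)
    have "\<forall>\<^sub>F n in sequentially. f m (f n x) = f n x"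
      using eventually_ge_at_top[of m] by eventually_elim (rule dec)
    with z show "(\<lambda>n. f m (f n x)) \<longlonglongrightarrow> z" by (simp add: tendsto_cong)
  qed
  moreover have "cinner (x - z) w = 0" if w: "\<forall>n. f n w = w" for w
  proof -
    have "(\<lambda>n. cinner (x - f n x) w) \<longlonglongrightarrow> cinner (x - z) w"
      by (intro cinner.tendsto tendsto_diff z tendsto_const)
    moreover have "cinner (x - f n x) w = 0" for n
      using w by (simp add: cinner_simps sym)
    ultimately show ?thesis by (simp add: LIMSEQ_const_iff)
  qed
  moreover have "closed_csubspace {x. \<forall>n. f n x = x}"
  proof -
    have "{x. \<forall>n. f n x = x} = (\<Inter>n. {x. f n x = x})" by auto
    moreover note S = closed_csubspace_range[OF f order_refl]
    have "closed (\<Inter>n. {x. f n x = x})" using S by (auto simp: closed_csubspace_def)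
    ultimately show ?thesis using S
      by (intro closed_csubspaceI) (auto simp: closed_csubspace_def)
  qed
  ultimately have "proj_onto {x. \<forall>n. f n x = x} x = z" by (intro proj_onto_eqI) auto
  then show ?thesis using z by simp
qed

text \<open>The trace is not assumed to be normal, so the infimum \<open>g\<close> of the iterated halves need not vanish;
  but its trace does, and it is subtracted.\<close>

lemma dyadic_projections_exist:
  fixes M :: "('h::complex_hilbert \<Rightarrow>\<^sub>L 'h) set"
  assumes M: "II1_factor M" and tr: "tracial_state M \<tau>"
  shows "\<exists>e. e 0 = id_blinfun \<and> (\<forall>n. e n \<in> projections M) \<and> (\<forall>n. \<tau> (e n) = 1 / 2 ^ n) \<and>
    (\<forall>m n x. m \<le> n \<longrightarrow> blinfun_apply (e m) (e n x) = e n x) \<and> (\<forall>x. (\<lambda>n. e n x) \<longlonglongrightarrow> 0)"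
proof -
  interpret tracial_vn_algebra M \<tau>
    using M tr by unfold_locales (auto simp: II1_factor_def factor_def)
  have idp: "id_blinfun \<in> projections M" by (rule projectionsI) (simp_all add: id_closed)
  obtain f where f: "\<And>n. f n \<in> projections M \<and> \<tau> (f n) = 1 / 2 ^ n"
    and fS: "\<And>n x. blinfun_apply (f n) (f (Suc n) x) = f (Suc n) x"
  proof -
    have "\<exists>f. \<forall>n. (f n \<in> projections M \<and> \<tau> (f n) = 1 / 2 ^ n) \<and>
      (\<forall>x. blinfun_apply (f n) (f (Suc n) x) = f (Suc n) x)"
    proof (rule dependent_nat_choice)
      show "\<exists>p. p \<in> projections M \<and> \<tau> p = 1 / 2 ^ 0" using idp trace_id by (intro exI[of _ id_blinfun]) simp
      show "\<exists>q. (q \<in> projections M \<and> \<tau> q = 1 / 2 ^ Suc n) \<and> (\<forall>x. blinfun_apply p (q x) = q x)"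
        if "p \<in> projections M \<and> \<tau> p = 1 / 2 ^ n" for p n
        using halve_projection[OF M tr, of p] that by auto
    qed
    then show thesis using that by blast
  qed
  have dec: "blinfun_apply (f m) (f n x) = f n x" if "m \<le> n" for m n x
    using that
  proof (induction n arbitrary: x rule: dec_induct)
    case base
    then show ?case using f proj_idem by blast
  next
    case (step n)
    show ?case using step.IH[of "f (Suc n) x"] by (simp add: fS)
  qed
  define S where "S = {x. \<forall>n. f n x = x}"
  define g where "g = proj_onto S"
  have fb: "f n \<in> projections bounded_ops" for n
    using f[of n] bounded by (auto simp: projections_def)
  have Seq: "S = (\<Inter>n. {x. f n x = x})" by (auto simp: S_def)
  have S1: "closed_csubspace {x. f n x = x}" for n by (rule closed_csubspace_range[OF fb order_refl])
  have S: "closed_csubspace S" unfolding Seq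
    using S1 by (auto simp: closed_csubspace_def intro!: closed_INT)
  have g: "g \<in> projections M" unfolding g_def
    by (rule proj_onto_closed[OF S]) (use f projection_mem in \<open>auto simp: S_def commutes\<close>)
  have fg: "f n (g x) = g x" for n x using proj_onto_in[OF S, of x] by (simp add: S_def g_def)
  have gf: "g (f n x) = g x" for n x
    by (rule cinner_eqI) (use f[of n] in \<open>simp add: proj_sym[OF g] proj_sym fg\<close>)
  have lim: "(\<lambda>n. f n x) \<longlonglongrightarrow> g x" for x
    unfolding g_def S_def by (rule projection_decreasing_tendsto[OF fb dec])
  have tg: "\<tau> g = 0"
  proof -
    have "Re (\<tau> g) \<le> 1 / 2 ^ n" for n
    proof -
      have "Re (\<tau> g) \<le> Re (\<tau> (f n))" using f by (intro trace_projection_mono g fg) auto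
      also have "\<tau> (f n) = complex_of_real (1 / 2 ^ n)" using f[of n] by simp
      finally show ?thesis by (simp only: Re_complex_of_real)
    qed
    moreover have "(\<lambda>n. 1 / 2 ^ n :: real) \<longlonglongrightarrow> 0" by (rule LIMSEQ_divide_realpow_zero) simp
    ultimately have "Re (\<tau> g) \<le> 0" by (intro LIMSEQ_le_const) auto
    moreover have "\<tau> g \<in> \<real>\<^sub>\<ge>\<^sub>0" by (rule trace_projection_nonneg[OF g])
    ultimately show ?thesis by (simp add: complex_nonneg_Reals_iff complex_eq_iff)
  qed
  \<comment> \<open>Nothing is subtracted at \<open>n = 0\<close>: the first difference
    \<open>e 0 - e 1\<close> thereby absorbs \<open>g\<close>, and the differences still sum to the
    identity.\<close>
  define e where "e n = (if n = 0 then id_blinfun else f n - g)" for n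
  show ?thesis
  proof (intro exI conjI allI impI)
    show "e 0 = id_blinfun" by (simp add: e_def)
    show "e n \<in> projections M" for n
      using f idp g fg by (auto simp: e_def intro!: projection_diff_closed)
    show "\<tau> (e n) = 1 / 2 ^ n" for n
      using f[of n] g by (auto simp: e_def trace_id trace_diff projection_mem tg)
    show "e m (e n x) = e n x" if "m \<le> n" for m n x
      using that proj_idem[OF g] by (auto simp: e_def blinfun.bilinear_simps dec fg gf)
    show "(\<lambda>n. e n x) \<longlonglongrightarrow> 0" for x
    proof -
      have "(\<lambda>n. f n x - g x) \<longlonglongrightarrow> g x - g x" by (intro tendsto_diff lim tendsto_const)
      moreover have "\<forall>\<^sub>F n in sequentially. f n x - g x = e n x"
        using eventually_gt_at_top[of 0] by eventually_elim (simp add: e_def blinfun.bilinear_simps)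
      ultimately show ?thesis using tendsto_cong by fastforce
    qed
  qed
qed

section \<open>Functional calculus of diagonal operators\<close>

locale orthogonal_resolution =
  fixes p :: "nat \<Rightarrow> 'h::complex_hilbert \<Rightarrow>\<^sub>L 'h"
  assumes proj: "\<And>n. p n \<in> projections bounded_ops"
    and orth: "\<And>m n x. m \<noteq> n \<Longrightarrow> p m (p n x) = 0"
    and resolution: "\<And>x. (\<lambda>n. p n x) sums x"
begin

lemmas idem = projection_idem[OF proj order_refl] and sym = projection_sym[OF proj order_refl]

lemma apply_apply: "blinfun_apply (p m) (p n x) = (if m = n then p n x else 0)"
  using orth idem by simp

lemma bounded_op: "p n \<in> bounded_ops"
  using proj by (simp add: projections_def)

lemma eqI: "(\<And>n. p n x = p n y) \<Longrightarrow> x = y"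
  using resolution[of x] resolution[of y] by (simp add: sums_unique2)

lemma sums_cinner: "(\<lambda>n. cinner (p n x) y) sums cinner x y"
  by (rule bounded_linear.sums[OF cinner.bounded_linear_left resolution])

lemma cinner_apply_self: "cinner (p n x) x = complex_of_real ((norm (p n x))\<^sup>2)"
  by (metis cinner_self idem sym)

lemma sums_norm2: "(\<lambda>n. (norm (p n x))\<^sup>2) sums (norm x)\<^sup>2"
  using sums_Re[OF sums_cinner[of x x]] by (simp only: cinner_apply_self cinner_self Re_complex_of_real)

text \<open>The \<open>c n\<close> are pairwise orthogonal, so by Pythagoras the partial sums are
  Cauchy as soon as the squared norms are summable.\<close>

lemma riesz_fischer:
  assumes c: "\<And>n. p n (c n) = c n" and s: "summable (\<lambda>n. (norm (c n))\<^sup>2)"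
  shows "\<exists>y. \<forall>n. p n y = c n"
proof -
  have pc: "p m (c n) = (if m = n then c n else 0)" for m n
    using apply_apply[of m n "c n"] by (simp add: c)
  have pyth: "(norm (sum c A))\<^sup>2 = (\<Sum>n\<in>A. (norm (c n))\<^sup>2)" if "finite A" for A
  proof (rule norm_sum_Pythagorean[OF that], unfold pairwise_def, intro ballI impI)
    fix m n :: nat assume "m \<noteq> n"
    have "cinner (c m) (c n) = cinner (c m) (p n (c n))" by (simp add: pc)
    also have "\<dots> = cinner (p n (c m)) (c n)" by (simp add: sym)
    finally show "orthogonal (c m) (c n)"
      using \<open>m \<noteq> n\<close> by (simp add: pc orthogonal_def inner_eq_Re_cinner cinner_simps)
  qed
  have "summable c"
    unfolding summable_Cauchy
  proof (intro allI impI)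
    fix e :: real assume e: "e > 0"
    then obtain N where N: "\<And>m n. m \<ge> N \<Longrightarrow> norm (\<Sum>k=m..<n. (norm (c k))\<^sup>2) < e\<^sup>2"
      using s unfolding summable_Cauchy by (meson zero_less_power)
    have "norm (sum c {m..<n}) < e" if "m \<ge> N" for m n
    proof -
      have "(norm (sum c {m..<n}))\<^sup>2 < e\<^sup>2" using N[OF that, of n] by (simp add: pyth)
      then show ?thesis using e by (simp add: power2_less_imp_less)
    qed
    then show "\<exists>N. \<forall>m\<ge>N. \<forall>n. norm (sum c {m..<n}) < e" by blast
  qed
  then have "p m (suminf c) = (\<Sum>n. p m (c n))" for m
    by (rule bounded_linear.suminf[OF blinfun.bounded_linear_right])
  also have "(\<Sum>n. p m (c n)) = c m" for m
    using suminf_finite[of "{m}" "\<lambda>n. p m (c n)"] by (simp add: pc)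
  finally show ?thesis by blast
qed

text \<open>The strong sum of the \<open>p n\<close> with \<open>n \<in> A\<close>. Written as a
  projection onto a closed subspace, it is a bounded operator without a limit being taken.\<close>

definition select :: "nat set \<Rightarrow> 'h \<Rightarrow>\<^sub>L 'h" where
  "select A = proj_onto {x. \<forall>n. n \<notin> A \<longrightarrow> p n x = 0}"

lemma select_space: "closed_csubspace {x. \<forall>n. n \<notin> A \<longrightarrow> p n x = 0}"
proof -
  have "{x. \<forall>n. n \<notin> A \<longrightarrow> p n x = 0} = (\<Inter>n\<in>-A. {x. p n x = 0})" by auto
  moreover have "closed {x. p n x = 0}" for n
    by (intro closed_Collect_eq continuous_intros)
  ultimately show ?thesis
    by (intro closed_csubspaceI)
      (auto simp: blinfun.bilinear_simps bounded_opsD[OF bounded_op] intro!: closed_INT)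
qed

lemma apply_select: "p n (select A x) = (if n \<in> A then p n x else 0)"
proof (cases "n \<in> A")
  case True
  have "cinner (p n (x - select A x)) z = 0" for z
  proof -
    have "cinner (x - select A x) (p n z) = 0"
      unfolding select_def
      by (rule proj_onto_orth[OF select_space]) (use True in \<open>auto simp: apply_apply\<close>)
    then show ?thesis by (simp add: sym)
  qed
  then have "p n (x - select A x) = 0" by (metis cinner_self_eq_0_iff)
  then show ?thesis using True by (simp add: blinfun.bilinear_simps)
next
  case False
  then show ?thesis using proj_onto_in[OF select_space[of A], of x] by (auto simp: select_def)
qed

lemma select_projection: "select A \<in> projections bounded_ops"
  unfolding select_def by (rule proj_onto_in_projections[OF select_space])

lemma sums_norm2_select: "(\<lambda>n. if n \<in> A then (norm (p n x))\<^sup>2 else 0) sums (norm (select A x))\<^sup>2"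
  using sums_norm2[of "select A x"] by (simp add: apply_select if_distrib[of "\<lambda>z. (norm z)\<^sup>2"] cong: if_cong)

lemma norm_select_le: "norm (select A x) \<le> norm x"
  by (rule projection_orth_norm_le[OF select_projection order_refl])

text \<open>Replace \<open>x\<close> by a finite partial sum \<open>w\<close> of its components. On
  \<open>w\<close> only finitely many indices matter, so the operators agree eventually; on
  \<open>x - w\<close> all of them are contractions.\<close>

lemma select_tendsto:
  assumes "\<And>n. \<forall>\<^sub>F N in sequentially. n \<in> A N \<longleftrightarrow> n \<in> B"
  shows "(\<lambda>N. select (A N) x) \<longlonglongrightarrow> select B x"
proof (rule metric_LIMSEQ_I)
  fix e :: real assume e: "e > 0"
  have "(\<lambda>K. \<Sum>n<K. p n x) \<longlonglongrightarrow> x" using resolution by (simp add: sums_def)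
  then obtain K where K: "norm ((\<Sum>n<K. p n x) - x) < e / 2"
    using LIMSEQ_D[of "\<lambda>K. \<Sum>n<K. p n x" x "e/2"] e by auto
  define w where "w = (\<Sum>n<K. p n x)"
  have "\<forall>\<^sub>F N in sequentially. \<forall>n\<in>{..<K}. n \<in> A N \<longleftrightarrow> n \<in> B"
    by (intro eventually_ball_finite) (use assms in auto)
  then obtain N0 where N0: "\<And>N n. N \<ge> N0 \<Longrightarrow> n < K \<Longrightarrow> n \<in> A N \<longleftrightarrow> n \<in> B"
    unfolding eventually_sequentially by auto
  have pw: "p n w = (if n < K then p n x else 0)" for n
    by (simp add: w_def blinfun.sum_right apply_apply)
  have "dist (select (A N) x) (select B x) < e" if "N \<ge> N0" for N
  proof -
    have "select (A N) w = select B w"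
      by (rule eqI) (use N0[OF that] in \<open>simp add: apply_select pw\<close>)
    then have "select (A N) x - select B x = select (A N) (x - w) - select B (x - w)"
      by (simp add: blinfun.bilinear_simps)
    also have "norm \<dots> \<le> norm (select (A N) (x - w)) + norm (select B (x - w))"
      by (rule norm_triangle_ineq4)
    also have "\<dots> \<le> norm (x - w) + norm (x - w)" by (intro add_mono norm_select_le)
    also have "\<dots> < e" using K by (simp add: w_def norm_minus_commute)
    finally show ?thesis by (simp add: dist_norm)
  qed
  then show "\<exists>N0. \<forall>N\<ge>N0. dist (select (A N) x) (select B x) < e" by blast
qed

text \<open>A mass \<open>p n\<close> sits at the point \<open>l n\<close>; several indices may
  share a point.\<close>

definition diag_spectral_measure :: "(nat \<Rightarrow> real) \<Rightarrow> real set \<Rightarrow> 'h \<Rightarrow>\<^sub>L 'h" where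
  "diag_spectral_measure l B = select {n. l n \<in> B}"

lemma spectral_measure_diag: "spectral_measure (diag_spectral_measure l)"
  unfolding spectral_measure_def
proof (intro conjI ballI allI impI)
  show "diag_spectral_measure l B \<in> projections bounded_ops" for B
    by (simp add: diag_spectral_measure_def select_projection)
  show "diag_spectral_measure l UNIV = id_blinfun"
    by (rule blinfun_eqI, rule eqI) (simp add: diag_spectral_measure_def apply_select)
  show "diag_spectral_measure l (B \<inter> C) = diag_spectral_measure l B o\<^sub>L diag_spectral_measure l C" for B C
    by (rule blinfun_eqI, rule eqI) (simp add: diag_spectral_measure_def apply_select)
  fix B :: "nat \<Rightarrow> real set" and x
  assume d: "disjoint_family B"
  have "(\<Sum>i<N. diag_spectral_measure l (B i) x) = select {n. l n \<in> (\<Union>i<N. B i)} x" for N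
  proof (rule eqI)
    fix k
    have "(\<Sum>i<N. if l k \<in> B i then p k x else 0) = (if \<exists>i\<in>{..<N}. l k \<in> B i then p k x else 0)"
    proof (cases "\<exists>i\<in>{..<N}. l k \<in> B i")
      case True
      then obtain i where i: "i < N" "l k \<in> B i" by blast
      have "l k \<in> B j \<longleftrightarrow> j = i" for j using d i(2) unfolding disjoint_family_on_def by blast
      then show ?thesis using i by (simp cong: if_cong)
    qed auto
    then show "p k (\<Sum>i<N. diag_spectral_measure l (B i) x) = p k (select {n. l n \<in> (\<Union>i<N. B i)} x)"
      by (simp add: blinfun.sum_right diag_spectral_measure_def apply_select)
  qed
  moreover have "(\<lambda>N. select {n. l n \<in> (\<Union>i<N. B i)} x) \<longlonglongrightarrow> select {n. l n \<in> (\<Union>i. B i)} x"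
  proof (rule select_tendsto)
    fix n
    show "\<forall>\<^sub>F N in sequentially. n \<in> {n. l n \<in> (\<Union>i<N. B i)} \<longleftrightarrow> n \<in> {n. l n \<in> (\<Union>i. B i)}"
    proof (cases "l n \<in> (\<Union>i. B i)")
      case True
      then obtain i where "l n \<in> B i" by blast
      then have "n \<in> {n. l n \<in> (\<Union>i<N. B i)}" if "N > i" for N using that by auto
      then have "\<forall>\<^sub>F N in sequentially. n \<in> {n. l n \<in> (\<Union>i<N. B i)}"
        by (rule eventually_mono[OF eventually_gt_at_top[of i]])
      then show ?thesis by eventually_elim (use True in auto)
    qed auto
  qed
  ultimately show "(\<lambda>n. diag_spectral_measure l (B n) x) sums diag_spectral_measure l (\<Union>n. B n) x"
    by (simp add: sums_def diag_spectral_measure_def)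
qed

end

section \<open>Scalar measures of a general spectral measure\<close>

lemma spectral_measure_projection: "spectral_measure P \<Longrightarrow> B \<in> sets borel \<Longrightarrow> P B \<in> projections bounded_ops"
  by (simp add: spectral_measure_def)

lemma spectral_measure_UNIV: "spectral_measure P \<Longrightarrow> P UNIV = id_blinfun"
  by (simp add: spectral_measure_def)

lemma spectral_measure_Int:
  "spectral_measure P \<Longrightarrow> B \<in> sets borel \<Longrightarrow> C \<in> sets borel \<Longrightarrow> P (B \<inter> C) = P B o\<^sub>L P C"
  by (simp only: spectral_measure_def)

lemma spectral_measure_sums:
  assumes "spectral_measure P" "range A \<subseteq> sets borel" "disjoint_family A"
  shows "(\<lambda>n. blinfun_apply (P (A n)) x) sums blinfun_apply (P (\<Union>n. A n)) x"
proof -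
  have "\<forall>B. range B \<subseteq> sets borel \<longrightarrow> disjoint_family B \<longrightarrow>
    (\<forall>x. (\<lambda>n. blinfun_apply (P (B n)) x) sums blinfun_apply (P (\<Union>n. B n)) x)"
    using assms(1) unfolding spectral_measure_def by (elim conjE) assumption
  then show ?thesis using assms(2,3) by blast
qed

lemma spectral_measure_cinner_self:
  assumes P: "spectral_measure P" and B: "B \<in> sets borel"
  shows "cinner (P B x) x = complex_of_real ((norm (P B x))\<^sup>2)"
proof -
  note PB = spectral_measure_projection[OF P B]
  have "cinner (P B x) (P B x) = cinner (P B (P B x)) x"
    by (rule projection_sym[OF PB order_refl, symmetric])
  then show ?thesis by (simp only: projection_idem[OF PB order_refl] cinner_self)
qed

lemma sets_scalar_measure [simp, measurable_cong]: "sets (scalar_measure P x) = sets borel"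
  unfolding scalar_measure_def using sets.sets_measure_of_eq[of borel] by simp

lemma space_scalar_measure [simp]: "space (scalar_measure P x) = UNIV"
  using sets_eq_imp_space_eq[OF sets_scalar_measure] by simp

text \<open>The squared norm equals \<open>cinner (P B x) x\<close>, which inherits countable
  additivity from the strong additivity of \<open>P\<close>.\<close>

lemma emeasure_scalar_measure:
  assumes P: "spectral_measure P" and B: "B \<in> sets borel"
  shows "emeasure (scalar_measure P x) B = ennreal ((norm (P B x))\<^sup>2)"
proof (rule emeasure_measure_of[OF scalar_measure_def])
  show "positive (sets (scalar_measure P x)) (\<lambda>B. ennreal ((norm (P B x))\<^sup>2))"
  proof -
    \<comment> \<open>The constant sequence of empty sets is disjoint, and a constant series
      converges only if its term is zero.\<close>
    have "(\<lambda>n. P {} x) sums P {} x"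
      using spectral_measure_sums[OF P, of "\<lambda>_. {}" x] by (simp add: disjoint_family_on_def)
    then have "P {} x = 0" by (metis summable_const_iff sums_summable)
    then show ?thesis by (simp add: positive_def)
  qed
  show "countably_additive (sets (scalar_measure P x)) (\<lambda>B. ennreal ((norm (P B x))\<^sup>2))"
  proof (rule countably_additiveI)
    fix A :: "nat \<Rightarrow> real set"
    assume A: "range A \<subseteq> sets (scalar_measure P x)" "disjoint_family A"
    then have A': "A n \<in> sets borel" for n by auto
    have "(\<lambda>n. cinner (P (A n) x) x) sums cinner (P (\<Union>n. A n) x) x"
      by (rule bounded_linear.sums[OF cinner.bounded_linear_left spectral_measure_sums[OF P]])
        (use A in auto)
    then have "(\<lambda>n. Re (cinner (P (A n) x) x)) sums Re (cinner (P (\<Union>n. A n) x) x)"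
      by (rule sums_Re)
    then have "(\<lambda>n. (norm (P (A n) x))\<^sup>2) sums (norm (P (\<Union>n. A n) x))\<^sup>2"
      using A' by (subst (asm) (1 2) spectral_measure_cinner_self[OF P]) auto
    then show "(\<Sum>n. ennreal ((norm (P (A n) x))\<^sup>2)) = ennreal ((norm (P (\<Union>n. A n) x))\<^sup>2)"
      by (intro suminf_ennreal_eq) simp_all
  qed
qed (use B in auto)

lemma finite_scalar_measure:
  "spectral_measure P \<Longrightarrow> finite_measure (scalar_measure P x)"
  by (rule finite_measureI) (simp add: emeasure_scalar_measure)

lemma scalar_measure_cong:
  assumes P: "spectral_measure P" "spectral_measure Q" and eq: "\<And>B. B \<in> sets borel \<Longrightarrow> P B = Q B"
  shows "scalar_measure P = scalar_measure Q"
  by (rule ext, rule measure_eqI) (auto simp: emeasure_scalar_measure P eq)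

section \<open>Spectral integrals of diagonal operators\<close>

context orthogonal_resolution
begin

text \<open>The domain is implicit: it consists of all \<open>x\<close> for which a vector with the
  prescribed components exists, that is, the maximal domain of the diagonal operator.\<close>

definition diag :: "(nat \<Rightarrow> real) \<Rightarrow> 'h uop" where
  "diag a = {(x, y). \<forall>n. p n y = a n *\<^sub>R p n x}"

lemma diag_iff: "(x, y) \<in> diag a \<longleftrightarrow> (\<forall>n. p n y = a n *\<^sub>R p n x)"
  by (simp add: diag_def)

text \<open>Turns integrals against scalar measures into series over the index of the
  resolution.\<close>

lemma scalar_measure_diag:
  "scalar_measure (diag_spectral_measure l) x =
    distr (density (count_space UNIV) (\<lambda>n. ennreal ((norm (p n x))\<^sup>2))) borel l"
proof (rule measure_eqI)
  fix B assume "B \<in> sets (scalar_measure (diag_spectral_measure l) x)"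
  then have B: "B \<in> sets borel" by simp
  have "emeasure (distr (density (count_space UNIV) (\<lambda>n. ennreal ((norm (p n x))\<^sup>2))) borel l) B
      = (\<Sum>n. ennreal ((norm (p n x))\<^sup>2) * indicator {n. l n \<in> B} n)"
    using B by (simp add: emeasure_distr emeasure_density nn_integral_count_space_nat vimage_def)
  also have "\<dots> = (\<Sum>n. ennreal (if l n \<in> B then (norm (p n x))\<^sup>2 else 0))"
    by (intro suminf_cong) auto
  also have "\<dots> = ennreal ((norm (diag_spectral_measure l B x))\<^sup>2)"
    using sums_norm2_select[of "{n. l n \<in> B}" x]
    by (intro suminf_ennreal_eq) (auto simp: diag_spectral_measure_def)
  finally show "emeasure (scalar_measure (diag_spectral_measure l) x) B =
      emeasure (distr (density (count_space UNIV) (\<lambda>n. ennreal ((norm (p n x))\<^sup>2))) borel l) B"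
    using B by (simp add: emeasure_scalar_measure[OF spectral_measure_diag])
qed simp

lemma spectral_domain_diag:
  assumes f: "f \<in> borel_measurable borel"
  shows "x \<in> spectral_domain (diag_spectral_measure l) f \<longleftrightarrow>
    summable (\<lambda>n. (f (l n))\<^sup>2 * (norm (p n x))\<^sup>2)"
proof -
  have "(\<integral>\<^sup>+ s. ennreal ((f s)\<^sup>2) \<partial>scalar_measure (diag_spectral_measure l) x)
      = (\<Sum>n. ennreal ((f (l n))\<^sup>2 * (norm (p n x))\<^sup>2))"
    using f by (simp add: scalar_measure_diag nn_integral_distr nn_integral_density
        nn_integral_count_space_nat mult.commute ennreal_mult)
  then have "x \<in> spectral_domain (diag_spectral_measure l) f \<longleftrightarrow>
      (\<Sum>n. ennreal ((f (l n))\<^sup>2 * (norm (p n x))\<^sup>2)) < top"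
    by (simp add: spectral_domain_def)
  also have "\<dots> \<longleftrightarrow> summable (\<lambda>n. (f (l n))\<^sup>2 * (norm (p n x))\<^sup>2)"
  proof
    assume "(\<Sum>n. ennreal ((f (l n))\<^sup>2 * (norm (p n x))\<^sup>2)) < top"
    then show "summable (\<lambda>n. (f (l n))\<^sup>2 * (norm (p n x))\<^sup>2)"
      by (intro summable_suminf_not_top) simp_all
  next
    assume s: "summable (\<lambda>n. (f (l n))\<^sup>2 * (norm (p n x))\<^sup>2)"
    have "(\<Sum>n. ennreal ((f (l n))\<^sup>2 * (norm (p n x))\<^sup>2)) = ennreal (\<Sum>n. (f (l n))\<^sup>2 * (norm (p n x))\<^sup>2)"
      by (rule suminf_ennreal2[OF _ s]) simp
    then show "(\<Sum>n. ennreal ((f (l n))\<^sup>2 * (norm (p n x))\<^sup>2)) < top"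
      by (simp only: ennreal_less_top)
  qed
  finally show ?thesis .
qed

text \<open>Square integrability gives absolute convergence through
  \<open>\<bar>f (l n)\<bar> \<le> (f (l n))\<^sup>2 + 1\<close>, since the weights
  \<open>(norm (p n x))\<^sup>2\<close> are summable.\<close>

lemma integral_diag:
  assumes f: "f \<in> borel_measurable borel"
    and x: "x \<in> spectral_domain (diag_spectral_measure l) f"
  shows "(\<lambda>n. f (l n) * (norm (p n x))\<^sup>2) sums (\<integral>s. f s \<partial>scalar_measure (diag_spectral_measure l) x)"
proof -
  have "summable (\<lambda>n. ((f (l n))\<^sup>2 + 1) * (norm (p n x))\<^sup>2)"
    using summable_add[OF x[unfolded spectral_domain_diag[OF f]] sums_summable[OF sums_norm2[of x]]]
    by (simp add: algebra_simps)
  then have s: "summable (\<lambda>n. norm ((norm (p n x))\<^sup>2 * f (l n)))"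
  proof (rule summable_comparison_test'[of _ 0])
    fix n
    have "\<bar>f (l n)\<bar> \<le> (f (l n))\<^sup>2 + 1"
      using zero_le_power2[of "\<bar>f (l n)\<bar> - 1"] by (simp add: power2_diff)
    then show "norm (norm ((norm (p n x))\<^sup>2 * f (l n))) \<le> ((f (l n))\<^sup>2 + 1) * (norm (p n x))\<^sup>2"
      by (simp add: abs_mult mult.commute mult_right_mono)
  qed
  have "(\<integral>s. f s \<partial>scalar_measure (diag_spectral_measure l) x)
      = (\<integral>n. (norm (p n x))\<^sup>2 * f (l n) \<partial>count_space UNIV)"
    using f by (simp add: scalar_measure_diag integral_distr integral_density)
  also have "\<dots> = (\<Sum>n. (norm (p n x))\<^sup>2 * f (l n))"
    by (rule integral_count_space_nat) (use s in \<open>simp add: integrable_count_space_nat_iff\<close>)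
  finally show ?thesis using summable_sums[OF summable_norm_cancel[OF s]] by (simp add: mult.commute)
qed

end

lemma polarisation:
  "(\<Sum>k<4. \<i> ^ k * complex_of_real ((norm (u + \<i> ^ k *\<^sub>C v))\<^sup>2)) = 4 * cinner u (v :: 'h::complex_hilbert)"
proof -
  have "(\<Sum>k<4. \<i> ^ k * complex_of_real ((norm (u + \<i> ^ k *\<^sub>C v))\<^sup>2)) =
      (\<Sum>k<4. \<i> ^ k * cinner (u + \<i> ^ k *\<^sub>C v) (u + \<i> ^ k *\<^sub>C v))"
    by (simp only: cinner_self)
  also have "\<dots> = 4 * cinner u v"
    by (simp add: eval_nat_numeral cinner_simps algebra_simps)
  finally show ?thesis .
qed

context orthogonal_resolution
begin

text \<open>The polarised integral uses the scalar measures of the vectors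
  \<open>x + \<i> ^ k *\<^sub>C z\<close>; these must lie in the domain before
  \<open>integral_diag\<close> applies.\<close>

lemma spectral_domain_diag_add:
  assumes f: "f \<in> borel_measurable borel"
    and x: "x \<in> spectral_domain (diag_spectral_measure l) f"
    and z: "z \<in> spectral_domain (diag_spectral_measure l) f"
    and w: "cmod w = 1"
  shows "x + w *\<^sub>C z \<in> spectral_domain (diag_spectral_measure l) f"
proof -
  have "summable (\<lambda>n. 2 * ((f (l n))\<^sup>2 * (norm (p n x))\<^sup>2) + 2 * ((f (l n))\<^sup>2 * (norm (p n z))\<^sup>2))"
    by (intro summable_add summable_mult) (use x z in \<open>simp_all add: spectral_domain_diag[OF f]\<close>)
  then have "summable (\<lambda>n. (f (l n))\<^sup>2 * (norm (p n (x + w *\<^sub>C z)))\<^sup>2)"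
  proof (rule summable_comparison_test'[of _ 0])
    fix n
    have "norm (p n (x + w *\<^sub>C z)) \<le> norm (p n x) + norm (p n z)"
      using norm_triangle_ineq[of "p n x" "w *\<^sub>C p n z"]
      by (simp add: blinfun.bilinear_simps bounded_opsD[OF bounded_op] norm_scaleC w)
    then have "(norm (p n (x + w *\<^sub>C z)))\<^sup>2 \<le> (norm (p n x) + norm (p n z))\<^sup>2"
      by (rule power_mono) simp
    also have "\<dots> \<le> 2 * (norm (p n x))\<^sup>2 + 2 * (norm (p n z))\<^sup>2"
      using zero_le_power2[of "norm (p n x) - norm (p n z)"] by (simp add: power2_diff power2_sum)
    finally have "(f (l n))\<^sup>2 * (norm (p n (x + w *\<^sub>C z)))\<^sup>2
        \<le> (f (l n))\<^sup>2 * (2 * (norm (p n x))\<^sup>2 + 2 * (norm (p n z))\<^sup>2)"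
      by (rule mult_left_mono) simp
    then show "norm ((f (l n))\<^sup>2 * (norm (p n (x + w *\<^sub>C z)))\<^sup>2)
        \<le> 2 * ((f (l n))\<^sup>2 * (norm (p n x))\<^sup>2) + 2 * ((f (l n))\<^sup>2 * (norm (p n z))\<^sup>2)"
      by (simp add: algebra_simps)
  qed
  then show ?thesis by (simp add: spectral_domain_diag[OF f])
qed

lemma sums_polarised_integral:
  assumes f: "f \<in> borel_measurable borel"
    and x: "x \<in> spectral_domain (diag_spectral_measure l) f"
    and z: "z \<in> spectral_domain (diag_spectral_measure l) f"
  shows "(\<lambda>n. complex_of_real (f (l n)) * cinner (p n x) z) sums
    ((\<Sum>k<4. \<i> ^ k * complex_of_real (\<integral>s. f s \<partial>scalar_measure (diag_spectral_measure l) (x + \<i> ^ k *\<^sub>C z))) / 4)"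
proof -
  have "(\<lambda>n. \<i> ^ k * complex_of_real (f (l n) * (norm (p n (x + \<i> ^ k *\<^sub>C z)))\<^sup>2)) sums
      (\<i> ^ k * complex_of_real (\<integral>s. f s \<partial>scalar_measure (diag_spectral_measure l) (x + \<i> ^ k *\<^sub>C z)))" for k
    by (intro sums_mult sums_of_real integral_diag[OF f] spectral_domain_diag_add[OF f x z])
      (simp add: norm_power)
  then have "(\<lambda>n. (\<Sum>k<4. \<i> ^ k * complex_of_real (f (l n) * (norm (p n (x + \<i> ^ k *\<^sub>C z)))\<^sup>2)) / 4) sums
    ((\<Sum>k<4. \<i> ^ k * complex_of_real (\<integral>s. f s \<partial>scalar_measure (diag_spectral_measure l) (x + \<i> ^ k *\<^sub>C z))) / 4)"
    by (intro sums_divide sums_sum)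
  moreover have "(\<Sum>k<4. \<i> ^ k * complex_of_real (f (l n) * (norm (p n (x + \<i> ^ k *\<^sub>C z)))\<^sup>2)) / 4
      = complex_of_real (f (l n)) * cinner (p n x) z" for n
  proof -
    have "(\<Sum>k<4. \<i> ^ k * complex_of_real (f (l n) * (norm (p n (x + \<i> ^ k *\<^sub>C z)))\<^sup>2))
        = complex_of_real (f (l n)) * (\<Sum>k<4. \<i> ^ k * complex_of_real ((norm (p n x + \<i> ^ k *\<^sub>C p n z))\<^sup>2))"
      by (simp add: sum_distrib_left mult_ac blinfun.bilinear_simps bounded_opsD[OF bounded_op])
    also have "\<dots> = complex_of_real (f (l n)) * (4 * cinner (p n x) (p n z))" by (simp only: polarisation)
    also have "cinner (p n x) (p n z) = cinner (p n x) z" by (metis idem sym)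
    finally show ?thesis by simp
  qed
  ultimately show ?thesis by simp
qed

text \<open>The vector \<open>p m u\<close> has at most one nonzero component, so it lies in the
  domain, and testing against it isolates the component \<open>p m y\<close>.\<close>

lemma spectral_integral_diag:
  assumes f: "f \<in> borel_measurable borel"
  shows "spectral_integral (diag_spectral_measure l) f = diag (\<lambda>n. f (l n))"
proof (intro set_eqI iffI; clarify)
  fix x y assume xy: "(x, y) \<in> spectral_integral (diag_spectral_measure l) f"
  then have x: "x \<in> spectral_domain (diag_spectral_measure l) f" by (simp add: spectral_integral_def)
  have "p m y = f (l m) *\<^sub>R p m x" for m
  proof (rule cinner_eqI)
    fix u
    have z: "p m u \<in> spectral_domain (diag_spectral_measure l) f"
      unfolding spectral_domain_diag[OF f]
      by (rule summable_finite[of "{m}"]) (auto simp: apply_apply)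
    have "cinner y (p m u) = (\<Sum>k<4. \<i> ^ k * complex_of_real
        (\<integral>s. f s \<partial>scalar_measure (diag_spectral_measure l) (x + \<i> ^ k *\<^sub>C p m u))) / 4"
      using xy z unfolding spectral_integral_def by blast
    also have "\<dots> = (\<Sum>n. complex_of_real (f (l n)) * cinner (p n x) (p m u))"
      by (rule sums_unique[OF sums_polarised_integral[OF f x z]])
    also have "\<dots> = (\<Sum>n\<in>{m}. complex_of_real (f (l n)) * cinner (p n x) (p m u))"
    proof (rule suminf_finite)
      fix n assume "n \<notin> {m}"
      then have "cinner (p n x) (p m u) = 0" by (simp add: sym apply_apply cinner_simps)
      then show "complex_of_real (f (l n)) * cinner (p n x) (p m u) = 0" by simp
    qed simp
    also have "\<dots> = cinner (f (l m) *\<^sub>R p m x) (p m u)"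
      by (simp add: cinner.scaleR_left scaleR_conv_of_real)
    finally show "cinner (p m y) u = cinner (f (l m) *\<^sub>R p m x) u"
      by (simp add: blinfun.bilinear_simps idem flip: sym)
  qed
  then show "(x, y) \<in> diag (\<lambda>n. f (l n))" by (simp add: diag_iff)
next
  fix x y assume xy: "(x, y) \<in> diag (\<lambda>n. f (l n))"
  then have py: "p n y = f (l n) *\<^sub>R p n x" for n by (simp add: diag_iff)
  have "(f (l n))\<^sup>2 * (norm (p n x))\<^sup>2 = (norm (p n y))\<^sup>2" for n by (simp add: py power_mult_distrib)
  then have x: "x \<in> spectral_domain (diag_spectral_measure l) f"
    using sums_summable[OF sums_norm2[of y]] by (simp add: spectral_domain_diag[OF f])
  have "cinner y z = (\<Sum>k<4. \<i> ^ k * complex_of_real (\<integral>s. f s \<partial>scalar_measure (diag_spectral_measure l) (x + \<i> ^ k *\<^sub>C z))) / 4"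
    if z: "z \<in> spectral_domain (diag_spectral_measure l) f" for z
  proof (rule sums_unique2)
    show "(\<lambda>n. complex_of_real (f (l n)) * cinner (p n x) z) sums cinner y z"
      using sums_cinner[of y z] by (simp add: py cinner.scaleR_left scaleR_conv_of_real)
  qed (rule sums_polarised_integral[OF f x z])
  then show "(x, y) \<in> spectral_integral (diag_spectral_measure l) f"
    using x by (simp add: spectral_integral_def)
qed

end

text \<open>Supplies the scalar measures that occur when \<open>spectral_integral\<close> is tested
  against \<open>P C x\<close>. The part of the vector on \<open>C\<close> is multiplied by
  \<open>1 + w\<close>, the part off \<open>C\<close> is unchanged, and the two are
  orthogonal.\<close>

lemma scalar_measure_add_apply:
  assumes P: "spectral_measure P" and C: "C \<in> sets borel"
  shows "scalar_measure P (x + w *\<^sub>C P C x) =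
    density (scalar_measure P x) (\<lambda>t. ennreal (if t \<in> C then (cmod (1 + w))\<^sup>2 else 1))"
proof (rule measure_eqI)
  fix B assume "B \<in> sets (scalar_measure P (x + w *\<^sub>C P C x))"
  then have B: "B \<in> sets borel" by simp
  let ?u = "P (B \<inter> C) x" and ?v = "P (B - C) x"
  have PB: "P B y = P (B \<inter> C) y + P (B - C) y" for y
  proof -
    let ?A = "\<lambda>n::nat. if n = 0 then B \<inter> C else if n = 1 then B - C else {}"
    have "(\<lambda>n. P (?A n) y) sums P (\<Union>n. ?A n) y"
      by (rule spectral_measure_sums[OF P]) (use B C in \<open>auto simp: disjoint_family_on_def\<close>)
    moreover have "(\<Union>n. ?A n) = B" by (auto split: if_splits)
    moreover have "P {} y = 0"
      using emeasure_scalar_measure[OF P, of "{}" y] by simp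
    then have "(\<lambda>n. P (?A n) y) sums (\<Sum>n\<in>{0,1}. P (?A n) y)"
      by (intro sums_finite) auto
    ultimately show ?thesis using sums_unique2 by fastforce
  qed
  have PBC: "P B (P C x) = P (B \<inter> C) x" using spectral_measure_Int[OF P B C] by simp
  have bo: "P B \<in> bounded_ops" using spectral_measure_projection[OF P B] by (simp add: projections_def)
  have "P B (x + w *\<^sub>C P C x) = ?u + ?v + w *\<^sub>C ?u"
    by (simp add: blinfun.bilinear_simps bounded_opsD[OF bo] PBC PB[of x])
  also have "\<dots> = (1 + w) *\<^sub>C ?u + ?v" by (simp add: scaleC_add_left)
  finally have 1: "P B (x + w *\<^sub>C P C x) = (1 + w) *\<^sub>C ?u + ?v" .
  have "cinner ?u ?v = 0"
  proof -
    have "cinner ?u ?v = cinner x (P (B \<inter> C) (P (B - C) x))"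
      by (rule projection_sym[OF spectral_measure_projection[OF P] order_refl]) (use B C in auto)
    also have "P (B \<inter> C) (P (B - C) x) = P ((B \<inter> C) \<inter> (B - C)) x"
      using spectral_measure_Int[OF P, of "B \<inter> C" "B - C"] B C by simp
    also have "(B \<inter> C) \<inter> (B - C) = {}" by auto
    also have "P {} x = 0" using emeasure_scalar_measure[OF P, of "{}" x] by simp
    finally show ?thesis by (simp add: cinner_simps)
  qed
  then have "inner ((1 + w) *\<^sub>C ?u) ?v = 0" by (simp add: inner_eq_Re_cinner cinner_simps)
  then have n: "(norm (P B (x + w *\<^sub>C P C x)))\<^sup>2 = (cmod (1 + w))\<^sup>2 * (norm ?u)\<^sup>2 + (norm ?v)\<^sup>2"
    unfolding 1 by (simp add: norm_add_Pythagorean orthogonal_def norm_scaleC power_mult_distrib)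
  have "emeasure (density (scalar_measure P x) (\<lambda>t. ennreal (if t \<in> C then (cmod (1 + w))\<^sup>2 else 1))) B
      = (\<integral>\<^sup>+ t. ennreal (if t \<in> C then (cmod (1 + w))\<^sup>2 else 1) * indicator B t \<partial>scalar_measure P x)"
    by (rule emeasure_density) (use B C in auto)
  also have "\<dots> = (\<integral>\<^sup>+ t. ennreal ((cmod (1 + w))\<^sup>2) * indicator (B \<inter> C) t + indicator (B - C) t \<partial>scalar_measure P x)"
    by (rule nn_integral_cong) (auto simp: indicator_def)
  also have "\<dots> = ennreal ((cmod (1 + w))\<^sup>2) * ennreal ((norm ?u)\<^sup>2) + ennreal ((norm ?v)\<^sup>2)"
    using B C by (simp add: nn_integral_add nn_integral_cmult emeasure_scalar_measure[OF P])
  finally show "emeasure (scalar_measure P (x + w *\<^sub>C P C x)) B =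
      emeasure (density (scalar_measure P x) (\<lambda>t. ennreal (if t \<in> C then (cmod (1 + w))\<^sup>2 else 1))) B"
    using B by (simp add: emeasure_scalar_measure[OF P] n ennreal_mult ennreal_plus)
qed simp

text \<open>Testing the eigenvalue equation against \<open>P(C)x\<close>, where \<open>C\<close> is either half-line bounded by the
  eigenvalue, shows that the scalar measure of an eigenvector is concentrated at the eigenvalue.\<close>

lemma spectral_measure_eigenvector:
  assumes P: "spectral_measure P" and eig: "(x, s *\<^sub>R x) \<in> spectral_integral P (\<lambda>t. t)"
    and B: "B \<in> sets borel"
  shows "P B x = (if s \<in> B then x else 0)"
proof -
  let ?\<mu> = "scalar_measure P x"
  interpret finite_measure ?\<mu> by (rule finite_scalar_measure[OF P])
  have dom: "(\<integral>\<^sup>+ t. ennreal (t\<^sup>2) \<partial>?\<mu>) < \<infinity>"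
    using eig by (simp add: spectral_integral_def spectral_domain_def)
  have int2: "integrable ?\<mu> (\<lambda>t. t\<^sup>2)"
    using dom by (intro integrableI_nonneg) auto
  have int: "integrable ?\<mu> (\<lambda>t. t)"
  proof (rule Bochner_Integration.integrable_bound)
    show "integrable ?\<mu> (\<lambda>t. t\<^sup>2 + 1)" using int2 by simp
    have "\<bar>t\<bar> \<le> t\<^sup>2 + 1" for t :: real
      using zero_le_power2[of "\<bar>t\<bar> - 1"] by (simp add: power2_diff)
    then show "AE t in ?\<mu>. norm t \<le> norm (t\<^sup>2 + 1)" by (simp add: order_trans[OF _ abs_ge_self])
  qed simp
  have moment: "(\<integral>t. (t - s) * indicator C t \<partial>?\<mu>) = 0" if C: "C \<in> sets borel" for C
  proof -
    have intC: "integrable ?\<mu> (\<lambda>t. t * indicator C t)"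
      using int C by (intro integrable_real_mult_indicator) auto
    have intC': "integrable ?\<mu> (\<lambda>t. t * indicator (- C) t)"
      using int C by (intro integrable_real_mult_indicator) auto
    have d0: "scalar_measure P (P C x) = density ?\<mu> (\<lambda>t. indicator C t)"
    proof (rule measure_eqI)
      fix D assume "D \<in> sets (scalar_measure P (P C x))"
      then have D: "D \<in> sets borel" by simp
      have "P D (P C x) = P (D \<inter> C) x" using spectral_measure_Int[OF P D C] by simp
      moreover have "emeasure (density ?\<mu> (\<lambda>t. indicator C t)) D = (\<integral>\<^sup>+ t. indicator C t * indicator D t \<partial>?\<mu>)"
        by (rule emeasure_density) (use C D in auto)
      moreover have "\<dots> = (\<integral>\<^sup>+ t. indicator (D \<inter> C) t \<partial>?\<mu>)"
        by (rule nn_integral_cong) (auto simp: indicator_def)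
      ultimately show "emeasure (scalar_measure P (P C x)) D = emeasure (density ?\<mu> (\<lambda>t. indicator C t)) D"
        using C D by (simp add: emeasure_scalar_measure[OF P])
    qed simp
    have z: "P C x \<in> spectral_domain P (\<lambda>t. t)"
    proof -
      have "(\<integral>\<^sup>+ t. ennreal (t\<^sup>2) \<partial>scalar_measure P (P C x)) = (\<integral>\<^sup>+ t. indicator C t * ennreal (t\<^sup>2) \<partial>?\<mu>)"
        unfolding d0 using C by (subst nn_integral_density) auto
      also have "\<dots> \<le> (\<integral>\<^sup>+ t. ennreal (t\<^sup>2) \<partial>?\<mu>)"
        by (intro nn_integral_mono) (auto simp: indicator_def)
      finally show ?thesis using dom by (simp add: spectral_domain_def)
    qed
    have J: "(\<integral>t. t \<partial>scalar_measure P (x + w *\<^sub>C P C x)) =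
        (\<integral>t. t * indicator (- C) t \<partial>?\<mu>) + (cmod (1 + w))\<^sup>2 * (\<integral>t. t * indicator C t \<partial>?\<mu>)" for w
    proof -
      have "(\<integral>t. t \<partial>scalar_measure P (x + w *\<^sub>C P C x)) =
          (\<integral>t. (if t \<in> C then (cmod (1 + w))\<^sup>2 else 1) * t \<partial>?\<mu>)"
        unfolding scalar_measure_add_apply[OF P C] using C by (subst integral_density) auto
      also have "\<dots> = (\<integral>t. t * indicator (- C) t + (cmod (1 + w))\<^sup>2 * (t * indicator C t) \<partial>?\<mu>)"
        by (intro Bochner_Integration.integral_cong) (auto simp: indicator_def)
      also have "\<dots> = (\<integral>t. t * indicator (- C) t \<partial>?\<mu>) + (cmod (1 + w))\<^sup>2 * (\<integral>t. t * indicator C t \<partial>?\<mu>)"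
        using intC intC' by simp
      finally show ?thesis .
    qed
    \<comment> \<open>In the sum over \<open>k\<close>, the integral off \<open>C\<close> has the
      weights \<open>\<i> ^ k\<close>, which add up to 0. The integral on \<open>C\<close> has total
      weight 4 + 2\<i> - 0 - 2\<i> = 4, which cancels the division by 4.\<close>
    have i: "\<i> ^ 0 = 1" "\<i> ^ 1 = \<i>" "\<i> ^ 2 = -1" "\<i> ^ 3 = -\<i>" by (simp_all add: power3_eq_cube)
    have c: "(cmod (1 + 1))\<^sup>2 = 4" "(cmod (1 + \<i>))\<^sup>2 = 2" "(cmod (1 + - 1))\<^sup>2 = 0" "(cmod (1 + - \<i>))\<^sup>2 = 2"
      by (simp_all add: cmod_power2)
    have sum4: "(\<Sum>k<4. F k) = F 0 + F 1 + F 2 + F (3::nat)" for F :: "nat \<Rightarrow> complex"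
      by (simp add: eval_nat_numeral)
    have "cinner (s *\<^sub>R x) (P C x) =
        (\<Sum>k<4. \<i> ^ k * complex_of_real (\<integral>t. t \<partial>scalar_measure P (x + \<i> ^ k *\<^sub>C P C x))) / 4"
      using eig z unfolding spectral_integral_def by blast
    also have "\<dots> = complex_of_real (\<integral>t. t * indicator C t \<partial>?\<mu>)"
      unfolding sum4 i J c by (simp add: algebra_simps)
    finally have "cinner (s *\<^sub>R x) (P C x) = complex_of_real (\<integral>t. t * indicator C t \<partial>?\<mu>)" .
    moreover have "cinner (s *\<^sub>R x) (P C x) = complex_of_real (s * measure ?\<mu> C)"
    proof -
      have "cinner x (P C x) = complex_of_real ((norm (P C x))\<^sup>2)"
        using spectral_measure_cinner_self[OF P C, of x] by (metis cinner_commute complex_cnj_complex_of_real)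
      moreover have "measure ?\<mu> C = (norm (P C x))\<^sup>2"
        by (simp add: measure_def emeasure_scalar_measure[OF P C])
      ultimately show ?thesis by (simp add: cinner.scaleR_left scaleR_conv_of_real)
    qed
    ultimately have "(\<integral>t. t * indicator C t \<partial>?\<mu>) = s * measure ?\<mu> C" by (metis of_real_eq_iff)
    moreover have "(\<integral>t. (t - s) * indicator C t \<partial>?\<mu>) = (\<integral>t. t * indicator C t - s * indicator C t \<partial>?\<mu>)"
      by (simp add: left_diff_distrib)
    moreover have "integrable ?\<mu> (\<lambda>t. s * indicator C t :: real)"
      by (intro integrable_mult_right integrable_real_indicator)
        (use C in \<open>simp_all add: emeasure_scalar_measure[OF P C]\<close>)
    ultimately show ?thesis using intC C by simp
  qed
  \<comment> \<open>On such a \<open>C\<close> the integrand of \<open>moment\<close> has constant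
    sign, so it vanishes almost everywhere; yet it is nonzero at every point of
    \<open>C\<close>.\<close>
  have null: "emeasure ?\<mu> C = 0"
    if C: "C \<in> sets borel" and sgn: "(\<forall>t\<in>C. 0 < t - s) \<or> (\<forall>t\<in>C. t - s < 0)" for C
  proof -
    have I: "integrable ?\<mu> (\<lambda>t. (t - s) * indicator C t)"
      using int C by (intro integrable_real_mult_indicator) auto
    have "AE t in ?\<mu>. \<bar>(t - s) * indicator C t\<bar> = 0"
    proof (subst integral_nonneg_eq_0_iff_AE[symmetric])
      show "(\<integral>t. \<bar>(t - s) * indicator C t\<bar> \<partial>?\<mu>) = 0"
      proof -
        from sgn have "(\<forall>t. \<bar>(t - s) * indicator C t\<bar> = (t - s) * indicator C t) \<or>
            (\<forall>t. \<bar>(t - s) * indicator C t\<bar> = - ((t - s) * indicator C t))"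
          by (auto simp: indicator_def)
        then show ?thesis using moment[OF C] by auto
      qed
    qed (use I in auto)
    then have "AE t in ?\<mu>. t \<notin> C" by eventually_elim (use sgn in \<open>auto simp: indicator_def split: if_splits\<close>)
    then show ?thesis using C by (subst (asm) AE_iff_measurable[of C]) auto
  qed
  have n0: "(norm (P B' x))\<^sup>2 = 0" if "B' \<in> sets borel" "s \<notin> B'" for B'
  proof -
    have "emeasure ?\<mu> (B' \<inter> {s<..}) = 0" "emeasure ?\<mu> (B' \<inter> {..<s}) = 0"
      using that by (intro null; auto)+
    moreover have "B' = (B' \<inter> {s<..}) \<union> (B' \<inter> {..<s})"
      using that(2) by (auto simp: less_le)
    ultimately have "emeasure ?\<mu> B' = 0"
      using that(1) emeasure_subadditive[of "B' \<inter> {s<..}" ?\<mu> "B' \<inter> {..<s}"] by simp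
    then show ?thesis using emeasure_scalar_measure[OF P that(1), of x] by simp
  qed
  show ?thesis
  proof (cases "s \<in> B")
    case True
    have "P (- B) x = 0" using n0[of "- B"] B True by auto
    moreover have "P UNIV x = P B x + P (- B) x"
    proof -
      let ?A = "\<lambda>n::nat. if n = 0 then B else if n = 1 then - B else {}"
      have "(\<lambda>n. P (?A n) x) sums P (\<Union>n. ?A n) x"
        by (rule spectral_measure_sums[OF P]) (use B in \<open>auto simp: disjoint_family_on_def\<close>)
      moreover have "(\<Union>n. ?A n) = UNIV" by (auto split: if_splits)
      moreover have "P {} x = 0"
        using emeasure_scalar_measure[OF P, of "{}" x] by simp
      then have "(\<lambda>n. P (?A n) x) sums (\<Sum>n\<in>{0,1}. P (?A n) x)"
        by (intro sums_finite) auto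
      ultimately show ?thesis using sums_unique2 by fastforce
    qed
    ultimately show ?thesis using True by (simp add: spectral_measure_UNIV[OF P])
  next
    case False
    then show ?thesis using n0[OF B] by simp
  qed
qed

section \<open>Functional calculus through uniqueness of the spectral measure\<close>

context orthogonal_resolution
begin

text \<open>Every \<open>p n x\<close> satisfies the eigenvalue equation of \<open>diag l\<close>,
  so \<open>P B\<close> is determined on it and, by continuity, on the sum \<open>x\<close>. The
  definite description in \<open>fun_calc\<close> depends on this.\<close>

lemma spectral_measure_diag_unique:
  assumes P: "spectral_measure P" and eq: "spectral_integral P (\<lambda>t. t) = diag l" and B: "B \<in> sets borel"
  shows "P B = diag_spectral_measure l B"
proof (rule blinfun_eqI, rule eqI)
  fix x k
  have "P B (p n x) = (if l n \<in> B then p n x else 0)" for n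
  proof (rule spectral_measure_eigenvector[OF P _ B])
    show "(p n x, l n *\<^sub>R p n x) \<in> spectral_integral P (\<lambda>t. t)"
      unfolding eq by (simp add: diag_iff blinfun.bilinear_simps apply_apply)
  qed
  then have "(\<lambda>n. if l n \<in> B then p n x else 0) sums P B x"
    using bounded_linear.sums[OF blinfun.bounded_linear_right resolution[of x], of "P B"] by simp
  then have "(\<lambda>n. p k (if l n \<in> B then p n x else 0)) sums p k (P B x)"
    by (rule bounded_linear.sums[OF blinfun.bounded_linear_right])
  moreover have "(\<lambda>n. p k (if l n \<in> B then p n x else 0)) sums
      (\<Sum>n\<in>{k}. p k (if l n \<in> B then p n x else 0))"
    by (rule sums_finite) (auto simp: apply_apply)
  ultimately have "p k (P B x) = (if l k \<in> B then p k x else 0)"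
    using sums_unique2 by (fastforce simp: apply_apply)
  then show "p k (P B x) = p k (diag_spectral_measure l B x)"
    by (simp add: diag_spectral_measure_def apply_select)
qed

lemma fun_calc_diag:
  assumes f: "f \<in> borel_measurable borel"
  shows "fun_calc f (diag l) = diag (\<lambda>n. f (l n))"
  unfolding fun_calc_def
proof (rule the_equality)
  have "spectral_integral (diag_spectral_measure l) (\<lambda>s. s) = diag l"
    by (simp add: spectral_integral_diag)
  then show "\<exists>P. spectral_measure P \<and> spectral_integral P (\<lambda>s. s) = diag l \<and>
      diag (\<lambda>n. f (l n)) = spectral_integral P f"
    by (intro exI[of _ "diag_spectral_measure l"]) (simp add: spectral_measure_diag spectral_integral_diag f)
  fix A assume "\<exists>P. spectral_measure P \<and> spectral_integral P (\<lambda>s. s) = diag l \<and> A = spectral_integral P f"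
  then obtain P where P: "spectral_measure P" "spectral_integral P (\<lambda>s. s) = diag l" "A = spectral_integral P f"
    by blast
  have "scalar_measure P = scalar_measure (diag_spectral_measure l)"
    by (rule scalar_measure_cong[OF P(1) spectral_measure_diag spectral_measure_diag_unique[OF P(1,2)]])
  then have "spectral_integral P f = spectral_integral (diag_spectral_measure l) f"
    by (simp add: spectral_integral_def spectral_domain_def)
  then show "A = diag (\<lambda>n. f (l n))" by (simp add: P(3) spectral_integral_diag f)
qed

end

section \<open>Adjoint, modulus and affiliation of diagonal operators\<close>

context orthogonal_resolution
begin

lemma uop_adj_diag: "uop_adj (diag a) = diag a"
proof (intro set_eqI iffI; clarify)
  fix y z assume "(y, z) \<in> uop_adj (diag a)"
  then have adj: "cinner w y = cinner x z" if "(x, w) \<in> diag a" for x w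
    using that unfolding uop_adj_def by blast
  have "p n z = a n *\<^sub>R p n y" for n
  proof (rule cinner_eqI)
    fix u
    have "(p n u, a n *\<^sub>R p n u) \<in> diag a"
      by (simp add: diag_iff blinfun.bilinear_simps apply_apply)
    then have "cinner (a n *\<^sub>R p n u) y = cinner (p n u) z" by (rule adj)
    then have "cinner u (a n *\<^sub>R p n y) = cinner u (p n z)"
      by (simp add: sym cinner.scaleR_left cinner.scaleR_right)
    then show "cinner (p n z) u = cinner (a n *\<^sub>R p n y) u" by (metis cinner_commute)
  qed
  then show "(y, z) \<in> diag a" by (simp add: diag_iff)
next
  fix y z assume yz: "(y, z) \<in> diag a"
  have "cinner w y = cinner x z" if "(x, w) \<in> diag a" for x w
  proof (rule sums_unique2[OF sums_cinner])
    have "cinner (p n w) y = cinner (p n x) z" for n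
    proof -
      have "cinner (p n w) y = cinner (a n *\<^sub>R p n x) (p n y)"
        using that by (metis diag_iff idem sym)
      also have "\<dots> = cinner (p n x) (p n z)"
        using yz by (simp add: diag_iff cinner.scaleR_left cinner.scaleR_right)
      also have "\<dots> = cinner (p n x) z" by (metis idem sym)
      finally show ?thesis .
    qed
    then show "(\<lambda>n. cinner (p n w) y) sums cinner x z" using sums_cinner[of x z] by simp
  qed
  then show "(y, z) \<in> uop_adj (diag a)" unfolding uop_adj_def by blast
qed

text \<open>From right to left, an intermediate vector with components
  \<open>t n *\<^sub>R p n x\<close> has to exist; the bound on \<open>t\<close> makes these square
  summable.\<close>

lemma diag_square:
  assumes t: "\<And>n. \<bar>t n\<bar> \<le> 1"
  shows "diag t O diag t = diag (\<lambda>n. (t n)\<^sup>2)"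
proof (intro set_eqI iffI; clarify)
  fix x z assume xz: "(x, z) \<in> diag (\<lambda>n. (t n)\<^sup>2)"
  have "\<exists>y. \<forall>n. p n y = t n *\<^sub>R p n x"
  proof (rule riesz_fischer)
    show "summable (\<lambda>n. (norm (t n *\<^sub>R p n x))\<^sup>2)"
    proof (rule summable_comparison_test'[OF sums_summable[OF sums_norm2[of x]], of 0])
      fix n
      have "norm (t n *\<^sub>R p n x) \<le> norm (p n x)" using t[of n] by (simp add: mult_left_le_one_le)
      then show "norm ((norm (t n *\<^sub>R p n x))\<^sup>2) \<le> (norm (p n x))\<^sup>2" by (simp add: power_mono)
    qed
  qed (simp add: blinfun.bilinear_simps idem)
  then obtain y where "\<And>n. p n y = t n *\<^sub>R p n x" by blast
  then have "(x, y) \<in> diag t" "(y, z) \<in> diag t" using xz by (simp_all add: diag_iff power2_eq_square)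
  then show "(x, z) \<in> diag t O diag t" by blast
qed (simp add: diag_iff power2_eq_square)

lemma uop_abs_diag:
  assumes t: "\<And>n. 0 \<le> t n" "\<And>n. t n \<le> 1"
  shows "uop_abs (diag t) = diag t"
proof -
  have "uop_abs (diag t) = fun_calc sqrt (diag (\<lambda>n. (t n)\<^sup>2))"
    unfolding uop_abs_def uop_adj_diag by (subst diag_square) (use t in auto)
  also have "\<dots> = diag t" by (subst fun_calc_diag) (use t in auto)
  finally show ?thesis .
qed

lemma kernel_diag: "(\<And>n. t n \<noteq> 0) \<Longrightarrow> {x. (x, 0) \<in> diag t} = {0}"
  by (auto simp: diag_iff intro: eqI)

lemma closed_densely_defined_diag: "closed_densely_defined (diag a)"
  unfolding closed_densely_defined_def
proof (intro conjI)
  show "single_valued (diag a)"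
    unfolding single_valued_def diag_iff by (metis eqI)
  show "(0, 0) \<in> diag a" by (simp add: diag_iff)
  show "\<forall>(x, y)\<in>diag a. \<forall>(x', y')\<in>diag a. (x + x', y + y') \<in> diag a"
    by (auto simp: diag_iff blinfun.bilinear_simps algebra_simps)
  show "\<forall>c. \<forall>(x, y)\<in>diag a. (c *\<^sub>C x, c *\<^sub>C y) \<in> diag a"
    by (auto simp: diag_iff bounded_opsD[OF bounded_op] scaleC_scaleC mult.commute simp flip: scaleC_of_real)
  have "closed {g. p n (snd g) = a n *\<^sub>R p n (fst g)}" for n
    by (intro closed_Collect_eq continuous_intros)
  then have "closed (\<Inter>n. {g. p n (snd g) = a n *\<^sub>R p n (fst g)})" by blast
  moreover have "(\<Inter>n. {g. p n (snd g) = a n *\<^sub>R p n (fst g)}) = diag a"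
    by (auto simp: diag_iff)
  ultimately show "closed (diag a)" by simp
  show "closure (Domain (diag a)) = UNIV"
  proof (intro set_eqI iffI)
    fix x :: 'h
    have "(\<Sum>n<N. p n x) \<in> Domain (diag a)" for N
    proof
      show "((\<Sum>n<N. p n x), (\<Sum>n<N. a n *\<^sub>R p n x)) \<in> diag a"
        by (simp add: diag_iff blinfun.sum_right blinfun.bilinear_simps apply_apply
            if_distrib[of "\<lambda>y. _ *\<^sub>R y"] cong: if_cong)
    qed
    then show "x \<in> closure (Domain (diag a))"
      using resolution[of x] unfolding closure_sequential sums_def
      by (intro exI[of _ "\<lambda>N. \<Sum>n<N. p n x"]) simp
  qed simp
qed

text \<open>The commutant of \<open>M\<close> commutes with every \<open>p n\<close>, so it maps the
  graph into itself; the reverse inclusion applies this to the adjoint of the unitary.\<close>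

lemma affiliated_diag:
  assumes "vn_algebra M" and pM: "\<And>n. p n \<in> M"
  shows "diag a \<in> affiliated_ops M"
proof -
  interpret vn_algebra M by fact
  have "uop_conj U (diag a) = diag a" if U: "U \<in> unitaries (commutant M)" for U
  proof (intro set_eqI iffI; clarify)
    have UM: "U \<in> commutant M" and U1: "U (adj U x) = x" for x
      using U by (auto simp: unitaries_def dest: arg_cong[of _ _ "\<lambda>S. blinfun_apply S x"])
    have inv: "(A x, A y) \<in> diag a" if "A \<in> commutant M" "(x, y) \<in> diag a" for A x y
      using that by (simp add: diag_iff commutes[OF that(1) pM] blinfun.bilinear_simps)
    fix x y
    show "(x, y) \<in> diag a" if "(x, y) \<in> uop_conj U (diag a)"
      using that inv[OF UM] by (auto simp: uop_conj_def)
    show "(x, y) \<in> uop_conj U (diag a)" if "(x, y) \<in> diag a"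
      using inv[OF adj_commutant[OF UM] that] unfolding uop_conj_def by (force simp: U1)
  qed
  then show ?thesis by (simp add: affiliated_ops_def closed_densely_defined_diag)
qed

end

section \<open>Singular values of diagonal operators\<close>

lemma (in vn_algebra) cinner_projection_self:
  assumes p: "p \<in> projections M"
  shows "cinner (p x) x = complex_of_real ((norm (p x))\<^sup>2)"
proof -
  have "cinner (p (p x)) x = cinner (p x) (p x)" by (rule proj_sym[OF p])
  then show ?thesis by (simp only: proj_idem[OF p] cinner_self)
qed

text \<open>A passage to adjoints: \<open>(1 - p) e\<close> is the adjoint of
  \<open>e (1 - p)\<close>.\<close>

lemma (in vn_algebra) norm_swap_le:
  assumes p: "p \<in> projections M" and e: "e \<in> projections M"
    and d: "\<And>x. norm (e (x - p x)) \<le> d * norm x"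
  shows "norm (e x - p (e x)) \<le> d * norm x"
proof -
  define z where "z = e x - p (e x)"
  have pz: "p z = 0" by (simp add: z_def blinfun.bilinear_simps proj_idem[OF p])
  have "cinner z z = cinner (e x - p (e x)) z" by (simp only: z_def)
  also have "\<dots> = cinner (e x) z - cinner (e x) (p z)"
    by (simp only: cinner_left.diff proj_sym[OF p])
  also have "\<dots> = cinner x (e (z - p z))"
    by (simp add: pz cinner_simps proj_sym[OF e])
  finally have "(norm z)\<^sup>2 = cmod (cinner x (e (z - p z)))"
    by (metis cinner_self norm_of_real abs_power2)
  also have "\<dots> \<le> norm x * (d * norm z)"
    by (rule order_trans[OF cmod_cinner_le mult_left_mono[OF d]]) simp
  finally have "norm z * norm z \<le> (d * norm x) * norm z" by (simp add: power2_eq_square mult_ac)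
  moreover have "0 \<le> d * norm x" using order_trans[OF norm_ge_zero d] by blast
  ultimately show ?thesis unfolding z_def[symmetric]
    by (cases "z = 0") (simp_all add: mult_le_cancel_right)
qed

text \<open>The compression \<open>e p e\<close> dominates \<open>(1 - d\<^sup>2) e\<close> and has the same trace as \<open>p e p \<le> p\<close>.\<close>

lemma (in tracial_vn_algebra) trace_le_of_norm_le:
  assumes p: "p \<in> projections M" and e: "e \<in> projections M"
    and d: "\<And>x. norm (e (x - p x)) \<le> d * norm x"
  shows "(1 - d\<^sup>2) * Re (\<tau> e) \<le> Re (\<tau> p)"
proof -
  have M: "p \<in> M" "e \<in> M" using p e projection_mem by auto
  have "Re (\<tau> ((1 - d\<^sup>2) *\<^sub>R e)) \<le> Re (\<tau> (e o\<^sub>L (p o\<^sub>L e)))"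
  proof (rule trace_mono)
    fix x
    let ?y = "e x"
    have 1: "cinner ((e o\<^sub>L (p o\<^sub>L e)) x) x = complex_of_real ((norm (p ?y))\<^sup>2)"
      by (simp only: blinfun_apply_blinfun_compose proj_sym[OF e, of _ x] cinner_projection_self[OF p])
    have 2: "cinner (e x) x = complex_of_real ((norm ?y)\<^sup>2)"
      by (rule cinner_projection_self[OF e])
    \<comment> \<open>Pythagoras: as \<open>?y - p ?y\<close> is at most \<open>d * norm ?y\<close>
      long, \<open>p ?y\<close> keeps at least the fraction \<open>1 - d\<^sup>2\<close> of the
      squared norm.\<close>
    have "cinner (p ?y) (?y - p ?y) = 0"
      by (simp add: proj_sym[OF p] blinfun.bilinear_simps proj_idem[OF p] cinner_simps)
    then have "(norm (p ?y + (?y - p ?y)))\<^sup>2 = (norm (p ?y))\<^sup>2 + (norm (?y - p ?y))\<^sup>2"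
      by (intro norm_add_Pythagorean) (simp add: orthogonal_def inner_eq_Re_cinner)
    moreover have "norm (?y - p ?y) \<le> d * norm ?y"
      using norm_swap_le[OF p e d, of ?y] by (simp add: proj_idem[OF e])
    then have "(norm (?y - p ?y))\<^sup>2 \<le> d\<^sup>2 * (norm ?y)\<^sup>2"
      by (metis norm_ge_zero power_mono power_mult_distrib)
    ultimately have "0 \<le> (norm (p ?y))\<^sup>2 - (1 - d\<^sup>2) * (norm ?y)\<^sup>2" by (simp add: algebra_simps)
    moreover have "cinner (((e o\<^sub>L (p o\<^sub>L e)) - (1 - d\<^sup>2) *\<^sub>R e) x) x =
        complex_of_real ((norm (p ?y))\<^sup>2 - (1 - d\<^sup>2) * (norm ?y)\<^sup>2)"
      unfolding minus_blinfun.rep_eq cinner_left.diff 1 scaleR_blinfun.rep_eq cinner.scaleR_left 2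
      by (simp add: scaleR_conv_of_real)
    ultimately show "cinner (((e o\<^sub>L (p o\<^sub>L e)) - (1 - d\<^sup>2) *\<^sub>R e) x) x \<in> \<real>\<^sub>\<ge>\<^sub>0"
      by (simp only: nonneg_Reals_of_real_iff)
  qed (intro scaleR_closed compose_closed M)+
  also have "\<tau> (e o\<^sub>L (p o\<^sub>L e)) = \<tau> ((p o\<^sub>L e) o\<^sub>L e)" by (intro trace_commute compose_closed M)
  also have "(p o\<^sub>L e) o\<^sub>L e = p o\<^sub>L (p o\<^sub>L e)"
    by (rule blinfun_eqI) (simp add: proj_idem[OF p] proj_idem[OF e])
  also have "\<tau> (p o\<^sub>L (p o\<^sub>L e)) = \<tau> ((p o\<^sub>L e) o\<^sub>L p)" by (intro trace_commute compose_closed M)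
  also have "Re (\<tau> ((p o\<^sub>L e) o\<^sub>L p)) \<le> Re (\<tau> p)"
  proof (rule trace_mono)
    fix x
    let ?y = "p x"
    have "cinner (((p o\<^sub>L e) o\<^sub>L p) x) x = complex_of_real ((norm (e ?y))\<^sup>2)"
      by (simp only: blinfun_apply_blinfun_compose proj_sym[OF p, of _ x] cinner_projection_self[OF e])
    moreover have "cinner (p x) x = complex_of_real ((norm ?y)\<^sup>2)"
      by (rule cinner_projection_self[OF p])
    ultimately have "cinner ((p - ((p o\<^sub>L e) o\<^sub>L p)) x) x = complex_of_real ((norm ?y)\<^sup>2 - (norm (e ?y))\<^sup>2)"
      by (simp only: minus_blinfun.rep_eq cinner_left.diff of_real_diff)
    moreover have "(norm (e ?y))\<^sup>2 \<le> (norm ?y)\<^sup>2"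
      by (intro power_mono projection_orth_norm_le[OF e bounded]) simp
    ultimately show "cinner ((p - ((p o\<^sub>L e) o\<^sub>L p)) x) x \<in> \<real>\<^sub>\<ge>\<^sub>0"
      by (simp add: nonneg_Reals_of_real_iff del: of_real_diff of_real_power)
  qed (intro compose_closed M)+
  finally show ?thesis using trace_scaleR[OF M(2)] by simp
qed

section \<open>Singular values along dyadic tails\<close>

lemma uop_norm_le: "0 \<le> c \<Longrightarrow> (\<And>x. \<exists>y. (x, y) \<in> A \<and> norm y \<le> c * norm x) \<Longrightarrow> uop_norm A \<le> ennreal c"
  unfolding uop_norm_def by (rule Inf_lower) blast

text \<open>The assumptions are what \<open>dyadic_projections_exist\<close> provides;
  \<open>e n\<close> is the tail of the resolution formed by the differences
  \<open>atom k\<close>.\<close>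

locale dyadic_resolution = tracial_vn_algebra M \<tau>
  for M :: "('h::complex_hilbert \<Rightarrow>\<^sub>L 'h) set" and \<tau> +
  fixes e :: "nat \<Rightarrow> 'h \<Rightarrow>\<^sub>L 'h"
  assumes e_zero: "e 0 = id_blinfun"
    and e_proj: "\<And>n. e n \<in> projections M"
    and e_trace: "\<And>n. \<tau> (e n) = 1 / 2 ^ n"
    and e_dec: "\<And>m n x. m \<le> n \<Longrightarrow> e m (e n x) = e n x"
    and e_lim: "\<And>x. (\<lambda>n. e n x) \<longlonglongrightarrow> 0"
begin

lemma e_dec': "m \<le> n \<Longrightarrow> e n (e m x) = e n x"
  by (rule cinner_eqI) (simp add: proj_sym[OF e_proj] e_dec)

definition atom :: "nat \<Rightarrow> 'h \<Rightarrow>\<^sub>L 'h" where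
  "atom n = e n - e (Suc n)"

lemma atom_in: "atom n \<in> projections M"
  unfolding atom_def by (intro projection_diff_closed e_proj e_dec) simp

lemma atom_e: "atom k (e n x) = (if n \<le> k then atom k x else 0)"
proof (cases "n \<le> k")
  case True
  then show ?thesis by (simp add: atom_def blinfun.bilinear_simps e_dec')
next
  case False
  then show ?thesis by (simp add: atom_def blinfun.bilinear_simps e_dec)
qed

sublocale orthogonal_resolution atom
proof
  show "atom n \<in> projections bounded_ops" for n
    using atom_in[of n] bounded by (auto simp: projections_def)
  show "atom m (atom n x) = 0" if "m \<noteq> n" for m n x
  proof -
    have "atom m (atom n x) = atom m (e n x) - atom m (e (Suc n) x)"
      by (simp add: atom_def[of n] blinfun.bilinear_simps)
    then show ?thesis using that by (auto simp: atom_e)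
  qed
  fix x
  have "(\<Sum>n<N. atom n x) = x - e N x" for N
    by (induction N) (simp_all add: e_zero atom_def blinfun.bilinear_simps)
  then show "(\<lambda>n. atom n x) sums x"
    using tendsto_diff[OF tendsto_const e_lim, of x x] by (simp add: sums_def)
qed

context
  fixes a :: "nat \<Rightarrow> real"
  assumes a: "\<And>n. 0 \<le> a n" "incseq a"
begin

text \<open>Removing the tail leaves the entries \<open>a 0\<close> to \<open>a n\<close>, the
  largest of which is \<open>a n\<close>.\<close>

lemma uop_norm_cutoff_le: "uop_norm {(x, y). (x - e (Suc n) x, y) \<in> diag a} \<le> ennreal (a n)"
proof (rule uop_norm_le[OF a(1)])
  fix x
  define y where "y = (\<Sum>k\<le>n. a k *\<^sub>R atom k x)"
  have y: "atom k y = (if k \<le> n then a k *\<^sub>R atom k x else 0)" for k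
    by (simp add: y_def blinfun.sum_right blinfun.bilinear_simps apply_apply
        if_distrib[of "\<lambda>y. _ *\<^sub>R y"] cong: if_cong)
  have "(x - e (Suc n) x, y) \<in> diag a"
    by (auto simp: diag_iff y blinfun.bilinear_simps atom_e)
  moreover have "(norm y)\<^sup>2 \<le> (a n)\<^sup>2 * (norm x)\<^sup>2"
  proof (rule sums_le[OF _ sums_norm2 sums_mult[OF sums_norm2]])
    fix k
    show "(norm (atom k y))\<^sup>2 \<le> (a n)\<^sup>2 * (norm (atom k x))\<^sup>2"
      using a incseqD[OF a(2), of k n] by (auto simp: y power_mult_distrib intro!: mult_right_mono power_mono)
  qed
  then have "(norm y)\<^sup>2 \<le> (a n * norm x)\<^sup>2" by (simp add: power_mult_distrib)
  then have "norm y \<le> a n * norm x" by (rule power2_le_imp_le) (simp add: a)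
  ultimately show "\<exists>y. (x, y) \<in> {(x, y). (x - e (Suc n) x, y) \<in> diag a} \<and> norm y \<le> a n * norm x" by blast
qed

text \<open>The entries of \<open>diag a\<close> on the tail \<open>e n\<close> are at least
  \<open>a n\<close>. A bound below \<open>a n / 4\<close> would therefore push the norm of
  \<open>e n (1 - q)\<close> down to 1/4 and, by \<open>trace_le_of_norm_le\<close>, the trace of
  \<open>q\<close> up to \<open>1 - 1/16\<close> of that of \<open>e n\<close>.\<close>

lemma le_uop_norm_cutoff:
  assumes q: "q \<in> projections M" and t: "Re (\<tau> q) < 15 / 16 / 2 ^ n"
  shows "ennreal (a n / 4) \<le> uop_norm {(x, y). (x - q x, y) \<in> diag a}"
  unfolding uop_norm_def
proof (rule Inf_greatest, clarify)
  fix c :: real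
  assume c: "0 \<le> c" "\<forall>x. \<exists>y. (x, y) \<in> {(x, y). (x - q x, y) \<in> diag a} \<and> norm y \<le> c * norm x"
  show "ennreal (a n / 4) \<le> ennreal c"
  proof (rule ccontr)
    assume "\<not> ?thesis"
    then have ca: "c < a n / 4" using c(1) by (metis ennreal_leI not_le)
    then have an: "0 < a n" using c(1) by simp
    have "norm (e n (x - q x)) \<le> 1/4 * norm x" for x
    proof -
      obtain y where y: "(x - q x, y) \<in> diag a" "norm y \<le> c * norm x" using c(2) by blast
      have "(a n)\<^sup>2 * (norm (e n (x - q x)))\<^sup>2 \<le> (norm y)\<^sup>2"
      proof (rule sums_le[OF _ sums_mult[OF sums_norm2] sums_norm2])
        fix k
        show "(a n)\<^sup>2 * (norm (atom k (e n (x - q x))))\<^sup>2 \<le> (norm (atom k y))\<^sup>2"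
          using y(1) a incseqD[OF a(2), of n k]
          by (auto simp: diag_iff atom_e power_mult_distrib intro!: mult_right_mono power_mono)
      qed
      then have "(a n * norm (e n (x - q x)))\<^sup>2 \<le> (norm y)\<^sup>2" by (simp add: power_mult_distrib)
      then have "a n * norm (e n (x - q x)) \<le> norm y" by (rule power2_le_imp_le) simp
      also have "\<dots> \<le> a n * (1/4 * norm x)"
        using y(2) mult_right_mono[OF less_imp_le[OF ca], of "norm x"] by simp
      finally show ?thesis using an by simp
    qed
    then have "(1 - (1/4)\<^sup>2) * Re (\<tau> (e n)) \<le> Re (\<tau> q)" by (rule trace_le_of_norm_le[OF q e_proj])
    moreover have "\<tau> (e n) = complex_of_real (1 / 2 ^ n)" by (simp add: e_trace)
    then have "Re (\<tau> (e n)) = 1 / 2 ^ n" by (simp only: Re_complex_of_real)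
    ultimately show False using t by (simp add: power2_eq_square)
  qed
qed

lemma mu_INF_finite:
  assumes "1 / 2 ^ Suc n \<le> t"
  shows "(INF p\<in>{p \<in> projections M. Re (\<tau> p) \<le> t}. uop_norm {(x, y). (x - blinfun_apply p x, y) \<in> diag a}) \<le> ennreal (a n)"
proof -
  have "\<tau> (e (Suc n)) = complex_of_real (1 / 2 ^ Suc n)" by (simp add: e_trace)
  then have "Re (\<tau> (e (Suc n))) = 1 / 2 ^ Suc n" by (simp only: Re_complex_of_real)
  then have "e (Suc n) \<in> {p \<in> projections M. Re (\<tau> p) \<le> t}" using assms e_proj by simp
  then show ?thesis by (rule INF_lower2) (rule uop_norm_cutoff_le)
qed

lemma mu_le: "1 / 2 ^ Suc n \<le> t \<Longrightarrow> mu M \<tau> t (diag a) \<le> a n"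
  unfolding mu_def using enn2real_mono[OF mu_INF_finite[of n t]] a(1)[of n] by simp

text \<open>\<open>enn2real\<close> sends \<infinity> to 0, so it respects an inequality only once
  the larger side is known to be finite.\<close>

lemma mu_INF_finite': "0 < t \<Longrightarrow>
    (INF p\<in>{p \<in> projections M. Re (\<tau> p) \<le> t}. uop_norm {(x, y). (x - blinfun_apply p x, y) \<in> diag a}) < top"
proof -
  assume "0 < t"
  then obtain n where "(1/2) ^ n < t" using real_arch_pow_inv[of t "1/2"] by auto
  moreover have "(1/2::real) ^ Suc n \<le> (1/2) ^ n" by simp
  ultimately have "1 / 2 ^ Suc n \<le> t" by (simp add: power_one_over)
  from mu_INF_finite[OF this] show ?thesis
    by (rule order.strict_trans1) simp
qed

lemma le_mu:
  assumes t: "0 < t" "t < 15 / 16 / 2 ^ n"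
  shows "a n / 4 \<le> mu M \<tau> t (diag a)"
proof -
  have "ennreal (a n / 4) \<le> (INF p\<in>{p \<in> projections M. Re (\<tau> p) \<le> t}. uop_norm {(x, y). (x - blinfun_apply p x, y) \<in> diag a})"
    by (rule INF_greatest, rule le_uop_norm_cutoff) (use t in auto)
  from enn2real_mono[OF this mu_INF_finite'[OF t(1)]] show ?thesis
    unfolding mu_def using a(1)[of n] by simp
qed

lemma mu_antimono:
  assumes "0 < s" "s \<le> t"
  shows "mu M \<tau> t (diag a) \<le> mu M \<tau> s (diag a)"
  unfolding mu_def
proof (rule enn2real_mono[OF _ mu_INF_finite'[OF assms(1)]])
  show "(INF p\<in>{p \<in> projections M. Re (\<tau> p) \<le> t}. uop_norm {(x, y). (x - blinfun_apply p x, y) \<in> diag a})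
    \<le> (INF p\<in>{p \<in> projections M. Re (\<tau> p) \<le> s}. uop_norm {(x, y). (x - blinfun_apply p x, y) \<in> diag a})"
    by (rule INF_superset_mono) (use assms in auto)
qed

end

lemma mu_nonneg: "0 \<le> mu M \<tau> t A"
  by (simp add: mu_def)

text \<open>Covering every real \<open>t\<close> makes the singular value function literally the
  zero function, which belongs to each Calkin space.\<close>

lemma mu_diag_zero: "mu M \<tau> t (diag (\<lambda>_. 0)) = 0"
proof (cases "0 \<le> t")
  case True
  have 0: "(0 :: 'h \<Rightarrow>\<^sub>L 'h) \<in> {p \<in> projections M. Re (\<tau> p) \<le> t}"
    using True zero_closed by (auto simp: trace_zero intro!: projectionsI simp: cinner_simps)
  have "uop_norm {(x, y). (x - blinfun_apply 0 x, y) \<in> diag (\<lambda>_. 0)} \<le> ennreal 0"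
    by (rule uop_norm_le) (auto simp: diag_iff intro: exI[of _ 0])
  with 0 have "(INF p\<in>{p \<in> projections M. Re (\<tau> p) \<le> t}. uop_norm {(x, y). (x - blinfun_apply p x, y) \<in> diag (\<lambda>_. 0)}) \<le> ennreal 0"
    by (rule INF_lower2)
  then show ?thesis by (simp add: mu_def)
next
  case False
  \<comment> \<open>No projection has negative trace, so the infimum runs over the empty set; it is
    \<infinity>, which \<open>enn2real\<close> turns into 0.\<close>
  have "\<not> Re (\<tau> p) \<le> t" if "p \<in> projections M" for p
    using trace_projection_nonneg[OF that] False by (simp add: complex_nonneg_Reals_iff)
  then have "{p \<in> projections M. Re (\<tau> p) \<le> t} = {}" by blast
  then show ?thesis unfolding mu_def by (simp only: image_empty Inf_empty) simp
qed

end

section \<open>Calkin function spaces\<close>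

lemma finite_measure_lebesgue_on_01: "finite_measure (lebesgue_on {0..1::real})"
  by (rule finite_measure_lebesgue_on) simp

lemma measure_lebesgue_on_01:
  "A \<subseteq> {0..1::real} \<Longrightarrow> measure (lebesgue_on {0..1}) A = measure lebesgue A"
  by (rule measure_restrict_space) auto

lemma measure_lebesgue_on_01_le_interval:
  assumes "A \<subseteq> {x..y}" "0 \<le> x" "x \<le> y" "y \<le> (1::real)"
  shows "measure (lebesgue_on {0..1}) A \<le> y - x"
proof -
  have "measure (lebesgue_on {0..1}) A \<le> measure (lebesgue_on {0..1}) {x..y}"
    by (rule finite_measure.finite_measure_mono[OF finite_measure_lebesgue_on_01])
      (use assms in \<open>auto simp: sets_restrict_space\<close>)
  also have "\<dots> = y - x" using assms by (simp add: measure_lebesgue_on_01)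
  finally show ?thesis .
qed

lemma superlevel_measurable:
  assumes "f \<in> borel_measurable (lebesgue_on {0..1::real})"
  shows "{u \<in> {0..1}. s < cmod (f u)} \<in> sets (lebesgue_on {0..1})"
proof -
  have "{u \<in> space (lebesgue_on {0..1}). s < cmod (f u)} \<in> sets (lebesgue_on {0..1})"
    using assms by measurable
  then show ?thesis by simp
qed

lemma rearrangement_le:
  assumes "0 \<le> s" "measure (lebesgue_on {0..1}) {u\<in>{0..1}. s < cmod (f u)} \<le> t"
  shows "rearrangement f t \<le> s"
  unfolding rearrangement_def by (rule cInf_lower) (use assms in \<open>auto intro!: bdd_belowI[of _ 0]\<close>)

text \<open>The infimum says something only over a nonempty set. The sets where
  \<open>cmod (f u)\<close> exceeds \<open>n\<close> decrease to the empty set, so for large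
  \<open>n\<close> their measure is below the positive number \<open>t\<close>.\<close>

lemma le_rearrangement:
  assumes f: "f \<in> borel_measurable (lebesgue_on {0..1})" and t: "0 < t"
    and le: "\<And>s. 0 \<le> s \<Longrightarrow> measure (lebesgue_on {0..1}) {u\<in>{0..1}. s < cmod (f u)} \<le> t \<Longrightarrow> x \<le> s"
  shows "x \<le> rearrangement f t"
  unfolding rearrangement_def
proof (rule cInf_greatest)
  let ?A = "\<lambda>n::nat. {u\<in>{0..1}. real n < cmod (f u)}"
  have "(\<lambda>n. measure (lebesgue_on {0..1}) (?A n)) \<longlonglongrightarrow> measure (lebesgue_on {0..1}) (\<Inter>n. ?A n)"
  proof (rule finite_measure.finite_Lim_measure_decseq[OF finite_measure_lebesgue_on_01])
    show "range ?A \<subseteq> sets (lebesgue_on {0..1})" using superlevel_measurable[OF f] by blast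
    show "decseq ?A" by (rule decseq_SucI) auto
  qed
  moreover have "(\<Inter>n. ?A n) = {}"
  proof (intro equals0I)
    fix u assume u: "u \<in> (\<Inter>n. ?A n)"
    obtain n where "cmod (f u) < real n" using reals_Archimedean2 by blast
    moreover have "real n < cmod (f u)" using u by blast
    ultimately show False by simp
  qed
  ultimately have "(\<lambda>n. measure (lebesgue_on {0..1}) (?A n)) \<longlonglongrightarrow> 0" by simp
  then have "\<forall>\<^sub>F n in sequentially. measure (lebesgue_on {0..1}) (?A n) < t"
    using t by (rule order_tendstoD)
  then obtain n where "measure (lebesgue_on {0..1}) (?A n) < t"
    using eventually_happens by fastforce
  then have "real n \<in> {s. 0 \<le> s \<and> measure (lebesgue_on {0..1}) {u\<in>{0..1}. s < cmod (f u)} \<le> t}" by simp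
  then show "{s. 0 \<le> s \<and> measure (lebesgue_on {0..1}) {u\<in>{0..1}. s < cmod (f u)} \<le> t} \<noteq> {}" by blast
qed (use le in auto)

lemma rearrangement_nonneg:
  "f \<in> borel_measurable (lebesgue_on {0..1}) \<Longrightarrow> 0 < t \<Longrightarrow> 0 \<le> rearrangement f t"
  by (rule le_rearrangement)

lemma rearrangement_antimono:
  "f \<in> borel_measurable (lebesgue_on {0..1}) \<Longrightarrow> 0 < s \<Longrightarrow> s \<le> t \<Longrightarrow>
    rearrangement f t \<le> rearrangement f s"
  by (rule le_rearrangement) (auto intro: rearrangement_le)

text \<open>Rearrangements and \<open>mu\<close> are known to be decreasing on the positive reals
  only; the other values are replaced by 0.\<close>

lemma borel_measurable_antimono_pos:
  fixes m :: "real \<Rightarrow> real"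
  assumes m: "\<And>s t. 0 < s \<Longrightarrow> s \<le> t \<Longrightarrow> m t \<le> m s"
  shows "(\<lambda>t. if 0 < t then m t else 0) \<in> borel_measurable borel"
proof -
  have "mono_on {0<..} (\<lambda>t. - m t)" by (rule mono_onI) (use m in auto)
  then have "(\<lambda>t. - m t) \<in> borel_measurable (restrict_space borel {0<..})"
    by (rule borel_measurable_mono_on_fnc)
  then have "(\<lambda>t. - (- m t)) \<in> borel_measurable (restrict_space borel {0<..})"
    by (rule borel_measurable_uminus)
  then have "(\<lambda>t. if t \<in> {0<..} then m t else 0) \<in> borel_measurable borel"
    by (subst (asm) measurable_restrict_space_iff[where c = 0]) (auto cong: if_cong)
  then show ?thesis by (simp cong: if_cong)
qed

lemma borel_measurable_lebesgue_on_01: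
  "f \<in> borel_measurable borel \<Longrightarrow> (\<lambda>t. complex_of_real (f t)) \<in> borel_measurable (lebesgue_on {0..1})"
  by (intro measurable_restrict_space1 measurable_completion) simp

text \<open>On the unit interval the replacement changes \<open>m\<close> at the single point
  0.\<close>

lemma measurable_antimono_pos:
  fixes m :: "real \<Rightarrow> real"
  assumes m: "\<And>s t. 0 < s \<Longrightarrow> s \<le> t \<Longrightarrow> m t \<le> m s"
  shows "(\<lambda>t. complex_of_real (m t)) \<in> borel_measurable (lebesgue_on {0..1})"
proof (rule measurable_discrete_difference[where X = "{0}"])
  show "(\<lambda>t. complex_of_real (if 0 < t then m t else 0)) \<in> borel_measurable (lebesgue_on {0..1})"
    by (intro borel_measurable_lebesgue_on_01 borel_measurable_antimono_pos m)
qed (auto simp: sets_restrict_space)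

section \<open>Rearrangements of decreasing functions\<close>

context
  fixes m :: "real \<Rightarrow> real"
  assumes nonneg: "\<And>t. 0 < t \<Longrightarrow> 0 \<le> m t" and antimono: "\<And>s t. 0 < s \<Longrightarrow> s \<le> t \<Longrightarrow> m t \<le> m s"
begin

lemma rearrangement_antimono_le:
  assumes t: "0 < t" "t < 1"
  shows "rearrangement (\<lambda>t. complex_of_real (m t)) t \<le> m t"
proof (rule rearrangement_le)
  have "{u\<in>{0..1}. m t < cmod (complex_of_real (m u))} \<subseteq> {0..t}"
  proof clarify
    fix u assume u: "u \<in> {0..1}" "m t < cmod (complex_of_real (m u))"
    have "u \<le> t"
    proof (rule ccontr)
      assume "\<not> u \<le> t"
      then have "m u \<le> m t" "0 \<le> m u" using antimono[of t u] nonneg[of u] t by auto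
      then show False using u by simp
    qed
    then show "u \<in> {0..t}" using u by simp
  qed
  from measure_lebesgue_on_01_le_interval[OF this]
  show "measure (lebesgue_on {0..1}) {u\<in>{0..1}. m t < cmod (complex_of_real (m u))} \<le> t" using t by simp
qed (use nonneg t in auto)

text \<open>A decreasing function can differ from its rearrangement at jumps; the strict inequality
  between \<open>s\<close> and \<open>t\<close> steps over them.\<close>

lemma le_rearrangement_antimono:
  assumes t: "0 < s" "s < t" "t < 1"
  shows "m t \<le> rearrangement (\<lambda>t. complex_of_real (m t)) s"
proof (rule le_rearrangement[OF measurable_antimono_pos[OF antimono] t(1)])
  fix r assume r: "0 \<le> r" "measure (lebesgue_on {0..1}) {u\<in>{0..1}. r < cmod (complex_of_real (m u))} \<le> s"
  show "m t \<le> r"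
  proof (rule ccontr)
    assume "\<not> m t \<le> r"
    have "t = measure (lebesgue_on {0..1}) {0<..t}" using t by (simp add: measure_lebesgue_on_01 subset_iff)
    also have "\<dots> \<le> measure (lebesgue_on {0..1}) {u\<in>{0..1}. r < cmod (complex_of_real (m u))}"
    proof (rule finite_measure.finite_measure_mono[OF finite_measure_lebesgue_on_01])
      show "{0<..t} \<subseteq> {u\<in>{0..1}. r < cmod (complex_of_real (m u))}"
      proof
        fix u assume u: "u \<in> {0<..t}"
        then have "m t \<le> m u" using antimono[of u t] by simp
        then show "u \<in> {u\<in>{0..1}. r < cmod (complex_of_real (m u))}" using u t \<open>\<not> m t \<le> r\<close> by auto
      qed
    qed (rule superlevel_measurable[OF measurable_antimono_pos[OF antimono]])
    finally show False using r t by simp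
  qed
qed

end

section \<open>Closure properties of Calkin function spaces\<close>

context
  fixes G
  assumes G: "calkin_function_space G"
begin

lemma calkin_function_space_measurable: "f \<in> G \<Longrightarrow> f \<in> borel_measurable (lebesgue_on {0..1})"
  using G unfolding calkin_function_space_def by (elim conjE) (rule subsetD)

lemma calkin_function_space_zero: "(\<lambda>t. 0) \<in> G"
  using G unfolding calkin_function_space_def by (elim conjE) assumption

lemma calkin_function_space_add: "f \<in> G \<Longrightarrow> g \<in> G \<Longrightarrow> (\<lambda>t. f t + g t) \<in> G"
  using G unfolding calkin_function_space_def by (elim conjE) blast

lemma calkin_function_space_scale: "f \<in> G \<Longrightarrow> (\<lambda>t. c * f t) \<in> G"
  using G unfolding calkin_function_space_def by (elim conjE) blast

lemma calkin_function_space_ideal: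
  assumes f: "f \<in> borel_measurable (lebesgue_on {0..1})" and g: "g \<in> G"
    and le: "\<And>t. 0 < t \<Longrightarrow> t < 1 \<Longrightarrow> rearrangement f t \<le> rearrangement g t"
  shows "f \<in> G"
proof -
  have "\<forall>f \<in> borel_measurable (lebesgue_on {0..1}). \<forall>g\<in>G.
      (\<forall>t\<in>{0<..<1}. rearrangement f t \<le> rearrangement g t) \<longrightarrow> f \<in> G"
    using G unfolding calkin_function_space_def by (elim conjE) assumption
  then show ?thesis using f g le by (meson greaterThanLessThan_iff)
qed

end

text \<open>Two disjoint copies of the decreasing rearrangement of \<open>g\<close> on the two halves of the unit
  interval have a sum whose rearrangement is a dilation of that of \<open>g\<close> by almost the factor two.\<close>

lemma calkin_function_space_dilation:
  assumes G: "calkin_function_space G" and g: "g \<in> G" and k: "k \<in> borel_measurable (lebesgue_on {0..1})"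
    and le: "\<And>t. 0 < t \<Longrightarrow> t < 1 \<Longrightarrow> rearrangement k t \<le> rearrangement g (9 / 16 * t)"
  shows "k \<in> G"
proof -
  define h where "h = rearrangement g"
  have gm: "g \<in> borel_measurable (lebesgue_on {0..1})" by (rule calkin_function_space_measurable[OF G g])
  have h0: "0 \<le> h t" if "0 < t" for t unfolding h_def by (rule rearrangement_nonneg[OF gm that])
  have ha: "h t \<le> h s" if "0 < s" "s \<le> t" for s t unfolding h_def by (rule rearrangement_antimono[OF gm that])
  define H where "H t = (if 0 < t then h t else 0)" for t
  have H: "H \<in> borel_measurable borel" unfolding H_def by (rule borel_measurable_antimono_pos[OF ha])
  define A where "A t = (if t < 1/2 then H t else 0)" for t
  define B where "B t = (if 1/2 < t then H (t - 1/2) else 0)" for t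
  have Am: "A \<in> borel_measurable borel" unfolding A_def using H by measurable
  have Bm: "B \<in> borel_measurable borel" unfolding B_def using H by measurable
  have A0: "0 \<le> A t" and B0: "0 \<le> B t" for t using h0 by (auto simp: A_def B_def H_def)
  have AG: "(\<lambda>t. complex_of_real (A t)) \<in> G"
  proof (rule calkin_function_space_ideal[OF G borel_measurable_lebesgue_on_01[OF Am] g])
    fix t :: real assume t: "0 < t" "t < 1"
    have "rearrangement (\<lambda>t. complex_of_real (A t)) t \<le> h t"
    proof (rule rearrangement_le[OF h0[OF t(1)]])
      have "{u\<in>{0..1}. h t < cmod (complex_of_real (A u))} \<subseteq> {0..t}"
      proof clarify
        fix u assume u: "u \<in> {0..1}" "h t < cmod (complex_of_real (A u))"
        have "u \<le> t"
        proof (rule ccontr)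
          assume "\<not> u \<le> t"
          then have "A u \<le> h t" using ha[of t u] h0[of t] t by (simp add: A_def H_def)
          then show False using u A0[of u] by simp
        qed
        then show "u \<in> {0..t}" using u by simp
      qed
      from measure_lebesgue_on_01_le_interval[OF this]
      show "measure (lebesgue_on {0..1}) {u\<in>{0..1}. h t < cmod (complex_of_real (A u))} \<le> t" using t by simp
    qed
    then show "rearrangement (\<lambda>t. complex_of_real (A t)) t \<le> rearrangement g t" by (simp add: h_def)
  qed
  have BG: "(\<lambda>t. complex_of_real (B t)) \<in> G"
  proof (rule calkin_function_space_ideal[OF G borel_measurable_lebesgue_on_01[OF Bm] g])
    fix t :: real assume t: "0 < t" "t < 1"
    have "rearrangement (\<lambda>t. complex_of_real (B t)) t \<le> h t"
    proof (rule rearrangement_le[OF h0[OF t(1)]])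
      have "{u\<in>{0..1}. h t < cmod (complex_of_real (B u))} \<subseteq> {1/2..min 1 (1/2 + t)}"
      proof clarify
        fix u assume u: "u \<in> {0..1}" "h t < cmod (complex_of_real (B u))"
        have "1/2 < u"
          using u h0[OF t(1)] by (auto simp: B_def split: if_splits)
        moreover have "u \<le> 1/2 + t"
        proof (rule ccontr)
          assume "\<not> u \<le> 1/2 + t"
          then have "B u \<le> h t" using ha[of t "u - 1/2"] h0[of t] t by (simp add: B_def H_def)
          then show False using u B0[of u] by simp
        qed
        ultimately show "u \<in> {1/2..min 1 (1/2 + t)}" using u by simp
      qed
      from measure_lebesgue_on_01_le_interval[OF this]
      show "measure (lebesgue_on {0..1}) {u\<in>{0..1}. h t < cmod (complex_of_real (B u))} \<le> t" using t by simp
    qed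
    then show "rearrangement (\<lambda>t. complex_of_real (B t)) t \<le> rearrangement g t" by (simp add: h_def)
  qed
  have ABG: "(\<lambda>t. complex_of_real (A t) + complex_of_real (B t)) \<in> G"
    by (rule calkin_function_space_add[OF G AG BG])
  show ?thesis
  proof (rule calkin_function_space_ideal[OF G k ABG])
    fix t :: real assume t: "0 < t" "t < 1"
    have "h (9 / 16 * t) \<le> rearrangement (\<lambda>t. complex_of_real (A t) + complex_of_real (B t)) t"
    proof (rule le_rearrangement[OF calkin_function_space_measurable[OF G ABG] t(1)])
      fix s assume s: "0 \<le> s"
        "measure (lebesgue_on {0..1}) {u\<in>{0..1}. s < cmod (complex_of_real (A u) + complex_of_real (B u))} \<le> t"
      show "h (9 / 16 * t) \<le> s"
      proof (rule ccontr)
        assume hs: "\<not> h (9 / 16 * t) \<le> s"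
        \<comment> \<open>Each copy has only half of the unit interval, hence the cap at 1/2.
          Together the copies exceed the level \<open>s\<close> on a set of measure
          \<open>2 * r\<close>, which is more than \<open>t\<close> since 9/8 > 1 and
          \<open>t < 1\<close>.\<close>
        define r where "r = min (9 / 16 * t) (1/2)"
        have r: "0 < r" "r \<le> 1/2" "r \<le> 9 / 16 * t" "t < 2 * r" using t by (auto simp: r_def)
        have hr: "s < h u" if "0 < u" "u < r" for u using ha[of u "9 / 16 * t"] that hs r by simp
        have "2 * r = measure (lebesgue_on {0..1}) {0<..<r} + measure (lebesgue_on {0..1}) {1/2<..<1/2 + r}"
          using r by (simp add: measure_lebesgue_on_01 subset_iff)
        also have "\<dots> = measure (lebesgue_on {0..1}) ({0<..<r} \<union> {1/2<..<1/2 + r})"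
          by (rule finite_measure.finite_measure_Union[OF finite_measure_lebesgue_on_01, symmetric])
            (use r in \<open>auto simp: sets_restrict_space_iff\<close>)
        also have "\<dots> \<le> measure (lebesgue_on {0..1}) {u\<in>{0..1}. s < cmod (complex_of_real (A u) + complex_of_real (B u))}"
        proof (rule finite_measure.finite_measure_mono[OF finite_measure_lebesgue_on_01])
          show "{0<..<r} \<union> {1/2<..<1/2 + r} \<subseteq> {u\<in>{0..1}. s < cmod (complex_of_real (A u) + complex_of_real (B u))}"
          proof
            fix u assume u: "u \<in> {0<..<r} \<union> {1/2<..<1/2 + r}"
            then have "s < A u + B u"
              using r hr[of u] hr[of "u - 1/2"] by (auto simp: A_def B_def H_def)
            also have "\<dots> = cmod (complex_of_real (A u + B u))" using A0[of u] B0[of u]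
              by (simp only: norm_of_real abs_of_nonneg add_nonneg_nonneg)
            finally show "u \<in> {u\<in>{0..1}. s < cmod (complex_of_real (A u) + complex_of_real (B u))}"
              using u r by auto
          qed
        qed (rule superlevel_measurable[OF calkin_function_space_measurable[OF G ABG]])
        finally show False using s r by simp
      qed
    qed
    then show "rearrangement k t \<le> rearrangement (\<lambda>t. complex_of_real (A t) + complex_of_real (B t)) t"
      using le[OF t] by (simp add: h_def)
  qed
qed

lemma dyadic_interval:
  assumes "0 < s" "s < (1::real)"
  shows "\<exists>n. 1 / 2 ^ Suc n \<le> s \<and> s < 1 / 2 ^ n"
proof -
  obtain k where "(1/2) ^ k < s" using real_arch_pow_inv[of s "1/2"] assms by auto
  then have ex: "1 / 2 ^ k \<le> s" by (simp add: power_one_over)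
  define N where "N = (LEAST k. 1 / 2 ^ k \<le> s)"
  have N: "1 / 2 ^ N \<le> s" unfolding N_def by (rule LeastI[of _ k]) (rule ex)
  then have "N \<noteq> 0" using assms by (intro notI) simp
  then obtain n where n: "N = Suc n" using not0_implies_Suc by blast
  then have "\<not> 1 / 2 ^ n \<le> s" unfolding N_def by (intro not_less_Least) simp
  then show ?thesis using N n by (intro exI[of _ n]) simp
qed

text \<open>The constants \<open>3/4\<close> and \<open>15/16\<close> (the latter is \<open>1 - (1/4)\<^sup>2\<close>) are such that passing from \<open>f\<^sup>*\<close>
  to \<open>m\<close> and back costs a dilation by less than two each time.\<close>

lemma dyadic_comparison:
  assumes E: "calkin_function_space E" and F: "calkin_function_space F" and f: "f \<in> F" "f \<notin> E"
    and m0: "\<And>t. 0 < t \<Longrightarrow> 0 \<le> m t" and ma: "\<And>s t. 0 < s \<Longrightarrow> s \<le> t \<Longrightarrow> m t \<le> m s"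
    and upper: "\<And>n t. 1 / 2 ^ Suc n \<le> t \<Longrightarrow> m t \<le> rearrangement f (3 / 4 / 2 ^ n)"
    and lower: "\<And>n t. 0 < t \<Longrightarrow> t < 15 / 16 / 2 ^ n \<Longrightarrow> rearrangement f (3 / 4 / 2 ^ n) / 4 \<le> m t"
  shows "(\<lambda>t. complex_of_real (m t)) \<in> F" and "(\<lambda>t. complex_of_real (m t)) \<notin> E"
proof -
  have fm: "f \<in> borel_measurable (lebesgue_on {0..1})" by (rule calkin_function_space_measurable[OF F f(1)])
  show "(\<lambda>t. complex_of_real (m t)) \<in> F"
  proof (rule calkin_function_space_dilation[OF F f(1) measurable_antimono_pos[OF ma]])
    fix t :: real assume t: "0 < t" "t < 1"
    obtain n where n: "1 / 2 ^ Suc n \<le> t" "t < 1 / 2 ^ n" using dyadic_interval[OF t] by blast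
    have "rearrangement (\<lambda>t. complex_of_real (m t)) t \<le> m t" by (rule rearrangement_antimono_le[OF m0 ma t])
    also have "\<dots> \<le> rearrangement f (3 / 4 / 2 ^ n)" by (rule upper[OF n(1)])
    also have "\<dots> \<le> rearrangement f (9 / 16 * t)"
      by (rule rearrangement_antimono[OF fm]) (use t n(2) in auto)
    finally show "rearrangement (\<lambda>t. complex_of_real (m t)) t \<le> rearrangement f (9 / 16 * t)" .
  qed
  show "(\<lambda>t. complex_of_real (m t)) \<notin> E"
  proof
    assume "(\<lambda>t. complex_of_real (m t)) \<in> E"
    then have "(\<lambda>t. 4 * complex_of_real (m t)) \<in> E" by (rule calkin_function_space_scale[OF E])
    then have mE: "(\<lambda>t. complex_of_real (4 * m t)) \<in> E" by simp
    have "f \<in> E"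
    proof (rule calkin_function_space_dilation[OF E mE fm])
      fix s :: real assume s: "0 < s" "s < 1"
      \<comment> \<open>The factor 2/3 selects \<open>n\<close> such that
        \<open>3 / 4 / 2 ^ n \<le> s\<close> and \<open>5 / 8 * s < 15 / 16 / 2 ^ n\<close>: the
        first is for monotonicity of the rearrangement, the second for \<open>lower\<close>.\<close>
      obtain n where n: "1 / 2 ^ Suc n \<le> 2 / 3 * s" "2 / 3 * s < 1 / 2 ^ n"
        using dyadic_interval[of "2 / 3 * s"] s by auto
      have "rearrangement f s \<le> rearrangement f (3 / 4 / 2 ^ n)"
        by (rule rearrangement_antimono[OF fm]) (use n(1) in auto)
      also have "\<dots> \<le> 4 * m (5 / 8 * s)" using lower[of "5 / 8 * s" n] s n(2) by simp
      \<comment> \<open>The gap between 9/16 and 5/8 provides the strict inequality in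
        \<open>le_rearrangement_antimono\<close>.\<close>
      also have "\<dots> \<le> rearrangement (\<lambda>t. complex_of_real (4 * m t)) (9 / 16 * s)"
        by (rule le_rearrangement_antimono) (use m0 ma s in auto)
      finally show "rearrangement f s \<le> rearrangement (\<lambda>t. complex_of_real (4 * m t)) (9 / 16 * s)" .
    qed
    then show False using f(2) by contradiction
  qed
qed

section \<open>The determinants differ\<close>

theorem proposition3p2:
  fixes M :: "('h::complex_hilbert \<Rightarrow>\<^sub>L 'h) set"
    and \<tau> :: "('h \<Rightarrow>\<^sub>L 'h) \<Rightarrow> complex"
    and E F :: "(real \<Rightarrow> complex) set"
    and \<psi> \<phi> :: "'h uop \<Rightarrow> complex"
  assumes "II1_factor M" and "separable_predual M" and "tracial_state M \<tau>"
    and "calkin_function_space E" and "calkin_function_space F" and "E \<subset> F"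
    and "positive_trace_on M \<tau> F \<psi>"
    and "positive_trace_on M \<tau> E \<phi>"
  shows "restrict (det_tr M \<tau> F \<psi>) (log_bimodule M \<tau> E) \<noteq> det_tr M \<tau> E \<phi>"
proof -
  obtain f where f: "f \<in> F" "f \<notin> E" using \<open>E \<subset> F\<close> by blast
  have fm: "f \<in> borel_measurable (lebesgue_on {0..1})"
    by (rule calkin_function_space_measurable[OF \<open>calkin_function_space F\<close> f(1)])
  obtain e :: "nat \<Rightarrow> 'h \<Rightarrow>\<^sub>L 'h" where e: "e 0 = id_blinfun" "\<And>n. e n \<in> projections M" "\<And>n. \<tau> (e n) = 1 / 2 ^ n"
    "\<And>m n x. m \<le> n \<Longrightarrow> blinfun_apply (e m) (e n x) = e n x" "\<And>x. (\<lambda>n. e n x) \<longlonglongrightarrow> 0"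
    using dyadic_projections_exist[OF assms(1,3)] by blast
  interpret dyadic_resolution M \<tau> e
    using assms(1,3) e by unfold_locales (auto simp: II1_factor_def factor_def)
  \<comment> \<open>The constant 3/4 lies above 1/2, which keeps the dilation in the upper bound
    below two, and below 15/16, which does the same for the lower bound.\<close>
  define a where "a n = rearrangement f (3 / 4 / 2 ^ n)" for n :: nat
  have a0: "0 \<le> a n" for n unfolding a_def by (rule rearrangement_nonneg[OF fm]) simp
  have ainc: "incseq a" unfolding a_def
    by (rule incseq_SucI) (rule rearrangement_antimono[OF fm]; simp add: field_simps)
  define t where "t n = exp (- a n)" for n
  have t: "0 \<le> t n" "t n \<le> 1" "t n \<noteq> 0" for n using a0 by (simp_all add: t_def)
  define T where "T = diag t"
  have aff: "diag b \<in> affiliated_ops M" for b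
    by (rule affiliated_diag) (use vn_algebra_axioms atom_in projection_mem in auto)
  have absT: "uop_abs T = T" unfolding T_def by (rule uop_abs_diag) (rule t)+
  have meas: "log_plus \<in> borel_measurable borel" "log_minus \<in> borel_measurable borel"
    unfolding log_plus_def log_minus_def by measurable
  have plus: "fun_calc log_plus (uop_abs T) = diag (\<lambda>_. 0)"
    unfolding absT unfolding T_def fun_calc_diag[OF meas(1)] using a0 by (simp add: log_plus_def t_def max_def)
  have minus: "fun_calc log_minus (uop_abs T) = diag a"
    unfolding absT unfolding T_def fun_calc_diag[OF meas(2)] using a0 by (simp add: log_minus_def t_def min_def)
  \<comment> \<open>\<open>log_plus\<close> turns \<open>T\<close> into the zero operator, so
    \<open>T\<close> belongs to both logarithmic bimodules. The determinants are extensional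
    functions and take their intended values only there.\<close>
  have logE: "T \<in> log_bimodule M \<tau> E" and logF: "T \<in> log_bimodule M \<tau> F"
    using aff[of t, folded T_def] aff[of "\<lambda>_. 0"] assms(4,5)
    by (simp_all add: log_bimodule_def plus bimodule_def mu_diag_zero calkin_function_space_zero)
  note cmp = dyadic_comparison[OF assms(4,5) f, of "\<lambda>t. mu M \<tau> t (diag a)", folded a_def,
      OF mu_nonneg mu_antimono[OF a0 ainc] mu_le[OF a0 ainc] le_mu[OF a0 ainc]]
  have inF: "diag a \<in> bimodule M \<tau> F" and notE: "diag a \<notin> bimodule M \<tau> E"
    using cmp aff by (simp_all add: bimodule_def)
  have "{x. (x, 0) \<in> T} = {0}" unfolding T_def by (rule kernel_diag[OF t(3)])
  then have "det_tr M \<tau> F \<psi> T \<noteq> 0" "det_tr M \<tau> E \<phi> T = 0"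
    using logE logF inF notE by (simp_all add: det_tr_def minus)
  then show ?thesis using logE by (metis restrict_apply')
qed

end
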